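(* Let $C$ be an elliptic curve over $\mathbb{C}$, let $P,Q\in C$ be closed points, let $a\le b$ be integers, and let $E=\mathcal{O}_C(aP)\oplus\mathcal{O}_C(bQ)$. If $a\le1$, then $$\mathbf{R}(E)=\begin{cases}\emptyset & \text{if } b<2;\\ \mathbb{P}^{b-1} & \text{if } b\ge2.\end{cases}$$
   Context: We work over $\mathbb{C}$. An elliptic curve is a smooth projective (irreducible) curve of genus $1$. For a vector space $V$, $\mathbb{P}V$ denotes the projective space of one-dimensional subspaces of $V$. For a vector bundle $E$ of rank at least two on a smooth projective curve $C$, let $d_2:\bigwedge^2H^0(C,E)\to H^0(C,\bigwedge^2E)$ be the second determinant map, $s\wedge t\mapsto (x\mapsto s(x)\wedge t(x))$. The (projectivized) resonance variety of $E$ is $$\mathbf{R}(E)=\{[s]\in\mathbb{P}H^0(C,E) : \exists\, t\in H^0(C,E)\text{ with } 0\ne s\wedge t\in\ker(d_2)\},$$ i.e. the locus of classes of sections $s$ for which there is a section $t$, linearly independent from $s$, such that $s,t$ generate a rank-one subsheaf of $E$. The equality $\mathbf{R}(E)=\mathbb{P}^{b-1}$ is understood as an identification (isomorphism) of varieties. *)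

theory Defs
  imports "HOL-Analysis.Analysis" "HOL-Library.Function_Algebras"
begin

section \<open>Complex vector spaces\<close>

class cvector = ab_group_add +
  fixes cscale :: "complex \<Rightarrow> 'a \<Rightarrow> 'a"  (infixr "*\<^sub>C" 75)
  assumes cscale_add_right: "c *\<^sub>C (x + y) = c *\<^sub>C x + c *\<^sub>C y"
    and cscale_add_left: "(c + d) *\<^sub>C x = c *\<^sub>C x + d *\<^sub>C x"
    and cscale_cscale: "c *\<^sub>C d *\<^sub>C x = (c * d) *\<^sub>C x"
    and cscale_one: "1 *\<^sub>C x = x"

global_interpretation cvec: vector_space "(*\<^sub>C) :: complex \<Rightarrow> 'a \<Rightarrow> 'a::cvector"
  by unfold_locales (simp_all add: cscale_add_right cscale_add_left cscale_cscale cscale_one)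

instantiation complex :: cvector
begin
definition cscale_complex :: "complex \<Rightarrow> complex \<Rightarrow> complex"
  where "cscale_complex c x = c * x"
instance by standard (simp_all add: cscale_complex_def algebra_simps)
end

instantiation "fun" :: (type, cvector) cvector
begin
definition cscale_fun :: "complex \<Rightarrow> ('a \<Rightarrow> 'b) \<Rightarrow> 'a \<Rightarrow> 'b"
  where "cscale_fun c f = (\<lambda>x. c *\<^sub>C f x)"
instance
  by standard (simp_all add: cscale_fun_def fun_eq_iff cscale_add_right cscale_add_left
      cscale_cscale cscale_one)
end

instantiation prod :: (cvector, cvector) cvector
begin
definition cscale_prod :: "complex \<Rightarrow> 'a \<times> 'b \<Rightarrow> 'a \<times> 'b"
  where "cscale_prod c x = (c *\<^sub>C fst x, c *\<^sub>C snd x)"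
instance
  by standard (simp_all add: cscale_prod_def prod_eq_iff cscale_add_right cscale_add_left
      cscale_cscale cscale_one)
end


section \<open>Projective varieties\<close>

definition proj :: "'v::cvector set \<Rightarrow> 'v set set"
  where "proj V = {L. cvec.subspace L \<and> L \<subseteq> V \<and> cvec.dim L = 1}"

text \<open>Homogeneous polynomial functions of degree \<open>d\<close>: linear combinations of products of \<open>d\<close>
  linear forms. The forms are defined on the whole type. Every linear form on a linear subspace
  \<open>V\<close> extends to the whole type, and \<open>V\<close> is the common zero set of the forms vanishing on it.
  Hence the Zariski topology and the regular functions of \<open>proj V\<close> are those induced
  from \<open>proj UNIV\<close>, and \<open>V\<close> need not be mentioned below.\<close>

definition hom_poly :: "nat \<Rightarrow> ('v::cvector \<Rightarrow> complex) set"
  where "hom_poly d = cvec.span {F. \<exists>l. (\<forall>i<d. Vector_Spaces.linear (*\<^sub>C) (*\<^sub>C) (l i)) \<and>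
                                        F = (\<lambda>v. \<Prod>i<d. l i v)}"

definition zclosed :: "'v::cvector set set \<Rightarrow> bool"
  where "zclosed X \<longleftrightarrow> (\<exists>S \<subseteq> (\<Union>d. hom_poly d).
           X = {L \<in> proj UNIV. \<forall>F\<in>S. \<forall>v\<in>L. F v = 0})"

definition zopen_in :: "'v::cvector set set \<Rightarrow> 'v set set \<Rightarrow> bool"
  where "zopen_in X U \<longleftrightarrow> (\<exists>Z. zclosed Z \<and> U = X - Z)"

definition zirreducible :: "'v::cvector set set \<Rightarrow> bool"
  where "zirreducible X \<longleftrightarrow> X \<noteq> {} \<and>
           (\<forall>A B. zclosed A \<and> zclosed B \<and> X \<subseteq> A \<union> B \<longrightarrow> X \<subseteq> A \<or> X \<subseteq> B)"

definition irreducible_chain :: "'v::cvector set set \<Rightarrow> nat \<Rightarrow> (nat \<Rightarrow> 'v set set) \<Rightarrow> bool"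
  where "irreducible_chain X n Z \<longleftrightarrow>
           (\<forall>i\<le>n. zclosed (Z i) \<and> zirreducible (Z i) \<and> Z i \<subseteq> X) \<and> (\<forall>i<n. Z i \<subset> Z (Suc i))"

definition has_krull_dim :: "'v::cvector set set \<Rightarrow> nat \<Rightarrow> bool"
  where "has_krull_dim X n \<longleftrightarrow>
           (\<exists>Z. irreducible_chain X n Z) \<and> (\<forall>m Z. irreducible_chain X m Z \<longrightarrow> m \<le> n)"

text \<open>The kernel of the Jacobian matrix of the homogeneous ideal of \<open>X\<close>, taken at the point
  \<open>L\<close>: this is the tangent space of the affine cone over \<open>X\<close> along the line \<open>L\<close>, which
  exceeds the projective tangent space in dimension by one.\<close>

definition cone_tangent :: "'v::cvector set set \<Rightarrow> 'v set \<Rightarrow> 'v set"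
  where "cone_tangent X L = {v. \<forall>d. \<forall>F\<in>hom_poly d. (\<forall>M\<in>X. \<forall>u\<in>M. F u = 0) \<longrightarrow>
           (\<forall>w\<in>L - {0}. deriv (\<lambda>z. F (w + z *\<^sub>C v)) 0 = 0)}"

definition nonsingular :: "'v::cvector set set \<Rightarrow> bool"
  where "nonsingular X \<longleftrightarrow> (\<forall>n. has_krull_dim X n \<longrightarrow> (\<forall>L\<in>X. cvec.dim (cone_tangent X L) = n + 1))"

definition regular_on :: "'v::cvector set set \<Rightarrow> 'v set set \<Rightarrow> ('v set \<Rightarrow> complex) \<Rightarrow> bool"
  where "regular_on X U f \<longleftrightarrow> (\<forall>L\<in>U. \<exists>W d. zopen_in X W \<and> L \<in> W \<and> W \<subseteq> U \<and>
           (\<exists>G\<in>hom_poly d. \<exists>H\<in>hom_poly d. \<forall>M\<in>W. \<forall>v\<in>M - {0}. H v \<noteq> 0 \<and> f M = G v / H v))"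

definition morphism :: "'v::cvector set set \<Rightarrow> 'w::cvector set set \<Rightarrow> ('v set \<Rightarrow> 'w set) \<Rightarrow> bool"
  where "morphism X Y \<phi> \<longleftrightarrow> \<phi> ` X \<subseteq> Y \<and>
           (\<forall>U. zopen_in Y U \<longrightarrow> zopen_in X {x\<in>X. \<phi> x \<in> U} \<and>
              (\<forall>f. regular_on Y U f \<longrightarrow> regular_on X {x\<in>X. \<phi> x \<in> U} (f \<circ> \<phi>)))"

definition isomorphic_varieties :: "'v::cvector set set \<Rightarrow> 'w::cvector set set \<Rightarrow> bool"
  where "isomorphic_varieties X Y \<longleftrightarrow> zclosed X \<and> zclosed Y \<and>
           (\<exists>\<phi> \<psi>. morphism X Y \<phi> \<and> morphism Y X \<psi> \<and>
              (\<forall>x\<in>X. \<psi> (\<phi> x) = x) \<and> (\<forall>y\<in>Y. \<phi> (\<psi> y) = y))"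

text \<open>\<open>projective_space n\<close> is the projective space of \<open>n + 1\<close> coordinates \<open>x 0, \<dots>, x n\<close>.\<close>

definition projective_space :: "nat \<Rightarrow> (nat \<Rightarrow> complex) set set"
  where "projective_space n = proj {x. \<forall>i>n. x i = 0}"


section \<open>The genus\<close>

text \<open>\<open>H\<^sup>1(X, O\<^sub>X)\<close> is taken to be Cech cohomology, the direct limit over all open covers.
  Covers indexed by the points of \<open>X\<close>, with \<open>x \<in> U x\<close>, are cofinal and have canonical
  refinement maps (restriction), so only these are used.\<close>

definition point_cover :: "'v::cvector set set \<Rightarrow> ('v set \<Rightarrow> 'v set set) \<Rightarrow> bool"
  where "point_cover X U \<longleftrightarrow> (\<forall>x\<in>X. zopen_in X (U x) \<and> x \<in> U x)"

definition refines :: "'v::cvector set set \<Rightarrow> ('v set \<Rightarrow> 'v set set) \<Rightarrow> ('v set \<Rightarrow> 'v set set) \<Rightarrow> bool"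
  where "refines X V U \<longleftrightarrow> (\<forall>x\<in>X. V x \<subseteq> U x)"

definition cocycle :: "'v::cvector set set \<Rightarrow> ('v set \<Rightarrow> 'v set set) \<Rightarrow>
    ('v set \<Rightarrow> 'v set \<Rightarrow> 'v set \<Rightarrow> complex) \<Rightarrow> bool"
  where "cocycle X U f \<longleftrightarrow> (\<forall>x\<in>X. \<forall>y\<in>X. regular_on X (U x \<inter> U y) (f x y)) \<and>
           (\<forall>x\<in>X. \<forall>y\<in>X. \<forall>z\<in>X. \<forall>p \<in> U x \<inter> U y \<inter> U z. f x z p = f x y p + f y z p)"

text \<open>Values outside \<open>U x \<inter> U y\<close> are ignored, so for a cocycle on a coarser cover
  this predicate speaks about its restriction to \<open>U\<close>.\<close>

definition coboundary :: "'v::cvector set set \<Rightarrow> ('v set \<Rightarrow> 'v set set) \<Rightarrow>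
    ('v set \<Rightarrow> 'v set \<Rightarrow> 'v set \<Rightarrow> complex) \<Rightarrow> bool"
  where "coboundary X U f \<longleftrightarrow> (\<exists>g. (\<forall>x\<in>X. regular_on X (U x) (g x)) \<and>
           (\<forall>x\<in>X. \<forall>y\<in>X. \<forall>p \<in> U x \<inter> U y. f x y p = g y p - g x p))"

text \<open>The dimension of \<open>H\<^sup>1(X, O\<^sub>X)\<close> is \<open>n\<close>: there are \<open>n\<close> cocycles, on a common cover, whose
  classes in the direct limit form a basis.\<close>

definition H1_structure_sheaf_dim :: "'v::cvector set set \<Rightarrow> nat \<Rightarrow> bool"
  where "H1_structure_sheaf_dim X n \<longleftrightarrow> (\<exists>U F. point_cover X U \<and> (\<forall>i<n. cocycle X U (F i)) \<and>
           (\<forall>c V. point_cover X V \<and> refines X V U \<and> coboundary X V (\<Sum>i<n. c i *\<^sub>C F i)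
              \<longrightarrow> (\<forall>i<n. c i = 0)) \<and>
           (\<forall>W G. point_cover X W \<and> cocycle X W G \<longrightarrow>
              (\<exists>c V. point_cover X V \<and> refines X V U \<and> refines X V W \<and>
                 coboundary X V (G - (\<Sum>i<n. c i *\<^sub>C F i)))))"

definition smooth_projective_curve :: "(nat \<Rightarrow> complex) set set \<Rightarrow> bool"
  where "smooth_projective_curve C \<longleftrightarrow> (\<exists>n. C \<subseteq> projective_space n) \<and> zclosed C \<and>
           zirreducible C \<and> has_krull_dim C 1 \<and> nonsingular C"

definition elliptic_curve :: "(nat \<Rightarrow> complex) set set \<Rightarrow> bool"
  where "elliptic_curve C \<longleftrightarrow> smooth_projective_curve C \<and> H1_structure_sheaf_dim C 1"


section \<open>Line bundles of divisors\<close>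

text \<open>\<open>t\<close> is a regular function on the neighbourhood \<open>U\<close> of \<open>p\<close> with \<open>p\<close> as its only zero, and
  its germ generates the maximal ideal of the local ring at \<open>p\<close>.\<close>

definition local_equation :: "'v::cvector set set \<Rightarrow> 'v set \<Rightarrow> 'v set set \<Rightarrow> ('v set \<Rightarrow> complex) \<Rightarrow> bool"
  where "local_equation C p U t \<longleftrightarrow> zopen_in C U \<and> p \<in> U \<and> regular_on C U t \<and>
           (\<forall>x\<in>U. t x = 0 \<longleftrightarrow> x = p) \<and>
           (\<forall>W h. zopen_in C W \<and> p \<in> W \<and> regular_on C W h \<and> h p = 0 \<longrightarrow>
              (\<exists>W' g. zopen_in C W' \<and> p \<in> W' \<and> W' \<subseteq> U \<inter> W \<and> regular_on C W' g \<and>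
                 (\<forall>x\<in>W'. h x = t x * g x)))"

text \<open>\<open>sections_of C Z D\<close> is \<open>H\<^sup>0(C, O\<^sub>C(D))\<close> for a divisor \<open>D\<close> on the curve \<open>C\<close> whose support lies in
  the finite set \<open>Z\<close>. Here \<open>O\<^sub>C(D)\<close> is the sheaf of rational functions \<open>f\<close> with \<open>div f + D \<ge> 0\<close>,
  that is, the subsheaf of the sheaf of rational functions generated near \<open>p\<close> by \<open>t powi (- D p)\<close>,
  where \<open>t\<close> is a local equation of \<open>p\<close>. A rational function whose poles lie in \<open>Z\<close> is represented
  by its restriction to the dense open set \<open>C - Z\<close>, extended by \<open>0\<close> (also at points of \<open>Z\<close> where it
  happens to be regular), so that sums and products of sections are pointwise.\<close>

definition sections_of :: "'v::cvector set set \<Rightarrow> 'v set set \<Rightarrow> ('v set \<Rightarrow> int) \<Rightarrow> ('v set \<Rightarrow> complex) set"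
  where "sections_of C Z D = {f. regular_on C (C - Z) f \<and> (\<forall>x. x \<notin> C - Z \<longrightarrow> f x = 0) \<and>
           (\<forall>p\<in>Z. \<exists>U t g. local_equation C p U t \<and> regular_on C U g \<and>
              (\<forall>x\<in>U - Z. f x = t x powi (- D p) * g x))}"

definition point_divisor :: "int \<Rightarrow> 'v set \<Rightarrow> 'v set \<Rightarrow> int"
  where "point_divisor n P = (\<lambda>x. if x = P then n else 0)"


section \<open>Exterior squares and resonance\<close>

text \<open>The exterior square of \<open>V\<close> is the free vector space on \<open>V \<times> V\<close> (inside the functions
  \<open>'v \<times> 'v \<Rightarrow> complex\<close>) modulo the relations making \<open>(s, t) \<mapsto> s \<and> t\<close> bilinear and alternating.
  Its elements are cosets of \<open>ext2_rel V\<close>, which is therefore also its zero element.\<close>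

definition single_pair :: "'v \<Rightarrow> 'v \<Rightarrow> 'v \<times> 'v \<Rightarrow> complex"
  where "single_pair s t = (\<lambda>p. if p = (s, t) then 1 else 0)"

definition ext2_rel :: "'v::cvector set \<Rightarrow> ('v \<times> 'v \<Rightarrow> complex) set"
  where "ext2_rel V = cvec.span (
           {single_pair (u + v) w - single_pair u w - single_pair v w | u v w. u \<in> V \<and> v \<in> V \<and> w \<in> V} \<union>
           {single_pair w (u + v) - single_pair w u - single_pair w v | u v w. u \<in> V \<and> v \<in> V \<and> w \<in> V} \<union>
           {single_pair (c *\<^sub>C u) w - c *\<^sub>C single_pair u w | c u w. u \<in> V \<and> w \<in> V} \<union>
           {single_pair w (c *\<^sub>C u) - c *\<^sub>C single_pair w u | c u w. u \<in> V \<and> w \<in> V} \<union>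
           {single_pair u u | u. u \<in> V})"

definition ext2_class :: "'v::cvector set \<Rightarrow> ('v \<times> 'v \<Rightarrow> complex) \<Rightarrow> ('v \<times> 'v \<Rightarrow> complex) set"
  where "ext2_class V x = {x + r | r. r \<in> ext2_rel V}"

definition ext2 :: "'v::cvector set \<Rightarrow> ('v \<times> 'v \<Rightarrow> complex) set set"
  where "ext2 V = ext2_class V ` cvec.span {single_pair s t | s t. s \<in> V \<and> t \<in> V}"

definition wedge :: "'v::cvector set \<Rightarrow> 'v \<Rightarrow> 'v \<Rightarrow> ('v \<times> 'v \<Rightarrow> complex) set"
  where "wedge V s t = ext2_class V (single_pair s t)"

text \<open>The linear map on the exterior square with \<open>s \<and> t \<mapsto> \<mu> s t\<close>, for \<open>\<mu>\<close> bilinear and alternating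
  on \<open>V\<close>: the formula is constant on each coset.\<close>

definition ext2_lift :: "('v \<Rightarrow> 'v \<Rightarrow> 'w::cvector) \<Rightarrow> ('v \<times> 'v \<Rightarrow> complex) set \<Rightarrow> 'w"
  where "ext2_lift \<mu> \<xi> = the_elem ((\<lambda>x. \<Sum>(s, t) | x (s, t) \<noteq> 0. x (s, t) *\<^sub>C \<mu> s t) ` \<xi>)"

text \<open>The bundle \<open>E = O\<^sub>C(D\<^sub>1) \<oplus> O\<^sub>C(D\<^sub>2)\<close>. Its exterior square is \<open>O\<^sub>C(D\<^sub>1) \<otimes> O\<^sub>C(D\<^sub>2) = O\<^sub>C(D\<^sub>1 + D\<^sub>2)\<close>
  through \<open>(s\<^sub>1, s\<^sub>2) \<and> (t\<^sub>1, t\<^sub>2) = s\<^sub>1 t\<^sub>2 - s\<^sub>2 t\<^sub>1\<close>, so that the second determinant map takes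
  \<open>s \<and> t\<close> to this element of \<open>sections_of C Z (D\<^sub>1 + D\<^sub>2)\<close>.\<close>

definition sum_sections :: "'v::cvector set set \<Rightarrow> 'v set set \<Rightarrow> ('v set \<Rightarrow> int) \<Rightarrow> ('v set \<Rightarrow> int) \<Rightarrow>
    (('v set \<Rightarrow> complex) \<times> ('v set \<Rightarrow> complex)) set"
  where "sum_sections C Z D1 D2 = sections_of C Z D1 \<times> sections_of C Z D2"

definition second_det_map :: "((('v set \<Rightarrow> complex) \<times> ('v set \<Rightarrow> complex)) \<times>
    (('v set \<Rightarrow> complex) \<times> ('v set \<Rightarrow> complex)) \<Rightarrow> complex) set \<Rightarrow> 'v set \<Rightarrow> complex"
  where "second_det_map = ext2_lift (\<lambda>s t x. fst s x * snd t x - snd s x * fst t x)"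

definition resonance :: "'v::cvector set set \<Rightarrow> 'v set set \<Rightarrow> ('v set \<Rightarrow> int) \<Rightarrow> ('v set \<Rightarrow> int) \<Rightarrow>
    (('v set \<Rightarrow> complex) \<times> ('v set \<Rightarrow> complex)) set set"
  where "resonance C Z D1 D2 = (let H = sum_sections C Z D1 D2 in
           {L \<in> proj H. \<exists>s\<in>H. \<exists>t\<in>H. L = cvec.span {s} \<and> wedge H s t \<noteq> ext2_rel H \<and>
              wedge H s t \<in> {\<xi> \<in> ext2 H. second_det_map \<xi> = 0}})"

end

theory Submission
  imports Defs "HOL-Computational_Algebra.Polynomial"
begin

text \<open>
  Global sections of \<open>O\<^sub>C(aP)\<close> with \<open>a \<le> 1\<close> are constant, so two independent sections of \<open>E\<close> with vanishing
  determinant both lie in the summand \<open>O\<^sub>C(bQ)\<close>. Hence \<open>R(E)\<close> is empty or the projective space of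
  \<open>H\<^sup>0(C, O\<^sub>C(bQ))\<close>, and everything rests on \<open>h\<^sup>0(O\<^sub>C(bQ)) = b\<close> for \<open>b \<ge> 1\<close>.

  This needs no Riemann--Roch theorem, only \<open>dim H\<^sup>1(C, O\<^sub>C) = 1\<close>. Let \<open>t\<close> be a local equation of \<open>Q\<close>.
  The cocycles given by the principal parts \<open>t\<^sup>-\<^sup>j\<close> lie in a one-dimensional space, so for each \<open>j \<ge> 2\<close> some
  function has principal part \<open>t\<^sup>-\<^sup>j - c t\<^sup>-\<^sup>1\<close>, once \<open>t\<^sup>-\<^sup>1\<close> is known not to be a principal part. That,
  and the constancy of global sections of \<open>O\<^sub>C(Q)\<close>, follow by letting a nonconstant function with at most a
  simple pole act on \<open>H\<^sup>1(C, O\<^sub>C)\<close>: it acts as a scalar because the dimension is one, but its difference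
  from that scalar is invertible because cocycles can be divided by it.
\<close>


text \<open>Two facts about the curve have to be extracted from definitions that do not mention
  them. The first is that every nonempty open set has finite complement. Krull dimension one only
  bounds chains of irreducible closed sets, so a minimal infinite closed set is wanted, and its
  existence is the Noetherian property; this is why Hilbert's basis theorem appears. The second is
  that each point has a local equation. Nonsingularity speaks of a Jacobian kernel, sections speak
  of a generator of the maximal ideal; the bridge is the duality between linear relations of the
  affine coordinates modulo second order and the cone tangent space, followed by Nakayama's lemma.

  Division of a cocycle by \<open>f - l\<close> works because this function has finitely many zeros
  and covers are indexed by points: each bad point is left in its own member only, so no overlap of
  two different members meets it, while on the diagonal a cocycle is zero.

  The count is 1 + (b - 1): constants are the only sections with at most a simple pole, and each
  pole order from 2 to b adds one dimension, measured by the leading coefficient at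
  \<open>Q\<close>.\<close>

abbreviation clin :: "('a::cvector \<Rightarrow> 'b::cvector) \<Rightarrow> bool"
  where "clin \<equiv> Vector_Spaces.linear (*\<^sub>C) (*\<^sub>C)"

global_interpretation cvp: vector_space_pair
  "(*\<^sub>C) :: complex \<Rightarrow> 'a \<Rightarrow> 'a::cvector" "(*\<^sub>C) :: complex \<Rightarrow> 'b \<Rightarrow> 'b::cvector" ..

lemma cscale_complex: "c *\<^sub>C (x::complex) = c * x"
  by (simp add: cscale_complex_def)

lemma cscale_fun_apply [simp]: "(c *\<^sub>C f) x = c *\<^sub>C f x"
  by (simp add: cscale_fun_def)

lemma clinI:
  assumes "\<And>x y. f (x + y) = f x + f y" "\<And>c x. f (c *\<^sub>C x) = c *\<^sub>C f x"
  shows "clin f"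
  unfolding Vector_Spaces.linear_iff
  by (intro conjI allI cvec.vector_space_axioms assms)

lemma clinD:
  assumes "clin f"
  shows "f (x + y) = f x + f y" "f (c *\<^sub>C x) = c *\<^sub>C f x" "f 0 = 0" "f (x - y) = f x - f y"
    "f (sum h A) = (\<Sum>i\<in>A. f (h i))"
  using cvp.linear_add[OF assms] cvp.linear_scale[OF assms] cvp.linear_0[OF assms]
    cvp.linear_diff[OF assms] cvp.linear_sum[OF assms] by auto

lemma clin_compose:
  assumes "clin f" "clin g"
  shows "clin (\<lambda>x. f (g x))"
  by (intro clinI) (simp_all only: clinD(1,2)[OF assms(1)] clinD(1,2)[OF assms(2)])

lemma clin_coord: "clin (\<lambda>x :: 'i \<Rightarrow> complex. x i)"
  by (intro clinI) simp_all

text \<open>A basis of \<open>V\<close> stays independent after adding \<open>x\<close>, so the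
  values 0 on the basis and 1 at \<open>x\<close> extend linearly. The lemma later cuts out linear
  subspaces, produces a tangent vector by duality, and detects nonzero wedges.\<close>

lemma separating_functional:
  assumes "cvec.subspace V" "x \<notin> V"
  obtains l :: "'v::cvector \<Rightarrow> complex" where "clin l" "\<And>v. v \<in> V \<Longrightarrow> l v = 0" "l x = 1"
proof -
  obtain B where B: "B \<subseteq> V" "cvec.independent B" "V \<subseteq> cvec.span B"
    using cvec.maximal_independent_subset by blast
  have sp: "cvec.span B = V"
    using B(3) cvec.span_minimal[OF B(1) assms(1)] by (rule subset_antisym[OF _ _, rotated])
  have ind: "cvec.independent (insert x B)"
    using B(2) assms(2) sp by (simp add: cvec.independent_insertI)
  obtain l :: "'v \<Rightarrow> complex" where l: "clin l" "\<forall>b\<in>insert x B. l b = (if b = x then 1 else 0)"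
    using cvp.linear_independent_extend[OF ind, of "\<lambda>b. if b = x then 1 else 0"] by blast
  have xB: "x \<notin> B" using assms(2) B(1) by blast
  have "l v = 0" if "v \<in> V" for v
  proof (rule cvp.linear_eq_0_on_span[OF l(1), of B])
    show "\<And>y. y \<in> B \<Longrightarrow> l y = 0" using l(2) xB by auto
    show "v \<in> cvec.span B" using that sp by simp
  qed
  then show thesis by (rule that[OF l(1)]) (use l(2) in simp_all)
qed


section \<open>Points of projective space\<close>

text \<open>One fixed nonzero vector per line. Vanishing of a homogeneous polynomial and quotients
  of two such polynomials of equal degree do not depend on the vector, so statements quantified over
  a line become evaluations at \<open>rep L\<close>.\<close>

definition rep :: "'v::cvector set \<Rightarrow> 'v"
  where "rep L = (SOME w. w \<in> L \<and> w \<noteq> 0)"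

lemma proj_mono_UNIV: "L \<in> proj V \<Longrightarrow> L \<in> proj UNIV"
  by (simp add: proj_def)

lemma proj_ex_nonzero:
  assumes "L \<in> proj V"
  shows "\<exists>w. w \<in> L \<and> w \<noteq> 0"
proof (rule ccontr)
  assume "\<nexists>w. w \<in> L \<and> w \<noteq> 0"
  then have "L \<subseteq> {0}" by auto
  then have "cvec.dim L = 0"
    using cvec.dim_eq_card_independent[of "{}"] by (metis cvec.dim_le_card card.empty cvec.span_empty finite.emptyI le_zero_eq)
  then show False using assms by (simp add: proj_def)
qed

lemma rep_in: "L \<in> proj V \<Longrightarrow> rep L \<in> L"
  and rep_nonzero: "L \<in> proj V \<Longrightarrow> rep L \<noteq> 0"
  using someI_ex[OF proj_ex_nonzero[of L V]] unfolding rep_def by auto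

lemma proj_eq_span:
  assumes "L \<in> proj V" "w \<in> L" "w \<noteq> 0"
  shows "L = cvec.span {w}"
proof -
  obtain B where B: "B \<subseteq> L" "cvec.independent B" "L \<subseteq> cvec.span B" "card B = cvec.dim L"
    using cvec.basis_exists by blast
  then obtain b where "B = {b}"
    using assms(1) by (auto simp: proj_def card_1_singleton_iff)
  then have L: "L = cvec.span {b}"
    using B assms(1) cvec.span_minimal[of B L] by (auto simp: proj_def)
  then obtain c where c: "w = c *\<^sub>C b"
    using assms(2) by (auto simp: cvec.span_singleton)
  with assms(3) have "c \<noteq> 0" by auto
  then have "b = (1 / c) *\<^sub>C w" by (simp add: c)
  then have "b \<in> cvec.span {w}" by (metis cvec.span_base cvec.span_scale singletonI)
  then have "cvec.span {b} \<subseteq> cvec.span {w}" by (intro cvec.span_minimal) auto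
  moreover have "cvec.span {w} \<subseteq> L"
    using assms(1,2) by (intro cvec.span_minimal) (auto simp: proj_def)
  ultimately show ?thesis using L by blast
qed

lemma proj_elemE:
  assumes "L \<in> proj V" "w \<in> L" "w \<noteq> 0" "v \<in> L"
  obtains c where "v = c *\<^sub>C w"
  using assms proj_eq_span[OF assms(1-3)] by (auto simp: cvec.span_singleton)

lemma proj_elem_nonzeroE:
  assumes "L \<in> proj V" "v \<in> L" "v \<noteq> 0"
  obtains c where "v = c *\<^sub>C rep L" "c \<noteq> 0"
  using proj_elemE[OF assms(1) rep_in[OF assms(1)] rep_nonzero[OF assms(1)] assms(2)] assms(3)
  by (metis cvec.scale_eq_0_iff)

lemma dim_span_single: "w \<noteq> 0 \<Longrightarrow> cvec.dim (cvec.span {w}) = 1"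
  using cvec.dim_eq_card_independent[of "{w}"] by (simp add: cvec.dim_span)

lemma span_in_proj:
  assumes "cvec.subspace V" "w \<in> V" "w \<noteq> 0"
  shows "cvec.span {w} \<in> proj V"
  using assms dim_span_single by (auto simp: proj_def cvec.span_minimal)

lemma proj_eqI:
  assumes "L \<in> proj V" "M \<in> proj W" "w \<in> L" "w \<in> M" "w \<noteq> 0"
  shows "L = M"
  using assms proj_eq_span by metis


section \<open>Homogeneous polynomials\<close>

lemma hom_poly_subspace: "cvec.subspace (hom_poly d)"
  by (simp add: hom_poly_def)

lemma hom_poly_0: "(0 :: 'v::cvector \<Rightarrow> complex) \<in> hom_poly d"
  by (rule cvec.subspace_0[OF hom_poly_subspace])

lemma hom_poly_add: "F \<in> hom_poly d \<Longrightarrow> G \<in> hom_poly d \<Longrightarrow> (\<lambda>v. F v + G v) \<in> hom_poly d"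
  using cvec.subspace_add[OF hom_poly_subspace, of F d G] by (simp add: plus_fun_def)

lemma hom_poly_cmult: "F \<in> hom_poly d \<Longrightarrow> (\<lambda>v. c * F v) \<in> hom_poly d"
  using cvec.subspace_scale[OF hom_poly_subspace, of F d c] by (simp add: cscale_fun_def cscale_complex)

lemma hom_poly_prod: "(\<And>i. i < d \<Longrightarrow> clin (l i)) \<Longrightarrow> (\<lambda>v. \<Prod>i<d. l i v) \<in> hom_poly d"
  unfolding hom_poly_def by (rule cvec.span_base) auto

text \<open>Span induction with the generator displayed as a product of linear forms and with
  \<open>G\<close> known to be homogeneous, so that the closure lemmas can be applied to both
  summands.\<close>

lemma hom_poly_induct [consumes 1, case_names zero scale_add]:
  assumes "F \<in> hom_poly d" "P (\<lambda>_. 0)"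
    and "\<And>c l G. (\<And>i. i < d \<Longrightarrow> clin (l i)) \<Longrightarrow> G \<in> hom_poly d \<Longrightarrow> P G \<Longrightarrow> P (\<lambda>v. c * (\<Prod>i<d. l i v) + G v)"
  shows "P F"
proof -
  have "F \<in> hom_poly d \<and> P F" using assms(1) unfolding hom_poly_def
  proof (induction rule: cvec.span_induct_alt)
    case base
    show ?case by (intro conjI cvec.span_zero) (use assms(2) in \<open>simp only: zero_fun_def\<close>)
  next
    case (step c F G)
    then obtain l where l: "\<forall>i<d. clin (l i)" "F = (\<lambda>v. \<Prod>i<d. l i v)" by auto
    have eq: "c *\<^sub>C F + G = (\<lambda>v. c * (\<Prod>i<d. l i v) + G v)"
      by (simp add: l fun_eq_iff cscale_complex)
    have G: "G \<in> hom_poly d" "P G" using step by (auto simp only: hom_poly_def)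
    have "F \<in> hom_poly d" using l by (auto intro: hom_poly_prod)
    then have "c *\<^sub>C F + G \<in> hom_poly d"
      by (intro cvec.subspace_add cvec.subspace_scale hom_poly_subspace G)
    moreover have "P (c *\<^sub>C F + G)" unfolding eq using l G by (intro assms(3)) auto
    ultimately show ?case by (simp only: hom_poly_def)
  qed
  then show ?thesis ..
qed

lemma hom_poly_mult:
  assumes "F \<in> hom_poly d" "G \<in> hom_poly e"
  shows "(\<lambda>v. F v * G v) \<in> hom_poly (d + e)"
  using assms(1)
proof (induction rule: hom_poly_induct)
  case zero
  then show ?case using hom_poly_0 by (simp add: zero_fun_def)
next
  case (scale_add c l F')
  have "(\<lambda>v. (\<Prod>i<d. l i v) * G v) \<in> hom_poly (d + e)"
    using assms(2)
  proof (induction rule: hom_poly_induct)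
    case zero
    then show ?case using hom_poly_0 by (simp add: zero_fun_def)
  next
    case (scale_add c' l' G')
    \<comment> \<open>The linear factors are concatenated: indices below \<open>d\<close> belong to
      the first product, the others, shifted by \<open>d\<close>, to the second.\<close>
    have *: "(\<Prod>i<d+e. if i < d then l i v else l' (i - d) v) = (\<Prod>i<d. l i v) * (\<Prod>i<e. l' i v)" for v
    proof -
      have "{..<d+e} = {..<d} \<union> {d..<d+e}" by auto
      moreover have "(\<Prod>i\<in>{d..<d+e}. l' (i - d) v) = (\<Prod>i<e. l' i v)"
        by (rule prod.reindex_bij_witness[of _ "\<lambda>i. i + d" "\<lambda>i. i - d"]) auto
      ultimately show ?thesis
        by (simp add: prod.union_disjoint ivl_disj_int)
    qed
    have "(\<lambda>v. \<Prod>i<d+e. (if i < d then l i else l' (i - d)) v) \<in> hom_poly (d + e)"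
      by (rule hom_poly_prod) (use scale_add \<open>\<And>i. i < d \<Longrightarrow> clin (l i)\<close> in auto)
    then have "(\<lambda>v. (\<Prod>i<d. l i v) * (\<Prod>i<e. l' i v)) \<in> hom_poly (d + e)"
      by (simp add: if_distribR * cong: if_cong)
    from hom_poly_add[OF hom_poly_cmult[OF this, of c'] scale_add(3)]
    show ?case by (simp add: algebra_simps)
  qed
  from hom_poly_add[OF hom_poly_cmult[OF this, of c] scale_add(3)]
  show ?case by (simp add: algebra_simps)
qed

lemma hom_poly_const: "(\<lambda>_. c) \<in> hom_poly 0"
  using hom_poly_cmult[OF hom_poly_prod[of 0], where c = c] by simp

lemma hom_poly_linear: "clin l \<Longrightarrow> l \<in> hom_poly 1"
  using hom_poly_prod[of 1 "\<lambda>_. l"] by simp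

lemma hom_poly_homogeneous:
  assumes "F \<in> hom_poly d"
  shows "F (c *\<^sub>C v) = c ^ d * F v"
  using assms
proof (induction rule: hom_poly_induct)
  case (scale_add k l G)
  have "(\<Prod>i<d. l i (c *\<^sub>C v)) = c ^ d * (\<Prod>i<d. l i v)"
  proof -
    have "(\<Prod>i<d. l i (c *\<^sub>C v)) = (\<Prod>i<d. c * l i v)"
      by (intro prod.cong refl) (use clinD(2)[OF scale_add(1)] in \<open>simp add: cscale_complex\<close>)
    then show ?thesis by (simp add: prod.distrib)
  qed
  with scale_add show ?case by (simp add: algebra_simps)
qed simp

lemma hom_poly_compose:
  assumes "F \<in> hom_poly d" "clin A"
  shows "(\<lambda>v. F (A v)) \<in> hom_poly d"
  using assms(1)
proof (induction rule: hom_poly_induct)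
  case zero
  then show ?case using hom_poly_0 by (simp add: zero_fun_def)
next
  case (scale_add c l G)
  have "(\<lambda>v. \<Prod>i<d. l i (A v)) \<in> hom_poly d"
    by (rule hom_poly_prod) (use scale_add assms(2) in \<open>auto intro: clin_compose\<close>)
  from hom_poly_add[OF hom_poly_cmult[OF this, of c] scale_add(3)]
  show ?case .
qed

lemma hom_poly_vanish_iff:
  assumes "F \<in> hom_poly d" "L \<in> proj UNIV"
  shows "(\<forall>v\<in>L. F v = 0) \<longleftrightarrow> F (rep L) = 0"
proof
  assume "F (rep L) = 0"
  then show "\<forall>v\<in>L. F v = 0"
    using proj_elemE[OF assms(2) rep_in[OF assms(2)] rep_nonzero[OF assms(2)]] hom_poly_homogeneous[OF assms(1)]
    by (metis mult_zero_right)
qed (use rep_in[OF assms(2)] in blast)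

lemma hom_poly_ratio_iff:
  assumes "G \<in> hom_poly d" "H \<in> hom_poly d" "L \<in> proj UNIV"
  shows "(\<forall>v\<in>L - {0}. H v \<noteq> 0 \<and> y = G v / H v) \<longleftrightarrow> H (rep L) \<noteq> 0 \<and> y = G (rep L) / H (rep L)"
proof
  assume R: "H (rep L) \<noteq> 0 \<and> y = G (rep L) / H (rep L)"
  show "\<forall>v\<in>L - {0}. H v \<noteq> 0 \<and> y = G v / H v"
  proof
    fix v assume "v \<in> L - {0}"
    then obtain c where "v = c *\<^sub>C rep L" "c \<noteq> 0" using proj_elem_nonzeroE[OF assms(3)] by auto
    then show "H v \<noteq> 0 \<and> y = G v / H v"
      using R by (simp add: hom_poly_homogeneous[OF assms(1)] hom_poly_homogeneous[OF assms(2)])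
  qed
qed (use rep_in[OF assms(3)] rep_nonzero[OF assms(3)] in blast)


section \<open>The Zariski topology\<close>

lemma zclosed_iff: "zclosed X \<longleftrightarrow> (\<exists>S\<subseteq>(\<Union>d. hom_poly d). X = {L \<in> proj UNIV. \<forall>F\<in>S. F (rep L) = 0})"
  unfolding zclosed_def
proof (intro ex_cong1 conj_cong refl)
  fix S :: "('a \<Rightarrow> complex) set" assume S: "S \<subseteq> (\<Union>d. hom_poly d)"
  have "{L \<in> proj UNIV. \<forall>F\<in>S. \<forall>v\<in>L. F v = 0} = {L \<in> proj UNIV. \<forall>F\<in>S. F (rep L) = 0}"
    using S hom_poly_vanish_iff by blast
  then show "(X = {L \<in> proj UNIV. \<forall>F\<in>S. \<forall>v\<in>L. F v = 0}) =
    (X = {L \<in> proj UNIV. \<forall>F\<in>S. F (rep L) = 0})" by simp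
qed

lemma zclosed_subset: "zclosed X \<Longrightarrow> X \<subseteq> proj UNIV"
  by (auto simp: zclosed_iff)

lemma zclosed_zero_set: "F \<in> hom_poly d \<Longrightarrow> zclosed {L \<in> proj UNIV. F (rep L) = 0}"
  unfolding zclosed_iff by (rule exI[of _ "{F}"]) auto

text \<open>Defining equations are chosen for every member and united. The factor
  \<open>proj UNIV\<close> takes care of the empty family.\<close>

lemma zclosed_Inter:
  assumes "\<And>X. X \<in> \<X> \<Longrightarrow> zclosed X"
  shows "zclosed (proj UNIV \<inter> \<Inter>\<X>)"
proof -
  have "\<forall>X\<in>\<X>. \<exists>S\<subseteq>(\<Union>d. hom_poly d). X = {L \<in> proj UNIV. \<forall>F\<in>S. F (rep L) = 0}"
    using assms by (simp add: zclosed_iff)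
  from bchoice[OF this] obtain S
    where S: "\<forall>X\<in>\<X>. S X \<subseteq> (\<Union>d. hom_poly d) \<and> X = {L \<in> proj UNIV. \<forall>F\<in>S X. F (rep L) = 0}" ..
  show ?thesis unfolding zclosed_iff
  proof (intro exI conjI)
    show "\<Union>(S ` \<X>) \<subseteq> (\<Union>d. hom_poly d)" by (intro UN_least conjunct1[OF bspec[OF S]])
    show "proj UNIV \<inter> \<Inter>\<X> = {L \<in> proj UNIV. \<forall>F\<in>\<Union>(S ` \<X>). F (rep L) = 0}"
    proof -
      have "L \<in> X \<longleftrightarrow> L \<in> proj UNIV \<and> (\<forall>F\<in>S X. F (rep L) = 0)" if "X \<in> \<X>" for X L
        using eqset_imp_iff[OF conjunct2[OF bspec[OF S that]], of L] unfolding mem_Collect_eq .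
      then show ?thesis by auto
    qed
  qed
qed

lemma zclosed_Int: "zclosed X \<Longrightarrow> zclosed Y \<Longrightarrow> zclosed (X \<inter> Y)"
  using zclosed_Inter[of "{X, Y}"] zclosed_subset[of X] by (auto simp: Int_absorb1 inf.assoc[symmetric]) 

lemma zclosed_Un:
  assumes "zclosed X" "zclosed Y"
  shows "zclosed (X \<union> Y)"
proof -
  obtain S T where S: "S \<subseteq> (\<Union>d. hom_poly d)" "X = {L \<in> proj UNIV. \<forall>F\<in>S. F (rep L) = 0}"
    and T: "T \<subseteq> (\<Union>d. hom_poly d)" "Y = {L \<in> proj UNIV. \<forall>F\<in>T. F (rep L) = 0}"
    using assms[unfolded zclosed_iff] by (elim exE conjE)
  show ?thesis unfolding zclosed_iff
  proof (intro exI conjI)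
    show "{\<lambda>v. F v * G v | F G. F \<in> S \<and> G \<in> T} \<subseteq> (\<Union>d. hom_poly d)"
    proof
      fix K assume "K \<in> {\<lambda>v. F v * G v | F G. F \<in> S \<and> G \<in> T}"
      then obtain F G where K: "K = (\<lambda>v. F v * G v)" "F \<in> S" "G \<in> T" by blast
      then obtain d e where "F \<in> hom_poly d" "G \<in> hom_poly e" using S(1) T(1) by blast
      then have "K \<in> hom_poly (d + e)" unfolding K(1) by (rule hom_poly_mult)
      then show "K \<in> (\<Union>d. hom_poly d)" by blast
    qed
    show "X \<union> Y = {L \<in> proj UNIV. \<forall>F\<in>{\<lambda>v. F v * G v | F G. F \<in> S \<and> G \<in> T}. F (rep L) = 0}"
    proof (intro equalityI subsetI)
      fix L assume L: "L \<in> {L \<in> proj UNIV. \<forall>K\<in>{\<lambda>v. F v * G v | F G. F \<in> S \<and> G \<in> T}. K (rep L) = 0}"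
      then have L1: "L \<in> proj UNIV" by simp
      have prod: "F (rep L) * G (rep L) = 0" if "F \<in> S" "G \<in> T" for F G
        by (rule bspec[OF conjunct2[OF CollectD[OF L]], of "\<lambda>v. F v * G v"]) (use that in blast)
      have "L \<in> Y" if "L \<notin> X"
      proof -
        from that L1 obtain F where F: "F \<in> S" "F (rep L) \<noteq> 0" unfolding S(2) by auto
        then have "G (rep L) = 0" if "G \<in> T" for G using prod[OF F(1) that] by simp
        with L1 show ?thesis unfolding T(2) by simp
      qed
      then show "L \<in> X \<union> Y" by blast
    qed (auto simp: S(2) T(2))
  qed
qed

lemma zclosed_empty: "zclosed {}"
  using zclosed_zero_set[OF hom_poly_const[of 1]] by simp

text \<open>The equations are the linear forms vanishing on \<open>V\<close>; a vector outside
  \<open>V\<close> is excluded by a separating functional.\<close>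

lemma zclosed_proj:
  assumes "cvec.subspace V"
  shows "zclosed (proj V)"
  unfolding zclosed_iff
proof (intro exI conjI)
  let ?S = "{l :: 'a \<Rightarrow> complex. clin l \<and> (\<forall>v\<in>V. l v = 0)}"
  show "?S \<subseteq> (\<Union>d. hom_poly d)"
    by (intro subsetI UN_I[of 1] hom_poly_linear) simp_all
  show "proj V = {L \<in> proj UNIV. \<forall>F\<in>?S. F (rep L) = 0}"
  proof (intro equalityI subsetI)
    fix L assume L: "L \<in> proj V"
    then have "rep L \<in> V" using rep_in by (auto simp: proj_def)
    then show "L \<in> {L \<in> proj UNIV. \<forall>F\<in>?S. F (rep L) = 0}" using proj_mono_UNIV[OF L] by auto
  next
    fix L assume L: "L \<in> {L \<in> proj UNIV. \<forall>F\<in>?S. F (rep L) = 0}"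
    have "rep L \<in> V"
    proof (rule ccontr)
      assume "rep L \<notin> V"
      obtain l :: "'a \<Rightarrow> complex"
        where "clin l" "\<And>v. v \<in> V \<Longrightarrow> l v = 0" "l (rep L) = 1"
        using separating_functional[OF assms \<open>rep L \<notin> V\<close>] by metis
      then have "l \<in> ?S" by simp
      then have "l (rep L) = 0" by (rule bspec[OF conjunct2[OF CollectD[OF L]]])
      with \<open>l (rep L) = 1\<close> show False by simp
    qed
    have L1: "L \<in> proj UNIV" using L by simp
    have "cvec.span {rep L} \<in> proj V"
      by (rule span_in_proj[OF assms \<open>rep L \<in> V\<close> rep_nonzero[OF L1]])
    moreover have "L = cvec.span {rep L}"
      by (rule proj_eq_span[OF L1 rep_in[OF L1] rep_nonzero[OF L1]])
    ultimately show "L \<in> proj V" by simp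
  qed
qed

lemma proj_single:
  assumes L: "L \<in> proj UNIV"
  shows "proj L = {L}"
proof (intro equalityI subsetI)
  fix M assume M: "M \<in> proj L"
  have "M \<subseteq> L" using M by (simp add: proj_def)
  then have "L = M" using proj_eqI[OF L M _ rep_in[OF M] rep_nonzero[OF M]] rep_in[OF M] by blast
  then show "M \<in> {L}" by simp
next
  fix M assume "M \<in> {L}"
  then show "M \<in> proj L" using L by (simp add: proj_def)
qed

lemma zclosed_single:
  assumes "L \<in> proj UNIV"
  shows "zclosed {L}"
proof -
  have "cvec.subspace L" using assms by (simp add: proj_def)
  from zclosed_proj[OF this] show ?thesis by (simp only: proj_single[OF assms])
qed

lemma zclosed_finite:
  assumes "finite X" "X \<subseteq> proj UNIV"
  shows "zclosed X"
  using assms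
proof (induction rule: finite_induct)
  case (insert L X)
  then show ?case using zclosed_Un[OF zclosed_single[of L], of X] by simp
qed (rule zclosed_empty)

lemma zopen_in_subset: "zopen_in X U \<Longrightarrow> U \<subseteq> X"
  by (auto simp: zopen_in_def)

lemma zopen_inI: "zclosed Z \<Longrightarrow> U = X - Z \<Longrightarrow> zopen_in X U"
  unfolding zopen_in_def by blast

lemma zopen_in_self: "zopen_in X X"
  by (rule zopen_inI[OF zclosed_empty]) simp

lemma zopen_in_Int:
  assumes "zopen_in X U" "zopen_in X V"
  shows "zopen_in X (U \<inter> V)"
proof -
  obtain A B where "zclosed A" "U = X - A" "zclosed B" "V = X - B"
    using assms by (auto simp: zopen_in_def)
  then show ?thesis by (intro zopen_inI[OF zclosed_Un[of A B]]) auto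
qed

lemma zopen_in_diff_finite:
  assumes "zopen_in X U" "finite S" "X \<subseteq> proj UNIV"
  shows "zopen_in X (U - S)"
proof -
  have "zclosed (S \<inter> X)" by (rule zclosed_finite) (use assms in auto)
  then have "zopen_in X (X - S \<inter> X)" by (rule zopen_inI) simp
  from zopen_in_Int[OF assms(1) this] show ?thesis
    using zopen_in_subset[OF assms(1)] by (auto simp: Int_Diff Diff_Int_distrib2 elim!: back_subst[of "zopen_in X"])
qed

lemma zopen_in_diff_zero_set:
  assumes "zopen_in X U" "F \<in> hom_poly d" "X \<subseteq> proj UNIV"
  shows "zopen_in X {L \<in> U. F (rep L) \<noteq> 0}"
proof -
  have "zopen_in X (X - {L \<in> proj UNIV. F (rep L) = 0})"
    by (rule zopen_inI[OF zclosed_zero_set[OF assms(2)]]) simp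
  from zopen_in_Int[OF assms(1) this] show ?thesis
    using zopen_in_subset[OF assms(1)] assms(3) by (auto elim!: back_subst[of "zopen_in X"])
qed

text \<open>Openness is a local property: the complement is the intersection of all closed sets
  whose complement in \<open>X\<close> lies inside \<open>U\<close>.\<close>

lemma zopen_in_local:
  assumes "X \<subseteq> proj UNIV" "\<And>L. L \<in> U \<Longrightarrow> \<exists>W. zopen_in X W \<and> L \<in> W \<and> W \<subseteq> U"
  shows "zopen_in X U"
proof -
  define \<X> where "\<X> = {Z. zclosed Z \<and> X - Z \<subseteq> U}"
  have "U = X - (proj UNIV \<inter> \<Inter>\<X>)"
  proof (intro equalityI subsetI)
    fix L assume "L \<in> U"
    then obtain W Z where "zclosed Z" "W = X - Z" "L \<in> W" "W \<subseteq> U"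
      using assms(2)[of L] by (auto simp: zopen_in_def)
    then show "L \<in> X - (proj UNIV \<inter> \<Inter>\<X>)" by (auto simp: \<X>_def)
  next
    fix L assume "L \<in> X - (proj UNIV \<inter> \<Inter>\<X>)"
    then show "L \<in> U" using assms(1) by (auto simp: \<X>_def)
  qed
  moreover have "zclosed (proj UNIV \<inter> \<Inter>\<X>)" by (rule zclosed_Inter) (auto simp: \<X>_def)
  ultimately show ?thesis by (intro zopen_inI)
qed


section \<open>Regular functions\<close>

text \<open>The quotient clause of \<open>regular_on\<close>, isolated so that sums, products and
  inverses are checked on a single quotient of forms, and the passage to a common neighbourhood is
  done once for all operations.\<close>

definition ratio_on :: "'v::cvector set set \<Rightarrow> ('v set \<Rightarrow> complex) \<Rightarrow> bool"
  where "ratio_on W f \<longleftrightarrow>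
    (\<exists>d. \<exists>G\<in>hom_poly d. \<exists>H\<in>hom_poly d. \<forall>M\<in>W. \<forall>v\<in>M - {0}. H v \<noteq> 0 \<and> f M = G v / H v)"

lemma ratio_onI:
  assumes "G \<in> hom_poly d" "H \<in> hom_poly d" "\<And>M v. M \<in> W \<Longrightarrow> v \<in> M - {0} \<Longrightarrow> H v \<noteq> 0 \<and> f M = G v / H v"
  shows "ratio_on W f"
  unfolding ratio_on_def
  by (rule exI, rule bexI[OF _ assms(1)], rule bexI[OF _ assms(2)]) (intro ballI assms(3))

lemma ratio_onE:
  assumes "ratio_on W f"
  obtains d G H where "G \<in> hom_poly d" "H \<in> hom_poly d"
    "\<forall>M\<in>W. \<forall>v\<in>M - {0}. H v \<noteq> 0 \<and> f M = G v / H v"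
  using assms unfolding ratio_on_def by (elim exE bexE) (rule that)

lemma ratio_on_cong:
  assumes "ratio_on W f" "V \<subseteq> W" "\<And>x. x \<in> V \<Longrightarrow> f x = g x"
  shows "ratio_on V g"
proof -
  obtain d G H where *: "G \<in> hom_poly d" "H \<in> hom_poly d"
    "\<forall>M\<in>W. \<forall>v\<in>M - {0}. H v \<noteq> 0 \<and> f M = G v / H v" using ratio_onE[OF assms(1)] .
  show ?thesis
  proof (rule ratio_onI[OF *(1,2)])
    fix M v assume M: "M \<in> V" "v \<in> M - {0}"
    then have "H v \<noteq> 0 \<and> f M = G v / H v" using *(3) assms(2) by blast
    then show "H v \<noteq> 0 \<and> g M = G v / H v" using assms(3)[OF M(1)] by simp
  qed
qed

lemma ratio_on_subset: "ratio_on W f \<Longrightarrow> V \<subseteq> W \<Longrightarrow> ratio_on V f"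
  by (rule ratio_on_cong) auto

lemma regular_on_iff:
  "regular_on X U f \<longleftrightarrow> (\<forall>L\<in>U. \<exists>W. zopen_in X W \<and> L \<in> W \<and> W \<subseteq> U \<and> ratio_on W f)"
  unfolding regular_on_def ratio_on_def by (simp only: ex_simps)

lemma regular_onE:
  assumes "X \<subseteq> proj UNIV" "regular_on X U f" "L \<in> U"
  obtains W d G H where "zopen_in X W" "L \<in> W" "W \<subseteq> U" "G \<in> hom_poly d" "H \<in> hom_poly d"
    "\<forall>M\<in>W. H (rep M) \<noteq> 0 \<and> f M = G (rep M) / H (rep M)"
proof -
  obtain W where W: "zopen_in X W" "L \<in> W" "W \<subseteq> U" "ratio_on W f"
    using assms(2,3) unfolding regular_on_iff by blast
  obtain d G H where GH: "G \<in> hom_poly d" "H \<in> hom_poly d"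
    "\<forall>M\<in>W. \<forall>v\<in>M - {0}. H v \<noteq> 0 \<and> f M = G v / H v" using ratio_onE[OF W(4)] .
  have "rep M \<in> M - {0}" if "M \<in> W" for M
    using that zopen_in_subset[OF W(1)] assms(1) rep_in[of M UNIV] rep_nonzero[of M UNIV] by blast
  with GH(3) have "\<forall>M\<in>W. H (rep M) \<noteq> 0 \<and> f M = G (rep M) / H (rep M)" by blast
  then show thesis by (rule that[OF W(1-3) GH(1,2)])
qed

lemma regular_on_zopen:
  assumes "X \<subseteq> proj UNIV" "regular_on X U f"
  shows "zopen_in X U"
  by (rule zopen_in_local[OF assms(1)]) (use assms(2) in \<open>auto simp: regular_on_iff\<close>)

lemma regular_on_subset:
  assumes "regular_on X U f" "zopen_in X V" "V \<subseteq> U"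
  shows "regular_on X V f"
  unfolding regular_on_iff
proof
  fix L assume L: "L \<in> V"
  then obtain W where "zopen_in X W" "L \<in> W" "ratio_on W f"
    using assms(1,3) unfolding regular_on_iff by blast
  with L show "\<exists>W. zopen_in X W \<and> L \<in> W \<and> W \<subseteq> V \<and> ratio_on W f"
    by (intro exI[of _ "W \<inter> V"]) (auto intro: zopen_in_Int assms(2) ratio_on_subset)
qed

lemma regular_on_cong:
  assumes "regular_on X U f" "\<And>x. x \<in> U \<Longrightarrow> f x = g x"
  shows "regular_on X U g"
  using assms ratio_on_cong[OF _ subset_refl, of _ f g] unfolding regular_on_iff by (meson subsetD)

lemma regular_on_local:
  assumes "\<And>x. x \<in> U \<Longrightarrow> \<exists>V. x \<in> V \<and> V \<subseteq> U \<and> regular_on X V f"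
  shows "regular_on X U f"
  using assms unfolding regular_on_iff by (meson subset_trans)

lemma regular_on_const:
  assumes "zopen_in X U"
  shows "regular_on X U (\<lambda>_. c)"
proof -
  have "ratio_on U (\<lambda>_. c)" by (rule ratio_onI[OF hom_poly_const[of c] hom_poly_const[of 1]]) simp
  then show ?thesis using assms unfolding regular_on_iff by blast
qed

lemma regular_on_unop:
  assumes "regular_on X U f" "\<And>W. W \<subseteq> U \<Longrightarrow> ratio_on W f \<Longrightarrow> ratio_on W g"
  shows "regular_on X U g"
  using assms unfolding regular_on_iff by meson

lemma regular_on_binop:
  assumes "regular_on X U f" "regular_on X U g"
    "\<And>W. ratio_on W f \<Longrightarrow> ratio_on W g \<Longrightarrow> ratio_on W h"
  shows "regular_on X U h"
  unfolding regular_on_iff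
proof
  fix L assume L: "L \<in> U"
  obtain V where V: "zopen_in X V" "L \<in> V" "V \<subseteq> U" "ratio_on V f"
    using assms(1) L unfolding regular_on_iff by blast
  obtain W where W: "zopen_in X W" "L \<in> W" "W \<subseteq> U" "ratio_on W g"
    using assms(2) L unfolding regular_on_iff by blast
  have "ratio_on (V \<inter> W) h"
    using ratio_on_subset[OF V(4), of "V \<inter> W"] ratio_on_subset[OF W(4), of "V \<inter> W"] by (intro assms(3)) auto
  with V W show "\<exists>W. zopen_in X W \<and> L \<in> W \<and> W \<subseteq> U \<and> ratio_on W h"
    by (intro exI[of _ "V \<inter> W"]) (auto intro: zopen_in_Int)
qed

lemma regular_on_add:
  assumes "regular_on X U f" "regular_on X U g"
  shows "regular_on X U (\<lambda>x. f x + g x)"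
proof (rule regular_on_binop[OF assms])
  fix W assume "ratio_on W f" "ratio_on W g"
  then obtain d G H e G' H' where *: "G \<in> hom_poly d" "H \<in> hom_poly d" "G' \<in> hom_poly e" "H' \<in> hom_poly e"
    "\<forall>M\<in>W. \<forall>v\<in>M - {0}. H v \<noteq> 0 \<and> f M = G v / H v"
    "\<forall>M\<in>W. \<forall>v\<in>M - {0}. H' v \<noteq> 0 \<and> g M = G' v / H' v"
    by (elim ratio_onE)
  have "(\<lambda>v. G v * H' v + H v * G' v) \<in> hom_poly (d + e)" by (intro hom_poly_add hom_poly_mult *)
  then show "ratio_on W (\<lambda>x. f x + g x)"
  proof (rule ratio_onI[OF _ hom_poly_mult[OF *(2,4)]])
    fix M v assume "M \<in> W" "v \<in> M - {0}"
    then have "H v \<noteq> 0 \<and> f M = G v / H v" "H' v \<noteq> 0 \<and> g M = G' v / H' v" using *(5,6) by blast+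
    then show "H v * H' v \<noteq> 0 \<and> f M + g M = (G v * H' v + H v * G' v) / (H v * H' v)"
      by (simp add: add_frac_eq mult.commute)
  qed
qed

lemma regular_on_mult:
  assumes "regular_on X U f" "regular_on X U g"
  shows "regular_on X U (\<lambda>x. f x * g x)"
proof (rule regular_on_binop[OF assms])
  fix W assume "ratio_on W f" "ratio_on W g"
  then obtain d G H e G' H' where *: "G \<in> hom_poly d" "H \<in> hom_poly d" "G' \<in> hom_poly e" "H' \<in> hom_poly e"
    "\<forall>M\<in>W. \<forall>v\<in>M - {0}. H v \<noteq> 0 \<and> f M = G v / H v"
    "\<forall>M\<in>W. \<forall>v\<in>M - {0}. H' v \<noteq> 0 \<and> g M = G' v / H' v"
    by (elim ratio_onE)
  show "ratio_on W (\<lambda>x. f x * g x)"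
  proof (rule ratio_onI[OF hom_poly_mult[OF *(1,3)] hom_poly_mult[OF *(2,4)]])
    fix M v assume "M \<in> W" "v \<in> M - {0}"
    then have "H v \<noteq> 0 \<and> f M = G v / H v" "H' v \<noteq> 0 \<and> g M = G' v / H' v" using *(5,6) by blast+
    then show "H v * H' v \<noteq> 0 \<and> f M * g M = (G v * G' v) / (H v * H' v)" by simp
  qed
qed

lemma regular_on_cmult:
  assumes "regular_on X U f"
  shows "regular_on X U (\<lambda>x. c * f x)"
proof (rule regular_on_unop[OF assms])
  fix W assume "ratio_on W f"
  then obtain d G H where *: "G \<in> hom_poly d" "H \<in> hom_poly d"
    "\<forall>M\<in>W. \<forall>v\<in>M - {0}. H v \<noteq> 0 \<and> f M = G v / H v" by (elim ratio_onE)
  show "ratio_on W (\<lambda>x. c * f x)"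
    by (rule ratio_onI[OF hom_poly_cmult[OF *(1), of c] *(2)]) (use *(3) in fastforce)
qed

lemma regular_on_diff:
  assumes "regular_on X U f" "regular_on X U g"
  shows "regular_on X U (\<lambda>x. f x - g x)"
  using regular_on_add[OF assms(1) regular_on_cmult[OF assms(2), of "-1"]] by simp

lemma regular_on_power:
  assumes "X \<subseteq> proj UNIV" "regular_on X U f"
  shows "regular_on X U (\<lambda>x. f x ^ n)"
proof (induction n)
  case (Suc n)
  then show ?case using regular_on_mult[OF assms(2)] by simp
qed (simp add: regular_on_const[OF regular_on_zopen[OF assms]])

lemma regular_on_inverse:
  assumes "regular_on X U f" "\<And>x. x \<in> U \<Longrightarrow> f x \<noteq> 0"
  shows "regular_on X U (\<lambda>x. inverse (f x))"
proof (rule regular_on_unop[OF assms(1)])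
  fix W assume W: "W \<subseteq> U" "ratio_on W f"
  then obtain d G H where *: "G \<in> hom_poly d" "H \<in> hom_poly d"
    "\<forall>M\<in>W. \<forall>v\<in>M - {0}. H v \<noteq> 0 \<and> f M = G v / H v" by (elim ratio_onE)
  show "ratio_on W (\<lambda>x. inverse (f x))"
  proof (rule ratio_onI[OF *(2,1)])
    fix M v assume M: "M \<in> W" "v \<in> M - {0}"
    then have "f M = G v / H v" "f M \<noteq> 0" using *(3) W(1) assms(2) by blast+
    then show "G v \<noteq> 0 \<and> inverse (f M) = H v / G v" by auto
  qed
qed

text \<open>Locally \<open>f\<close> is a quotient of forms, and it is nonzero exactly where its
  numerator is.\<close>

lemma zopen_in_nonzero:
  assumes X: "X \<subseteq> proj UNIV" and f: "regular_on X U f"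
  shows "zopen_in X {x \<in> U. f x \<noteq> 0}"
proof (rule zopen_in_local[OF X])
  fix L assume L: "L \<in> {x \<in> U. f x \<noteq> 0}"
  then have L': "L \<in> U" by simp
  obtain W d G H where *: "zopen_in X W" "L \<in> W" "W \<subseteq> U"
    "G \<in> hom_poly d" "H \<in> hom_poly d" "\<forall>M\<in>W. H (rep M) \<noteq> 0 \<and> f M = G (rep M) / H (rep M)"
    using regular_onE[OF X f L'] .
  show "\<exists>W. zopen_in X W \<and> L \<in> W \<and> W \<subseteq> {x \<in> U. f x \<noteq> 0}"
  proof (intro exI conjI)
    show "zopen_in X {L \<in> W. G (rep L) \<noteq> 0}" by (rule zopen_in_diff_zero_set[OF *(1,4) X])
    show "L \<in> {L \<in> W. G (rep L) \<noteq> 0}" "{L \<in> W. G (rep L) \<noteq> 0} \<subseteq> {x \<in> U. f x \<noteq> 0}"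
      using * L by auto
  qed
qed

section \<open>Noetherian rings of polynomial functions\<close>

text \<open>Rings are subsets of one type, because the polynomial functions in different numbers of
  variables are all functions on the same space of sequences and are nested in each other.\<close>

definition is_subring :: "'a::comm_ring_1 set \<Rightarrow> bool"
  where "is_subring A \<longleftrightarrow> 0 \<in> A \<and> 1 \<in> A \<and> (\<forall>x\<in>A. - x \<in> A) \<and> (\<forall>x\<in>A. \<forall>y\<in>A. x + y \<in> A \<and> x * y \<in> A)"

inductive_set ideal_gen :: "'a::comm_ring_1 set \<Rightarrow> 'a set \<Rightarrow> 'a set" for A S
  where zero: "0 \<in> ideal_gen A S"
  | step: "a \<in> A \<Longrightarrow> s \<in> S \<Longrightarrow> r \<in> ideal_gen A S \<Longrightarrow> a * s + r \<in> ideal_gen A S"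

text \<open>Stated for generating sets instead of ideals: the finitely many generators can be taken
  from \<open>S\<close> itself. In this form an ascending union of ideals is generated by elements
  that all occur at one stage.\<close>

definition noetherian :: "'a::comm_ring_1 set \<Rightarrow> bool"
  where "noetherian A \<longleftrightarrow> (\<forall>S\<subseteq>A. \<exists>T\<subseteq>S. finite T \<and> S \<subseteq> ideal_gen A T)"

lemma is_subringD:
  assumes "is_subring A"
  shows "0 \<in> A" "1 \<in> A" "x \<in> A \<Longrightarrow> - x \<in> A" "x \<in> A \<Longrightarrow> y \<in> A \<Longrightarrow> x + y \<in> A"
    "x \<in> A \<Longrightarrow> y \<in> A \<Longrightarrow> x * y \<in> A" "x \<in> A \<Longrightarrow> y \<in> A \<Longrightarrow> x - y \<in> A"
proof -
  show minus: "x \<in> A \<Longrightarrow> - x \<in> A" and add: "x \<in> A \<Longrightarrow> y \<in> A \<Longrightarrow> x + y \<in> A" for x y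
    using assms by (auto simp: is_subring_def)
  show "x \<in> A \<Longrightarrow> y \<in> A \<Longrightarrow> x - y \<in> A" using add[of x "- y"] minus[of y] by simp
qed (use assms in \<open>auto simp: is_subring_def\<close>)

lemma is_subring_sum: "is_subring A \<Longrightarrow> (\<And>i. i \<in> I \<Longrightarrow> f i \<in> A) \<Longrightarrow> sum f I \<in> A"
  by (induction I rule: infinite_finite_induct) (auto simp: is_subringD)

lemma is_subring_power: "is_subring A \<Longrightarrow> x \<in> A \<Longrightarrow> x ^ n \<in> A"
  by (induction n) (auto simp: is_subringD)

lemma ideal_gen_base: "is_subring A \<Longrightarrow> s \<in> S \<Longrightarrow> s \<in> ideal_gen A S"
  using ideal_gen.step[of 1 A s S 0] by (simp add: is_subringD ideal_gen.zero)

lemma ideal_gen_add: "x \<in> ideal_gen A S \<Longrightarrow> y \<in> ideal_gen A S \<Longrightarrow> x + y \<in> ideal_gen A S"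
  by (induction rule: ideal_gen.induct) (simp_all add: add.assoc ideal_gen.step)

lemma ideal_gen_mult:
  assumes "is_subring A" "a \<in> A" "x \<in> ideal_gen A S"
  shows "a * x \<in> ideal_gen A S"
  using assms(3)
proof (induction rule: ideal_gen.induct)
  case zero
  show ?case by (simp add: ideal_gen.zero)
next
  case (step b s r)
  have "(a * b) * s + a * r \<in> ideal_gen A S"
    using step assms by (intro ideal_gen.step) (auto simp: is_subringD)
  then show ?case by (simp add: algebra_simps)
qed

lemma ideal_gen_minimal:
  assumes "0 \<in> J" "\<And>a x. a \<in> A \<Longrightarrow> x \<in> J \<Longrightarrow> a * x \<in> J" "\<And>x y. x \<in> J \<Longrightarrow> y \<in> J \<Longrightarrow> x + y \<in> J" "S \<subseteq> J"
  shows "ideal_gen A S \<subseteq> J"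
proof
  fix x assume "x \<in> ideal_gen A S"
  then show "x \<in> J"
  proof (induction rule: ideal_gen.induct)
    case (step a s r)
    then show ?case using assms(4) by (intro assms(2,3)) auto
  qed (rule assms(1))
qed

lemma ideal_gen_trans:
  assumes "is_subring A" "S \<subseteq> ideal_gen A T"
  shows "ideal_gen A S \<subseteq> ideal_gen A T"
  using assms by (intro ideal_gen_minimal ideal_gen.zero ideal_gen_mult ideal_gen_add)

lemma ideal_gen_mono:
  assumes "is_subring A" "S \<subseteq> T"
  shows "ideal_gen A S \<subseteq> ideal_gen A T"
  using ideal_gen_base[OF assms(1)] assms(2) by (intro ideal_gen_trans[OF assms(1)]) auto

lemma ideal_gen_subset: "is_subring A \<Longrightarrow> S \<subseteq> A \<Longrightarrow> ideal_gen A S \<subseteq> A"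
  by (intro ideal_gen_minimal) (auto simp: is_subringD)

lemma ideal_gen_finite:
  assumes "is_subring A" "x \<in> ideal_gen A S"
  shows "\<exists>T\<subseteq>S. finite T \<and> x \<in> ideal_gen A T"
  using assms(2)
proof (induction rule: ideal_gen.induct)
  case zero
  show ?case by (rule exI[of _ "{}"]) (simp add: ideal_gen.zero)
next
  case (step a s r)
  then obtain T where T: "T \<subseteq> S" "finite T" "r \<in> ideal_gen A T" by blast
  have "r \<in> ideal_gen A (insert s T)" using ideal_gen_mono[OF assms(1), of T "insert s T"] T by blast
  then have "a * s + r \<in> ideal_gen A (insert s T)" using step by (intro ideal_gen.step) auto
  then show ?case using T step by (intro exI[of _ "insert s T"]) auto
qed

text \<open>The element \<open>x\<close> need not be transcendental over \<open>A\<close>, so an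
  element of the extension may be the value of several polynomials; degrees and leading coefficients
  belong to the polynomial, not to its value.\<close>

definition adjoin :: "'a::comm_ring_1 set \<Rightarrow> 'a \<Rightarrow> 'a set"
  where "adjoin A x = {poly p x | p. \<forall>i. coeff p i \<in> A}"

lemma coeff_mult_subring:
  "is_subring A \<Longrightarrow> \<forall>i. coeff p i \<in> A \<Longrightarrow> \<forall>i. coeff q i \<in> A \<Longrightarrow> coeff (p * q) i \<in> A"
  unfolding coeff_mult by (intro is_subring_sum) (auto simp: is_subringD)

lemma is_subring_adjoin:
  assumes "is_subring A"
  shows "is_subring (adjoin A x)"
  unfolding is_subring_def
proof (intro conjI ballI)
  show "0 \<in> adjoin A x" unfolding adjoin_def
    by (intro CollectI exI[of _ 0]) (simp add: is_subringD[OF assms])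
  show "1 \<in> adjoin A x" unfolding adjoin_def
    by (intro CollectI exI[of _ 1]) (simp add: is_subringD[OF assms] coeff_1)
next
  fix y assume "y \<in> adjoin A x"
  then obtain p where "y = poly p x" "\<forall>i. coeff p i \<in> A" by (auto simp: adjoin_def)
  then show "- y \<in> adjoin A x" unfolding adjoin_def
    by (intro CollectI exI[of _ "- p"]) (simp add: is_subringD[OF assms])
  fix z assume "z \<in> adjoin A x"
  then obtain q where "z = poly q x" "\<forall>i. coeff q i \<in> A" by (auto simp: adjoin_def)
  with \<open>y = poly p x\<close> \<open>\<forall>i. coeff p i \<in> A\<close> show "y + z \<in> adjoin A x" "y * z \<in> adjoin A x" unfolding adjoin_def
    by (intro CollectI exI[of _ "p + q"] exI[of _ "p * q"];
        simp add: is_subringD[OF assms] coeff_mult_subring[OF assms])+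
qed

lemma adjoin_const: "is_subring A \<Longrightarrow> a \<in> A \<Longrightarrow> a \<in> adjoin A x"
  unfolding adjoin_def
  by (intro CollectI exI[of _ "[:a:]"]) (auto simp: is_subringD coeff_pCons split: nat.splits)

lemma adjoin_self: "is_subring A \<Longrightarrow> x \<in> adjoin A x"
  unfolding adjoin_def
  by (intro CollectI exI[of _ "[:0, 1:]"]) (auto simp: is_subringD coeff_pCons split: nat.splits)

text \<open>The degree is only bounded by \<open>d\<close>, so the coefficient may be 0; this makes
  the set closed under addition and, after multiplication by \<open>x\<close>, increasing in
  \<open>d\<close>.\<close>

definition leading_ideal :: "'a::comm_ring_1 set \<Rightarrow> 'a \<Rightarrow> 'a set \<Rightarrow> nat \<Rightarrow> 'a set"
  where "leading_ideal A x J d =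
    {coeff p d | p. (\<forall>i. coeff p i \<in> A) \<and> (\<forall>i>d. coeff p i = 0) \<and> poly p x \<in> J}"

lemma leading_ideal_Suc:
  assumes "is_subring A" "\<And>y. y \<in> J \<Longrightarrow> x * y \<in> J"
  shows "leading_ideal A x J d \<subseteq> leading_ideal A x J (Suc d)"
proof
  fix a assume "a \<in> leading_ideal A x J d"
  then obtain p where p: "a = coeff p d" "\<forall>i. coeff p i \<in> A" "\<forall>i>d. coeff p i = 0" "poly p x \<in> J"
    by (auto simp: leading_ideal_def)
  then show "a \<in> leading_ideal A x J (Suc d)" unfolding leading_ideal_def
    using assms(2) by (intro CollectI exI[of _ "pCons 0 p"])
      (auto simp: coeff_pCons is_subringD[OF assms(1)] split: nat.splits)
qed

lemma leading_ideal_mono: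
  assumes "is_subring A" "\<And>y. y \<in> J \<Longrightarrow> x * y \<in> J" "d \<le> e"
  shows "leading_ideal A x J d \<subseteq> leading_ideal A x J e"
  by (rule lift_Suc_mono_le[OF _ assms(3)]) (rule leading_ideal_Suc[OF assms(1,2)])

lemma leading_ideal_gen:
  assumes "is_subring A" "T \<subseteq> leading_ideal A x J d" "0 \<in> J"
    "\<And>a y. a \<in> A \<Longrightarrow> y \<in> J \<Longrightarrow> a * y \<in> J" "\<And>y z. y \<in> J \<Longrightarrow> z \<in> J \<Longrightarrow> y + z \<in> J"
  shows "ideal_gen A T \<subseteq> leading_ideal A x J d"
proof (rule ideal_gen_minimal[OF _ _ _ assms(2)])
  show "0 \<in> leading_ideal A x J d" unfolding leading_ideal_def
    by (intro CollectI exI[of _ 0]) (simp add: is_subringD[OF assms(1)] assms(3))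
  show "a * b \<in> leading_ideal A x J d" if "a \<in> A" "b \<in> leading_ideal A x J d" for a b
  proof -
    from that(2) obtain p where "b = coeff p d" "\<forall>i. coeff p i \<in> A" "\<forall>i>d. coeff p i = 0" "poly p x \<in> J"
      by (auto simp: leading_ideal_def)
    with that(1) show ?thesis unfolding leading_ideal_def
      by (intro CollectI exI[of _ "smult a p"]) (simp add: is_subringD[OF assms(1)] assms(4))
  qed
  show "a + b \<in> leading_ideal A x J d" if "a \<in> leading_ideal A x J d" "b \<in> leading_ideal A x J d" for a b
  proof -
    from that(2) obtain p where "b = coeff p d" "\<forall>i. coeff p i \<in> A" "\<forall>i>d. coeff p i = 0" "poly p x \<in> J"
      by (auto simp: leading_ideal_def)
    moreover from that(1) obtain q where "a = coeff q d" "\<forall>i. coeff q i \<in> A" "\<forall>i>d. coeff q i = 0" "poly q x \<in> J"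
      by (auto simp: leading_ideal_def)
    ultimately show ?thesis unfolding leading_ideal_def
      by (intro CollectI exI[of _ "q + p"]) (simp add: is_subringD[OF assms(1)] assms(5))
  qed
qed

text \<open>Leading coefficients of elements of the ideal \<open>J\<close> stabilize at some degree
  \<open>D\<close>. Lifts of finitely many generators of the leading ideals up to degree
  \<open>D\<close> generate \<open>J\<close>, since the top coefficient of any polynomial with value
  in \<open>J\<close> can be cancelled by them.\<close>

theorem hilbert_basis:
  assumes A: "is_subring A" and noeth: "noetherian A"
  shows "noetherian (adjoin A x)"
  unfolding noetherian_def
proof (intro allI impI)
  let ?R = "adjoin A x"
  have R: "is_subring ?R" by (rule is_subring_adjoin[OF A])
  fix S assume S: "S \<subseteq> ?R"
  define J where "J = ideal_gen ?R S"
  have J: "0 \<in> J" "\<And>a y. a \<in> ?R \<Longrightarrow> y \<in> J \<Longrightarrow> a * y \<in> J" "\<And>y z. y \<in> J \<Longrightarrow> z \<in> J \<Longrightarrow> y + z \<in> J"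
    unfolding J_def by (auto intro: ideal_gen.zero ideal_gen_mult[OF R] ideal_gen_add)
  have JA: "\<And>a y. a \<in> A \<Longrightarrow> y \<in> J \<Longrightarrow> a * y \<in> J" using J(2) adjoin_const[OF A] by blast
  have Jx: "\<And>y. y \<in> J \<Longrightarrow> x * y \<in> J" using J(2) adjoin_self[OF A] by blast
  let ?L = "leading_ideal A x J"
  have LA: "?L d \<subseteq> A" for d by (auto simp: leading_ideal_def)
  have "\<exists>T\<subseteq>(\<Union>d. ?L d). finite T \<and> (\<Union>d. ?L d) \<subseteq> ideal_gen A T"
    using noeth LA by (simp add: noetherian_def UN_least)
  then obtain T where T: "T \<subseteq> (\<Union>d. ?L d)" "finite T" "(\<Union>d. ?L d) \<subseteq> ideal_gen A T" by blast
  from T(2,1) have "\<exists>D. T \<subseteq> ?L D"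
  proof (induction T rule: finite_induct)
    case (insert t T)
    then obtain D d where "T \<subseteq> ?L D" "t \<in> ?L d" by blast
    then have "insert t T \<subseteq> ?L (max D d)"
      using leading_ideal_mono[OF A Jx, of D "max D d"] leading_ideal_mono[OF A Jx, of d "max D d"] by auto
    then show ?case by blast
  qed simp
  then obtain D where D: "T \<subseteq> ?L D" ..
  \<comment> \<open>The generators in \<open>T\<close> generate the leading coefficients of all
    degrees and lie at level \<open>D\<close>, so no degree contributes anything beyond level
    \<open>D\<close>.\<close>
  have LD: "?L d \<subseteq> ?L D" for d
    using T(3) leading_ideal_gen[OF A D J(1) JA J(3)] by blast
  have "\<forall>d. \<exists>U\<subseteq>?L d. finite U \<and> ?L d \<subseteq> ideal_gen A U"
    using noeth LA by (simp add: noetherian_def)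
  from choice[OF this] obtain U where U: "\<And>d. U d \<subseteq> ?L d" "\<And>d. finite (U d)" "\<And>d. ?L d \<subseteq> ideal_gen A (U d)"
    by blast
  have "\<forall>d. \<forall>a\<in>U d. \<exists>p. a = coeff p d \<and> (\<forall>i. coeff p i \<in> A) \<and> (\<forall>i>d. coeff p i = 0) \<and> poly p x \<in> J"
    using U(1) unfolding leading_ideal_def by blast
  then have "\<forall>d. \<exists>q. \<forall>a\<in>U d. a = coeff (q a) d \<and> (\<forall>i. coeff (q a) i \<in> A) \<and> (\<forall>i>d. coeff (q a) i = 0) \<and> poly (q a) x \<in> J"
    by (intro allI bchoice) blast
  from choice[OF this] obtain q where q: "\<And>d a. a \<in> U d \<Longrightarrow> a = coeff (q d a) d \<and> (\<forall>i. coeff (q d a) i \<in> A) \<and>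
    (\<forall>i>d. coeff (q d a) i = 0) \<and> poly (q d a) x \<in> J"
    by blast
  define W where "W = (\<Union>d\<le>D. (\<lambda>a. poly (q d a) x) ` U d)"
  have W: "finite W" "W \<subseteq> J" unfolding W_def using U(2) q by auto
  have WJ: "ideal_gen ?R W \<subseteq> J" by (rule ideal_gen_minimal[OF J W(2)])
  \<comment> \<open>The generators in \<open>U d\<close> have lifts with values in \<open>W\<close>;
    an \<open>A\<close>-linear combination of these lifts realizes any prescribed leading
    coefficient without leaving the ideal of \<open>W\<close>.\<close>
  have lift: "\<exists>p. coeff p d = a \<and> (\<forall>i. coeff p i \<in> A) \<and> (\<forall>i>d. coeff p i = 0) \<and> poly p x \<in> ideal_gen ?R W"
    if "a \<in> ideal_gen A (U d)" "d \<le> D" for a d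
    using that(1)
  proof (induction rule: ideal_gen.induct)
    case zero
    show ?case by (rule exI[of _ 0]) (simp add: is_subringD[OF A] ideal_gen.zero)
  next
    case (step a s r)
    then obtain p where p: "coeff p d = r" "\<forall>i. coeff p i \<in> A" "\<forall>i>d. coeff p i = 0" "poly p x \<in> ideal_gen ?R W"
      by blast
    have "poly (q d s) x \<in> W" unfolding W_def using step(2) that(2) by auto
    then have "a * poly (q d s) x + poly p x \<in> ideal_gen ?R W"
      using step(1) p(4) by (intro ideal_gen.step adjoin_const[OF A])
    then show ?case using p step(1) q[OF step(2)]
      by (intro exI[of _ "smult a (q d s) + p"]) (simp add: is_subringD[OF A])
  qed
  have "poly p x \<in> ideal_gen ?R W" if "\<forall>i. coeff p i \<in> A" "\<forall>i\<ge>n. coeff p i = 0" "poly p x \<in> J" for n p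
    using that
  proof (induction n arbitrary: p)
    case 0
    then have "p = 0" by (simp add: poly_eq_iff)
    then show ?case by (simp add: ideal_gen.zero)
  next
    case (Suc n)
    \<comment> \<open>Beyond degree \<open>D\<close> the cancelling polynomial is taken at level
      \<open>D\<close> and multiplied by the missing power \<open>n - d\<close> of the
      variable.\<close>
    define d where "d = min n D"
    have "coeff p n \<in> ?L n" using Suc.prems unfolding leading_ideal_def by (intro CollectI exI[of _ p]) auto
    then have "coeff p n \<in> ?L d" unfolding d_def using LD[of n] by (cases "n \<le> D") (auto simp: min_def)
    then have "coeff p n \<in> ideal_gen A (U d)" using U(3) by blast
    from lift[OF this] obtain r where r: "coeff r d = coeff p n" "\<forall>i. coeff r i \<in> A" "\<forall>i>d. coeff r i = 0"
      "poly r x \<in> ideal_gen ?R W" by (auto simp: d_def)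
    define r' where "r' = monom 1 (n - d) * r"
    have c: "coeff r' i = (if i < n - d then 0 else coeff r (i - (n - d)))" for i
      unfolding r'_def by (simp add: coeff_monom_mult)
    have r'J: "poly r' x \<in> ideal_gen ?R W"
      unfolding r'_def by (simp add: poly_monom ideal_gen_mult[OF R] is_subring_power[OF R] adjoin_self[OF A] r(4))
    have "poly (p - r') x \<in> ideal_gen ?R W"
    proof (rule Suc.IH)
      show "\<forall>i. coeff (p - r') i \<in> A" using Suc.prems(1) r(2) by (simp add: c is_subringD[OF A])
      show "\<forall>i\<ge>n. coeff (p - r') i = 0"
      proof (intro allI impI)
        fix i assume "n \<le> i"
        then consider "i = n" | "i > n" by linarith
        then show "coeff (p - r') i = 0"
        proof cases
          case 1
          have "\<not> n < n - d" "n - (n - d) = d" by (auto simp: d_def)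
          then show ?thesis using 1 r(1) by (simp add: c)
        next
          case 2
          have "i - (n - d) > d" "\<not> i < n - d" using 2 by (auto simp: d_def)
          then show ?thesis using 2 r(3) Suc.prems(2) by (simp add: c)
        qed
      qed
      have "- 1 * poly r' x \<in> J" using r'J WJ is_subringD[OF R] by (intro J(2)) auto
      then show "poly (p - r') x \<in> J" using J(3)[OF Suc.prems(3), of "- poly r' x"] by simp
    qed
    from ideal_gen_add[OF this r'J] show ?case by simp
  qed
  then have JW: "J \<subseteq> ideal_gen ?R W" 
  proof -
    have "y \<in> ideal_gen ?R W" if "y \<in> J" for y
    proof -
      have "y \<in> ?R" using that ideal_gen_subset[OF R S] by (auto simp: J_def)
      then obtain p where "y = poly p x" "\<forall>i. coeff p i \<in> A" by (auto simp: adjoin_def)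
      then show ?thesis
        using \<open>\<And>p n. \<lbrakk>\<forall>i. coeff p i \<in> A; \<forall>i\<ge>n. coeff p i = 0; poly p x \<in> J\<rbrakk> \<Longrightarrow> poly p x \<in> ideal_gen ?R W\<close>[of p "Suc (degree p)"] that
        by (simp add: coeff_eq_0)
    qed
    then show ?thesis by blast
  qed
  \<comment> \<open>The generators found so far lie in the ideal of \<open>S\<close> but perhaps not
    in \<open>S\<close>. Each of them uses only finitely many elements of \<open>S\<close>, and
    these together form the required finite subset.\<close>
  have "\<forall>w\<in>W. \<exists>V\<subseteq>S. finite V \<and> w \<in> ideal_gen ?R V"
    using W(2) ideal_gen_finite[OF R] unfolding J_def by blast
  from bchoice[OF this] obtain V where V: "\<forall>w\<in>W. V w \<subseteq> S \<and> finite (V w) \<and> w \<in> ideal_gen ?R (V w)" ..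
  have "W \<subseteq> ideal_gen ?R (\<Union>(V ` W))"
    using V ideal_gen_mono[OF R] by (meson UN_upper subsetD subsetI)
  then have "ideal_gen ?R W \<subseteq> ideal_gen ?R (\<Union>(V ` W))" by (rule ideal_gen_trans[OF R])
  moreover have "S \<subseteq> J" unfolding J_def using ideal_gen_base[OF R] by blast
  ultimately have "S \<subseteq> ideal_gen ?R (\<Union>(V ` W))" using JW by blast
  moreover have "\<Union>(V ` W) \<subseteq> S" "finite (\<Union>(V ` W))" using V W(1) by auto
  ultimately show "\<exists>T\<subseteq>S. finite T \<and> S \<subseteq> ideal_gen ?R T" by blast
qed

section \<open>Polynomial functions of finitely many coordinates\<close>

inductive_set polyfun :: "nat \<Rightarrow> ((nat \<Rightarrow> complex) \<Rightarrow> complex) set" for N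
  where const: "(\<lambda>_. c) \<in> polyfun N"
  | coord: "i < N \<Longrightarrow> (\<lambda>x. x i) \<in> polyfun N"
  | add: "p \<in> polyfun N \<Longrightarrow> q \<in> polyfun N \<Longrightarrow> (\<lambda>x. p x + q x) \<in> polyfun N"
  | mult: "p \<in> polyfun N \<Longrightarrow> q \<in> polyfun N \<Longrightarrow> (\<lambda>x. p x * q x) \<in> polyfun N"

lemma is_subring_polyfun: "is_subring (polyfun N)"
  unfolding is_subring_def
proof (intro conjI ballI)
  show "0 \<in> polyfun N" using polyfun.const[of 0 N] by (simp add: zero_fun_def)
  show "1 \<in> polyfun N" using polyfun.const[of 1 N] by (simp add: one_fun_def)
  show "- p \<in> polyfun N" if "p \<in> polyfun N" for p
    using polyfun.mult[OF polyfun.const[of "-1"] that] by (simp add: fun_Compl_def)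
  show "p + q \<in> polyfun N" "p * q \<in> polyfun N" if "p \<in> polyfun N" "q \<in> polyfun N" for p q
    using polyfun.add[OF that] polyfun.mult[OF that] by (simp_all add: plus_fun_def times_fun_def)
qed

lemma polyfun_Suc_mono: "p \<in> polyfun N \<Longrightarrow> p \<in> polyfun (Suc N)"
  by (induction rule: polyfun.induct) (auto intro: polyfun.intros)

text \<open>The new coordinate function is the adjoined element, which makes Hilbert's basis theorem
  the induction step for the number of variables.\<close>

lemma polyfun_Suc: "polyfun (Suc N) = adjoin (polyfun N) (\<lambda>x. x N)"
proof (intro equalityI subsetI)
  let ?R = "adjoin (polyfun N) (\<lambda>x. x N)"
  note A = is_subring_polyfun[of N] and R = is_subring_adjoin[OF is_subring_polyfun[of N], of "\<lambda>x. x N"]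
  fix p assume "p \<in> polyfun (Suc N)"
  then show "p \<in> ?R"
  proof (induction rule: polyfun.induct)
    case (const c)
    show ?case by (rule adjoin_const[OF A polyfun.const])
  next
    case (coord i)
    show ?case
    proof (cases "i = N")
      case True
      then show ?thesis using adjoin_self[OF A] by simp
    next
      case False
      then show ?thesis using coord by (intro adjoin_const[OF A polyfun.coord]) simp
    qed
  next
    case (add p q)
    then show ?case using is_subringD(4)[OF R, of p q] by (simp add: plus_fun_def)
  next
    case (mult p q)
    then show ?case using is_subringD(5)[OF R, of p q] by (simp add: times_fun_def)
  qed
next
  fix p assume "p \<in> adjoin (polyfun N) (\<lambda>x. x N)"
  then obtain q where q: "p = poly q (\<lambda>x. x N)" "\<forall>i. coeff q i \<in> polyfun N" by (auto simp: adjoin_def)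
  note R = is_subring_polyfun[of "Suc N"]
  show "p \<in> polyfun (Suc N)" unfolding q(1) poly_altdef using q(2)
    by (intro is_subring_sum[OF R] is_subringD(5)[OF R] is_subring_power[OF R])
      (auto intro: polyfun_Suc_mono polyfun.coord)
qed

lemma polyfun_0: "p \<in> polyfun 0 \<Longrightarrow> \<exists>c. p = (\<lambda>_. c)"
  by (induction rule: polyfun.induct) auto

theorem noetherian_polyfun: "noetherian (polyfun N)"
proof (induction N)
  case 0
  show ?case unfolding noetherian_def
  proof (intro allI impI)
    fix S assume S: "S \<subseteq> polyfun 0"
    show "\<exists>T\<subseteq>S. finite T \<and> S \<subseteq> ideal_gen (polyfun 0) T"
    proof (cases "S \<subseteq> {0}")
      case True
      then show ?thesis by (intro exI[of _ "{}"]) (auto intro: ideal_gen.zero)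
    next
      case False
      then obtain s where s: "s \<in> S" "s \<noteq> 0" by auto
      from polyfun_0[OF subsetD[OF S s(1)]] obtain c where c: "s = (\<lambda>_. c)" by (elim exE)
      with s have "c \<noteq> 0" by (auto simp: zero_fun_def)
      \<comment> \<open>A nonzero constant is invertible, so it alone generates all
        constants.\<close>
      have "y \<in> ideal_gen (polyfun 0) {s}" if yS: "y \<in> S" for y
      proof -
        obtain k where k: "y = (\<lambda>_. k)" using polyfun_0[OF subsetD[OF S yS]] by (elim exE)
        have "(\<lambda>_. k / c) * s + 0 \<in> ideal_gen (polyfun 0) {s}"
          by (intro ideal_gen.intros polyfun.const) simp
        moreover have "(\<lambda>_. k / c) * s + 0 = y" using \<open>c \<noteq> 0\<close> by (simp add: k c fun_eq_iff)
        ultimately show ?thesis by simp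
      qed
      with s show ?thesis by (intro exI[of _ "{s}"]) auto
    qed
  qed
next
  case (Suc N)
  show ?case unfolding polyfun_Suc by (rule hilbert_basis[OF is_subring_polyfun Suc])
qed


section \<open>Finiteness of proper closed subsets of a curve\<close>

lemma projective_space_D:
  assumes "L \<in> projective_space n"
  shows "L \<in> proj UNIV" "i > n \<Longrightarrow> rep L i = 0" "v \<in> L \<Longrightarrow> i > n \<Longrightarrow> v i = 0"
  using assms rep_in[OF assms[unfolded projective_space_def]] proj_mono_UNIV[OF assms[unfolded projective_space_def]]
  by (auto simp: projective_space_def proj_def)

lemma polyfun_sum: "(\<And>i. i \<in> I \<Longrightarrow> f i \<in> polyfun N) \<Longrightarrow> (\<lambda>x. \<Sum>i\<in>I. f i x) \<in> polyfun N"
  by (induction I rule: infinite_finite_induct) (auto intro: polyfun.intros)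

lemma polyfun_prod: "(\<And>i. i \<in> I \<Longrightarrow> f i \<in> polyfun N) \<Longrightarrow> (\<lambda>x. \<Prod>i\<in>I. f i x) \<in> polyfun N"
  by (induction I rule: infinite_finite_induct) (auto intro: polyfun.intros)

lemma vanishing_coords_sum:
  fixes x :: "nat \<Rightarrow> complex"
  assumes "\<forall>i>n. x i = 0"
  shows "x = (\<Sum>i\<le>n. x i *\<^sub>C (\<lambda>j. if j = i then 1 else 0))"
proof
  fix j
  have "(\<Sum>i\<le>n. x i *\<^sub>C (\<lambda>j. if j = i then 1 else 0 :: complex)) j = (\<Sum>i\<le>n. if j = i then x i else 0)"
    by (subst clinD(5)[OF clin_coord[of j]]) (simp add: cscale_complex if_distrib cong: if_cong)
  then show "x j = (\<Sum>i\<le>n. x i *\<^sub>C (\<lambda>j. if j = i then 1 else 0)) j"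
    using assms by auto
qed

lemma clin_vanishing_coords:
  fixes l :: "(nat \<Rightarrow> complex) \<Rightarrow> complex"
  assumes "clin l" "\<forall>i>n. x i = 0"
  shows "l x = (\<Sum>i\<le>n. l (\<lambda>j. if j = i then 1 else 0) * x i)"
proof -
  have "l x = l (\<Sum>i\<le>n. x i *\<^sub>C (\<lambda>j. if j = i then 1 else 0))"
    by (rule arg_cong[OF vanishing_coords_sum[OF assms(2)]])
  then show ?thesis by (simp add: clinD(2,5)[OF assms(1)] cscale_complex mult.commute)
qed

text \<open>A linear form on the space of all sequences is not determined by its values on unit
  vectors. It is so determined on sequences vanishing beyond \<open>n\<close>, and there it is a
  combination of the first \<open>n + 1\<close> coordinates.\<close>

lemma hom_poly_polyfun:
  assumes "F \<in> hom_poly d"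
  shows "\<exists>p\<in>polyfun (Suc n). \<forall>x. (\<forall>i>n. x i = 0) \<longrightarrow> F x = p x"
  using assms
proof (induction rule: hom_poly_induct)
  case zero
  show ?case by (rule bexI[OF _ polyfun.const[of 0]]) simp
next
  case (scale_add c l G)
  from scale_add(3) obtain p where p: "p \<in> polyfun (Suc n)" "\<forall>x. (\<forall>i>n. x i = 0) \<longrightarrow> G x = p x" by (elim bexE)
  let ?q = "\<lambda>x. c * (\<Prod>k<d. \<Sum>i\<le>n. l k (\<lambda>j. if j = i then 1 else 0) * x i) + p x"
  have "?q \<in> polyfun (Suc n)"
    by (intro polyfun.add polyfun.mult polyfun.const polyfun_prod polyfun_sum polyfun.coord p) auto
  moreover have "\<forall>x. (\<forall>i>n. x i = 0) \<longrightarrow> c * (\<Prod>k<d. l k x) + G x = ?q x"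
  proof (intro allI impI)
    fix x :: "nat \<Rightarrow> complex" assume that: "\<forall>i>n. x i = 0"
    have "(\<Prod>k<d. l k x) = (\<Prod>k<d. \<Sum>i\<le>n. l k (\<lambda>j. if j = i then 1 else 0) * x i)"
      by (intro prod.cong refl clin_vanishing_coords that scale_add(1)) simp
    then show "c * (\<Prod>k<d. l k x) + G x = ?q x" using p(2) that by simp
  qed
  ultimately show ?case by (intro bexI)
qed

text \<open>The ideal of the set of chosen representatives, not the homogeneous ideal of the cone.
  It contains the restrictions of all forms vanishing on \<open>Z\<close>, which is enough to
  recover a closed \<open>Z\<close>.\<close>

definition vanishing_ideal :: "nat \<Rightarrow> (nat \<Rightarrow> complex) set set \<Rightarrow> ((nat \<Rightarrow> complex) \<Rightarrow> complex) set"
  where "vanishing_ideal n Z = {p \<in> polyfun (Suc n). \<forall>L\<in>Z. p (rep L) = 0}"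

lemma zclosed_vanishing_ideal:
  assumes "zclosed Z" "L \<in> projective_space n" "\<forall>p\<in>vanishing_ideal n Z. p (rep L) = 0" "Z \<subseteq> projective_space n"
  shows "L \<in> Z"
proof -
  from assms(1)[unfolded zclosed_iff] obtain S where S: "S \<subseteq> (\<Union>d. hom_poly d)"
    and Z: "Z = {L \<in> proj UNIV. \<forall>F\<in>S. F (rep L) = 0}" by (elim exE conjE)
  have "F (rep L) = 0" if F: "F \<in> S" for F
  proof -
    obtain d where d: "F \<in> hom_poly d" using S F by blast
    obtain p where p: "p \<in> polyfun (Suc n)" "\<And>x. (\<forall>i>n. x i = 0) \<Longrightarrow> F x = p x"
      using hom_poly_polyfun[OF d, of n] by (elim bexE) simp
    have "p (rep M) = 0" if "M \<in> Z" for M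
    proof -
      have "F (rep M) = 0" using that F unfolding Z by blast
      moreover have "F (rep M) = p (rep M)"
        using that assms(4) projective_space_D(2) by (intro p(2)) blast
      ultimately show ?thesis by simp
    qed
    then have "p \<in> vanishing_ideal n Z" using p(1) by (simp add: vanishing_ideal_def)
    then have "p (rep L) = 0" using assms(3) by blast
    moreover have "F (rep L) = p (rep L)" using projective_space_D(2)[OF assms(2)] by (intro p(2)) blast
    ultimately show ?thesis by simp
  qed
  then show ?thesis using projective_space_D(1)[OF assms(2)] unfolding Z by blast
qed

text \<open>A strictly descending chain of closed sets gives an ascending chain of vanishing ideals.
  Finitely many generators of the union already lie in one member, so the ideals, and with them the
  closed sets, stop changing.\<close>

lemma zclosed_minimal:
  assumes "Z0 \<in> \<Z>" "\<And>Z. Z \<in> \<Z> \<Longrightarrow> zclosed Z \<and> Z \<subseteq> projective_space n"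
  obtains Z where "Z \<in> \<Z>" "\<And>Z'. Z' \<in> \<Z> \<Longrightarrow> \<not> Z' \<subset> Z"
proof -
  have "\<exists>Z\<in>\<Z>. \<forall>Z'\<in>\<Z>. \<not> Z' \<subset> Z"
  proof (rule ccontr)
    assume "\<not> ?thesis"
    then have "\<exists>Z'. Z' \<in> \<Z> \<and> Z' \<subset> Z" if "Z \<in> \<Z>" for Z using that by blast
    \<comment> \<open>Without a minimal member, dependent choice yields an infinite strictly
      descending sequence.\<close>
    from dependent_nat_choice[where P = "\<lambda>_ Z. Z \<in> \<Z>" and Q = "\<lambda>_ Z Z'. Z' \<subset> Z", OF exI[of _ Z0]] this assms(1)
    obtain f where f: "\<And>i. f i \<in> \<Z>" "\<And>i. f (Suc i) \<subset> f i" by metis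
    let ?I = "\<lambda>i. vanishing_ideal n (f i)"
    have mono: "?I i \<subseteq> ?I j" if "i \<le> j" for i j
      using lift_Suc_antimono_le[of f, OF _ that] f(2) by (auto simp: vanishing_ideal_def)
    have "(\<Union>i. ?I i) \<subseteq> polyfun (Suc n)" by (auto simp: vanishing_ideal_def)
    then obtain T where T: "T \<subseteq> (\<Union>i. ?I i)" "finite T" "(\<Union>i. ?I i) \<subseteq> ideal_gen (polyfun (Suc n)) T"
      using noetherian_polyfun[of "Suc n"] unfolding noetherian_def by meson
    from T(2,1) have "\<exists>m. T \<subseteq> ?I m"
    proof (induction T rule: finite_induct)
      case (insert t T)
      then obtain i j where "T \<subseteq> ?I i" "t \<in> ?I j" by blast
      then have "insert t T \<subseteq> ?I (max i j)" using mono[of i "max i j"] mono[of j "max i j"] by auto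
      then show ?case by blast
    qed simp
    then obtain m where m: "T \<subseteq> ?I m" ..
    have "ideal_gen (polyfun (Suc n)) T \<subseteq> ?I m"
    proof (rule ideal_gen_minimal[OF _ _ _ m])
      show "0 \<in> ?I m" using is_subringD(1)[OF is_subring_polyfun] by (simp add: vanishing_ideal_def)
      show "a * p \<in> ?I m" if "a \<in> polyfun (Suc n)" "p \<in> ?I m" for a p
        using that is_subringD(5)[OF is_subring_polyfun] by (simp add: vanishing_ideal_def)
      show "p + q \<in> ?I m" if "p \<in> ?I m" "q \<in> ?I m" for p q
        using that is_subringD(4)[OF is_subring_polyfun] by (simp add: vanishing_ideal_def)
    qed
    then have sub: "?I (Suc m) \<subseteq> ?I m" using T(3) by blast
    have "f m \<subseteq> f (Suc m)"
    proof
      fix L assume L: "L \<in> f m"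
      have cl: "zclosed (f (Suc m))" "f (Suc m) \<subseteq> projective_space n" "f m \<subseteq> projective_space n"
        using assms(2)[OF f(1)] by blast+
      have van: "\<forall>p\<in>?I (Suc m). p (rep L) = 0"
      proof
        fix p assume "p \<in> ?I (Suc m)"
        then have "p \<in> ?I m" using sub by blast
        then show "p (rep L) = 0" using L by (simp add: vanishing_ideal_def)
      qed
      show "L \<in> f (Suc m)"
        by (rule zclosed_vanishing_ideal[OF cl(1) subsetD[OF cl(3) L] van cl(2)])
    qed
    then show False using f(2)[of m] by blast
  qed
  then show thesis using that by blast
qed

lemma zirreducible_single: "zirreducible {L}"
  by (auto simp: zirreducible_def)

text \<open>If \<open>Z\<close> were infinite, a minimal infinite closed subset \<open>M\<close> of
  it would be irreducible, because two proper closed parts of \<open>M\<close> are finite and cannot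
  cover it. A point, \<open>M\<close> and \<open>C\<close> would then form a chain of length
  two.\<close>

lemma finite_proper_closed:
  assumes C: "C \<subseteq> projective_space n" "zclosed C" "zirreducible C" "has_krull_dim C 1"
    and Z: "zclosed Z" "Z \<subset> C"
  shows "finite Z"
proof (rule ccontr)
  assume inf: "infinite Z"
  let ?F = "{Z'. zclosed Z' \<and> Z' \<subseteq> Z \<and> infinite Z'}"
  have "Z \<in> ?F" using Z inf by simp
  moreover have "zclosed Z' \<and> Z' \<subseteq> projective_space n" if "Z' \<in> ?F" for Z'
    using that Z(2) C(1) by blast
  ultimately obtain M where M: "M \<in> ?F" "\<And>Z'. Z' \<in> ?F \<Longrightarrow> \<not> Z' \<subset> M"
    using zclosed_minimal by (metis (no_types, lifting))
  have cl: "zclosed M" and MZ: "M \<subseteq> Z" and Minf: "infinite M" using M(1) by auto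
  \<comment> \<open>Minimality: a closed set not containing \<open>M\<close> cuts out of it a
    smaller closed set, which therefore is not infinite.\<close>
  have fin: "finite (M \<inter> A)" if "zclosed A" "\<not> M \<subseteq> A" for A
  proof (rule ccontr)
    assume "infinite (M \<inter> A)"
    then have "M \<inter> A \<in> ?F" using MZ zclosed_Int[OF cl that(1)] by auto
    from M(2)[OF this] show False using that(2) by blast
  qed
  have irr: "zirreducible M" unfolding zirreducible_def
  proof (intro conjI allI impI)
    show "M \<noteq> {}" using Minf by auto
    fix A B assume AB: "zclosed A \<and> zclosed B \<and> M \<subseteq> A \<union> B"
    show "M \<subseteq> A \<or> M \<subseteq> B"
    proof (rule ccontr)
      assume "\<not> (M \<subseteq> A \<or> M \<subseteq> B)"
      then have "finite (M \<inter> A)" "finite (M \<inter> B)" using fin AB by auto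
      moreover have "M = (M \<inter> A) \<union> (M \<inter> B)" using AB by blast
      ultimately show False using Minf by (metis finite_UnI)
    qed
  qed
  obtain L where L: "L \<in> M" using Minf by (metis finite.emptyI ex_in_conv)
  have LU: "L \<in> proj UNIV" using L zclosed_subset[OF cl] by blast
  have "{L} \<subset> M" using L Minf by (metis finite.emptyI finite.insertI empty_subsetI insert_subset psubsetI)
  let ?Z = "\<lambda>i::nat. if i = 0 then {L} else if i = 1 then M else C"
  have "irreducible_chain C 2 ?Z" unfolding irreducible_chain_def
  proof (intro conjI allI impI)
    fix i :: nat
    show "zclosed (?Z i)" using cl C(2) zclosed_single[OF LU] by simp
    show "zirreducible (?Z i)" using irr C(3) zirreducible_single[of L] by simp
    show "?Z i \<subseteq> C" using L MZ Z(2) by auto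
  next
    fix i :: nat assume "i < 2"
    then consider "i = 0" | "i = 1" by linarith
    then show "?Z i \<subset> ?Z (Suc i)"
      by cases (use \<open>{L} \<subset> M\<close> MZ Z(2) in auto)
  qed
  with conjunct2[OF C(4)[unfolded has_krull_dim_def]] have "2 \<le> (1::nat)" by (elim allE impE)
  then show False by simp
qed

section \<open>Germs of functions\<close>

text \<open>Functions are total, so a germ is represented by any function, and equality of germs at
  \<open>p\<close> is \<open>near\<close> applied to a pointwise equation. The point
  \<open>p\<close> itself is included; punctured statements carry the premise that \<open>x\<close>
  differs from \<open>p\<close>.\<close>

definition near :: "'v::cvector set set \<Rightarrow> 'v set \<Rightarrow> ('v set \<Rightarrow> bool) \<Rightarrow> bool"
  where "near C p \<phi> \<longleftrightarrow> (\<exists>W. zopen_in C W \<and> p \<in> W \<and> (\<forall>x\<in>W. \<phi> x))"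

definition reg_at :: "'v::cvector set set \<Rightarrow> 'v set \<Rightarrow> ('v set \<Rightarrow> complex) \<Rightarrow> bool"
  where "reg_at C p f \<longleftrightarrow> (\<exists>W. p \<in> W \<and> regular_on C W f)"

lemma nearI: "zopen_in C W \<Longrightarrow> p \<in> W \<Longrightarrow> (\<And>x. x \<in> W \<Longrightarrow> \<phi> x) \<Longrightarrow> near C p \<phi>"
  unfolding near_def by blast

lemma nearE:
  assumes "near C p \<phi>"
  obtains W where "zopen_in C W" "p \<in> W" "\<And>x. x \<in> W \<Longrightarrow> \<phi> x"
  using assms unfolding near_def by blast

lemma near_mono: "near C p \<phi> \<Longrightarrow> (\<And>x. \<phi> x \<Longrightarrow> \<psi> x) \<Longrightarrow> near C p \<psi>"
  unfolding near_def by blast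

lemma near_conj:
  assumes "near C p \<phi>" "near C p \<psi>"
  shows "near C p (\<lambda>x. \<phi> x \<and> \<psi> x)"
proof -
  from assms(1) obtain U where "zopen_in C U" "p \<in> U" "\<And>x. x \<in> U \<Longrightarrow> \<phi> x" by (rule nearE) blast
  moreover from assms(2) obtain V where "zopen_in C V" "p \<in> V" "\<And>x. x \<in> V \<Longrightarrow> \<psi> x" by (rule nearE) blast
  ultimately show ?thesis by (intro nearI[OF zopen_in_Int[of C U V]]) auto
qed

lemma near_mono2:
  "near C p \<phi> \<Longrightarrow> near C p \<psi> \<Longrightarrow> (\<And>x. \<phi> x \<Longrightarrow> \<psi> x \<Longrightarrow> \<rho> x) \<Longrightarrow> near C p \<rho>"
  by (drule (1) near_conj) (erule near_mono, simp)

lemma near_self: "p \<in> C \<Longrightarrow> near C p (\<lambda>x. x \<in> C)"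
  by (rule nearI[OF zopen_in_self])

lemma near_all_finite:
  assumes "finite I" "p \<in> C" "\<And>i. i \<in> I \<Longrightarrow> near C p (\<phi> i)"
  shows "near C p (\<lambda>x. \<forall>i\<in>I. \<phi> i x)"
  using assms(1,3)
proof (induction I rule: finite_induct)
  case empty
  show ?case using near_self[OF assms(2)] by (rule near_mono) simp
next
  case (insert i I)
  from insert(4) have "near C p (\<phi> i)" "near C p (\<lambda>x. \<forall>i\<in>I. \<phi> i x)" using insert(3) by simp_all
  from near_conj[OF this] show ?case by (rule near_mono) simp
qed

section \<open>Curves: nonempty open sets are cofinite\<close>

locale curve =
  fixes C :: "(nat \<Rightarrow> complex) set set" and n :: nat
  assumes C_subset: "C \<subseteq> projective_space n" and C_closed: "zclosed C"
    and C_irreducible: "zirreducible C" and C_dim: "has_krull_dim C 1" and C_nonsingular: "nonsingular C"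
begin

lemma C_proj: "C \<subseteq> proj UNIV"
  using C_subset projective_space_D(1) by blast

lemma finite_complement:
  assumes "zopen_in C U" "U \<noteq> {}"
  shows "finite (C - U)"
proof -
  obtain Z where Z: "zclosed Z" "U = C - Z" using assms(1) by (auto simp: zopen_in_def)
  have "C - U = C \<inter> Z" using Z by auto
  moreover have "zclosed (C \<inter> Z)" by (rule zclosed_Int[OF C_closed Z(1)])
  moreover have "C \<inter> Z \<subset> C" using assms(2) Z(2) by auto
  ultimately show ?thesis
    using finite_proper_closed[OF C_subset C_closed C_irreducible C_dim] by metis
qed

text \<open>A chain of length one supplies two points. If \<open>C\<close> were finite, one point
  and the rest would be closed sets covering it, against irreducibility.\<close>

lemma C_infinite: "infinite C"
proof
  assume fin: "finite C"
  obtain Z where Z: "irreducible_chain C 1 Z" using C_dim unfolding has_krull_dim_def by blast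
  then have "Z 0 \<subset> Z 1" "Z 1 \<subseteq> C" "Z 0 \<noteq> {}" by (auto simp: irreducible_chain_def zirreducible_def)
  then obtain x y where xy: "x \<in> C" "y \<in> C" "x \<noteq> y" by blast
  have "zclosed {x}" "zclosed (C - {x})" using xy C_proj fin by (auto intro!: zclosed_finite)
  moreover have "C \<subseteq> {x} \<union> (C - {x})" by auto
  ultimately have "C \<subseteq> {x} \<or> C \<subseteq> C - {x}" using C_irreducible unfolding zirreducible_def by metis
  then show False using xy by auto
qed

lemma open_Int_nonempty:
  assumes "zopen_in C U" "U \<noteq> {}" "zopen_in C V" "V \<noteq> {}"
  shows "U \<inter> V \<noteq> {}"
proof
  assume "U \<inter> V = {}"
  then have "C = (C - U) \<union> (C - V)" by auto
  then show False using C_infinite finite_complement[OF assms(1,2)] finite_complement[OF assms(3,4)]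
    by (metis finite_UnI)
qed

lemma open_infinite: "zopen_in C U \<Longrightarrow> U \<noteq> {} \<Longrightarrow> infinite U"
  using finite_complement[of U] C_infinite by (metis Diff_infinite_finite)

lemma open_diff_finite: "zopen_in C U \<Longrightarrow> finite S \<Longrightarrow> zopen_in C (U - S)"
  by (rule zopen_in_diff_finite[OF _ _ C_proj])

text \<open>The nonvanishing locus is open; if it were nonempty it would meet
  \<open>V\<close>.\<close>

lemma identity_principle:
  assumes "regular_on C U f" "zopen_in C V" "V \<noteq> {}" "V \<subseteq> U" "\<And>x. x \<in> V \<Longrightarrow> f x = 0" "x \<in> U"
  shows "f x = 0"
proof (rule ccontr)
  assume "f x \<noteq> 0"
  then have "{x \<in> U. f x \<noteq> 0} \<noteq> {}" using assms(6) by auto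
  from open_Int_nonempty[OF zopen_in_nonzero[OF C_proj assms(1)] this assms(2,3)] show False
    using assms(5) by auto
qed

section \<open>The local ring at a point of the curve\<close>

lemma reg_atE:
  assumes "reg_at C p f"
  obtains W where "zopen_in C W" "p \<in> W" "regular_on C W f"
  using assms regular_on_zopen[OF C_proj] unfolding reg_at_def by blast

lemma reg_atI: "regular_on C W f \<Longrightarrow> p \<in> W \<Longrightarrow> reg_at C p f"
  unfolding reg_at_def by blast

lemma reg_at_on_C: "reg_at C p f \<Longrightarrow> p \<in> C"
  by (elim reg_atE) (use zopen_in_subset in blast)

lemma regular_onI:
  assumes "zopen_in C U" "\<And>x. x \<in> U \<Longrightarrow> reg_at C x f"
  shows "regular_on C U f"
proof (rule regular_on_local)
  fix x assume x: "x \<in> U"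
  obtain W where W: "zopen_in C W" "x \<in> W" "regular_on C W f" by (rule reg_atE[OF assms(2)[OF x]])
  have "regular_on C (W \<inter> U) f"
    by (rule regular_on_subset[OF W(3) zopen_in_Int[OF W(1) assms(1)]]) simp
  then show "\<exists>V. x \<in> V \<and> V \<subseteq> U \<and> regular_on C V f" using x W(2) by (intro exI[of _ "W \<inter> U"]) auto
qed

lemma reg_at_cong:
  assumes "reg_at C p f" "near C p (\<lambda>x. f x = g x)"
  shows "reg_at C p g"
proof -
  obtain W where W: "zopen_in C W" "p \<in> W" "regular_on C W f" by (rule reg_atE[OF assms(1)])
  obtain V where V: "zopen_in C V" "p \<in> V" "\<And>x. x \<in> V \<Longrightarrow> f x = g x" by (rule nearE[OF assms(2)]) blast
  have "regular_on C (W \<inter> V) f"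
    by (rule regular_on_subset[OF W(3) zopen_in_Int[OF W(1) V(1)]]) simp
  then have "regular_on C (W \<inter> V) g" by (rule regular_on_cong) (use V(3) in auto)
  then show ?thesis by (rule reg_atI) (use W V in auto)
qed

lemma reg_at_common:
  assumes "reg_at C p f" "reg_at C p g"
  obtains W where "zopen_in C W" "p \<in> W" "regular_on C W f" "regular_on C W g"
proof -
  obtain W where W: "zopen_in C W" "p \<in> W" "regular_on C W f" by (rule reg_atE[OF assms(1)])
  obtain V where V: "zopen_in C V" "p \<in> V" "regular_on C V g" by (rule reg_atE[OF assms(2)])
  show thesis
  proof (rule that)
    show o: "zopen_in C (W \<inter> V)" by (rule zopen_in_Int[OF W(1) V(1)])
    show "regular_on C (W \<inter> V) f" by (rule regular_on_subset[OF W(3) o]) simp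
    show "regular_on C (W \<inter> V) g" by (rule regular_on_subset[OF V(3) o]) simp
  qed (use W V in simp)
qed

lemma reg_at_const: "p \<in> C \<Longrightarrow> reg_at C p (\<lambda>_. c)"
  by (rule reg_atI[OF regular_on_const[OF zopen_in_self]])

lemma reg_at_add: "reg_at C p f \<Longrightarrow> reg_at C p g \<Longrightarrow> reg_at C p (\<lambda>x. f x + g x)"
  by (rule reg_at_common, assumption+) (rule reg_atI[OF regular_on_add])

lemma reg_at_mult: "reg_at C p f \<Longrightarrow> reg_at C p g \<Longrightarrow> reg_at C p (\<lambda>x. f x * g x)"
  by (rule reg_at_common, assumption+) (rule reg_atI[OF regular_on_mult])

lemma reg_at_diff: "reg_at C p f \<Longrightarrow> reg_at C p g \<Longrightarrow> reg_at C p (\<lambda>x. f x - g x)"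
  by (rule reg_at_common, assumption+) (rule reg_atI[OF regular_on_diff])

lemma reg_at_cmult: "reg_at C p f \<Longrightarrow> reg_at C p (\<lambda>x. c * f x)"
  using reg_at_mult[OF reg_at_const[OF reg_at_on_C]] by blast

lemma reg_at_sum: "p \<in> C \<Longrightarrow> (\<And>i. i \<in> I \<Longrightarrow> reg_at C p (f i)) \<Longrightarrow> reg_at C p (\<lambda>x. \<Sum>i\<in>I. f i x)"
  by (induction I rule: infinite_finite_induct) (simp_all add: reg_at_const reg_at_add)

lemma reg_at_power: "reg_at C p f \<Longrightarrow> reg_at C p (\<lambda>x. f x ^ m)"
  by (induction m) (simp_all add: reg_at_const[OF reg_at_on_C] reg_at_mult)

lemma near_nonzero:
  assumes "reg_at C p f" "f p \<noteq> 0"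
  shows "near C p (\<lambda>x. f x \<noteq> 0)"
proof -
  obtain W where W: "zopen_in C W" "p \<in> W" "regular_on C W f" by (rule reg_atE[OF assms(1)])
  show ?thesis by (rule nearI[OF zopen_in_nonzero[OF C_proj W(3)]]) (use W assms(2) in auto)
qed

lemma reg_at_inverse:
  assumes "reg_at C p f" "f p \<noteq> 0"
  shows "reg_at C p (\<lambda>x. inverse (f x))"
proof -
  obtain W where W: "zopen_in C W" "p \<in> W" "regular_on C W f" by (rule reg_atE[OF assms(1)])
  note o = zopen_in_nonzero[OF C_proj W(3)]
  have "regular_on C {x \<in> W. f x \<noteq> 0} f" by (rule regular_on_subset[OF W(3) o]) auto
  then have "regular_on C {x \<in> W. f x \<noteq> 0} (\<lambda>x. inverse (f x))" by (rule regular_on_inverse) simp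
  then show ?thesis by (rule reg_atI) (use W assms(2) in simp)
qed

lemma near_neq: "p \<in> C \<Longrightarrow> p \<noteq> q \<Longrightarrow> near C p (\<lambda>x. x \<noteq> q)"
  by (rule nearI[OF open_diff_finite[OF zopen_in_self, of "{q}"]]) auto

text \<open>Nonempty open sets are infinite, so a punctured neighbourhood is nonempty. The lemma
  replaces continuity: an identity between regular germs checked away from \<open>p\<close> extends
  to \<open>p\<close>.\<close>

lemma punctured_identity:
  assumes "reg_at C p f" "near C p (\<lambda>x. x \<noteq> p \<longrightarrow> f x = 0)"
  shows "f p = 0"
proof -
  obtain W where W: "zopen_in C W" "p \<in> W" "regular_on C W f" by (rule reg_atE[OF assms(1)])
  obtain V where V: "zopen_in C V" "p \<in> V" "\<And>x. x \<in> V \<Longrightarrow> x \<noteq> p \<longrightarrow> f x = 0"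
    by (rule nearE[OF assms(2)]) blast
  note o = zopen_in_Int[OF W(1) V(1)]
  have "W \<inter> V - {p} \<noteq> {}" using open_infinite[OF o] W(2) V(2) by (metis IntI empty_iff finite.emptyI finite_insert infinite_remove)
  from identity_principle[OF W(3) open_diff_finite[OF o] this _ _ W(2)] show ?thesis using V(3) by auto
qed

section \<open>Local equations in terms of germs\<close>

lemma local_equationD:
  assumes "local_equation C p U t"
  shows "zopen_in C U" "p \<in> U" "p \<in> C" "reg_at C p t" "t p = 0" "near C p (\<lambda>x. x \<noteq> p \<longrightarrow> t x \<noteq> 0)"
    "reg_at C p h \<Longrightarrow> h p = 0 \<Longrightarrow> \<exists>g. reg_at C p g \<and> near C p (\<lambda>x. h x = t x * g x)"
proof -
  show o: "zopen_in C U" "p \<in> U" using assms by (auto simp: local_equation_def)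
  then show "p \<in> C" using zopen_in_subset by blast
  show "reg_at C p t" "t p = 0" using assms by (auto simp: local_equation_def intro: reg_atI)
  show "near C p (\<lambda>x. x \<noteq> p \<longrightarrow> t x \<noteq> 0)" using assms o by (intro nearI[OF o]) (auto simp: local_equation_def)
  assume h: "reg_at C p h" "h p = 0"
  obtain W where W: "zopen_in C W" "p \<in> W" "regular_on C W h" by (rule reg_atE[OF h(1)])
  from assms have "zopen_in C W \<and> p \<in> W \<and> regular_on C W h \<and> h p = 0 \<longrightarrow>
      (\<exists>W' g. zopen_in C W' \<and> p \<in> W' \<and> W' \<subseteq> U \<inter> W \<and> regular_on C W' g \<and> (\<forall>x\<in>W'. h x = t x * g x))"
    unfolding local_equation_def by (elim conjE allE)
  with W h(2) obtain W' g where g: "zopen_in C W'" "p \<in> W'" "regular_on C W' g" "\<forall>x\<in>W'. h x = t x * g x"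
    by (elim impE exE conjE) auto
  then show "\<exists>g. reg_at C p g \<and> near C p (\<lambda>x. h x = t x * g x)"
    by (intro exI[of _ g] conjI reg_atI[of W'] nearI[of C W']) auto
qed

lemma local_equationI:
  assumes "reg_at C p t" "near C p (\<lambda>x. t x = 0 \<longleftrightarrow> x = p)"
    "\<And>h. reg_at C p h \<Longrightarrow> h p = 0 \<Longrightarrow> \<exists>g. reg_at C p g \<and> near C p (\<lambda>x. h x = t x * g x)"
  shows "\<exists>U. local_equation C p U t"
proof -
  obtain W where W: "zopen_in C W" "p \<in> W" "regular_on C W t" by (rule reg_atE[OF assms(1)])
  obtain V where V: "zopen_in C V" "p \<in> V" "\<And>x. x \<in> V \<Longrightarrow> t x = 0 \<longleftrightarrow> x = p"
    by (rule nearE[OF assms(2)]) blast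
  let ?U = "W \<inter> V"
  have o: "zopen_in C ?U" by (rule zopen_in_Int[OF W(1) V(1)])
  have "local_equation C p ?U t" unfolding local_equation_def
  proof (intro conjI allI impI)
    show "regular_on C ?U t" by (rule regular_on_subset[OF W(3) o]) simp
    show "\<forall>x\<in>?U. (t x = 0) = (x = p)" using V(3) by auto
    fix N h assume h: "zopen_in C N \<and> p \<in> N \<and> regular_on C N h \<and> h p = 0"
    then obtain g where g: "reg_at C p g" "near C p (\<lambda>x. h x = t x * g x)"
      using assms(3)[OF reg_atI[of N h p]] by (elim exE conjE) auto
    obtain A where A: "zopen_in C A" "p \<in> A" "regular_on C A g" by (rule reg_atE[OF g(1)])
    obtain B where B: "zopen_in C B" "p \<in> B" "\<And>x. x \<in> B \<Longrightarrow> h x = t x * g x"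
      by (rule nearE[OF g(2)]) blast
    have o': "zopen_in C (?U \<inter> N \<inter> (A \<inter> B))" using zopen_in_Int[OF zopen_in_Int[OF o] zopen_in_Int[OF A(1) B(1)]] h by blast
    show "\<exists>W' g. zopen_in C W' \<and> p \<in> W' \<and> W' \<subseteq> ?U \<inter> N \<and> regular_on C W' g \<and> (\<forall>x\<in>W'. h x = t x * g x)"
      by (intro exI[of _ "?U \<inter> N \<inter> (A \<inter> B)"] exI[of _ g] conjI o' regular_on_subset[OF A(3) o'])
        (use W V A B h in auto)
  qed (use o W V in auto)
  then show ?thesis ..
qed

end

lemma regular_on_ratio:
  assumes "X \<subseteq> proj UNIV" "zopen_in X U" "G \<in> hom_poly d" "H \<in> hom_poly d" "\<And>x. x \<in> U \<Longrightarrow> H (rep x) \<noteq> 0"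
  shows "regular_on X U (\<lambda>x. G (rep x) / H (rep x))"
proof -
  have "ratio_on U (\<lambda>x. G (rep x) / H (rep x))"
  proof (rule ratio_onI[OF assms(3,4)])
    fix M v assume M: "M \<in> U" "v \<in> M - {0}"
    have "M \<in> proj UNIV" using M(1) zopen_in_subset[OF assms(2)] assms(1) by blast
    from hom_poly_ratio_iff[OF assms(3,4) this] show "H v \<noteq> 0 \<and> G (rep M) / H (rep M) = G v / H v"
      using assms(5)[OF M(1)] M(2) by blast
  qed
  then show ?thesis using assms(2) unfolding regular_on_iff by blast
qed

section \<open>First-order expansion of polynomial functions\<close>

lemma polyfun_translate: "p \<in> polyfun N \<Longrightarrow> (\<lambda>z. p (\<lambda>i. w i + z i)) \<in> polyfun N"
  by (induction rule: polyfun.induct) (auto intro: polyfun.intros)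

text \<open>The remainder has the shape needed for Nakayama's lemma: coordinates times polynomials
  vanishing at the origin, hence products of two elements of the maximal ideal.\<close>

lemma polyfun_taylor:
  assumes "p \<in> polyfun N"
  shows "\<exists>a q. (\<forall>i<N. q i \<in> polyfun N \<and> q i (\<lambda>_. 0) = 0) \<and>
    (\<forall>z. p z = p (\<lambda>_. 0) + (\<Sum>i<N. a i * z i) + (\<Sum>i<N. z i * q i z))"
  using assms
proof (induction rule: polyfun.induct)
  case (const c)
  show ?case by (rule exI[of _ "\<lambda>_. 0"], rule exI[of _ "\<lambda>_ _. 0"]) (simp add: polyfun.const)
next
  case (coord i)
  have "(\<Sum>j<N. (if j = i then 1 else 0) * z j) = z i" for z :: "nat \<Rightarrow> complex"
    using coord by (simp add: if_distrib[of "\<lambda>c. c * _"] cong: if_cong)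
  then show ?case
    by (intro exI[of _ "\<lambda>j. if j = i then 1 else 0"] exI[of _ "\<lambda>_ _. 0"]) (simp add: polyfun.const)
next
  case (add p p')
  from add(3) obtain a q where 1: "\<forall>i<N. q i \<in> polyfun N \<and> q i (\<lambda>_. 0) = 0"
    "\<forall>z. p z = p (\<lambda>_. 0) + (\<Sum>i<N. a i * z i) + (\<Sum>i<N. z i * q i z)" by (elim exE conjE)
  from add(4) obtain a' q' where 2: "\<forall>i<N. q' i \<in> polyfun N \<and> q' i (\<lambda>_. 0) = 0"
    "\<forall>z. p' z = p' (\<lambda>_. 0) + (\<Sum>i<N. a' i * z i) + (\<Sum>i<N. z i * q' i z)" by (elim exE conjE)
  show ?case
  proof (rule exI[of _ "\<lambda>i. a i + a' i"], rule exI[of _ "\<lambda>i z. q i z + q' i z"], intro conjI allI impI)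
    fix z
    show "p z + p' z = p (\<lambda>_. 0) + p' (\<lambda>_. 0) + (\<Sum>i<N. (a i + a' i) * z i) + (\<Sum>i<N. z i * (q i z + q' i z))"
      by (subst 1(2)[rule_format], subst 2(2)[rule_format]) (simp add: algebra_simps sum.distrib)
  qed (use 1(1) 2(1) in \<open>auto intro: polyfun.add\<close>)
next
  case (mult p p')
  from mult(3) obtain a q where 1: "\<forall>i<N. q i \<in> polyfun N \<and> q i (\<lambda>_. 0) = 0"
    "\<forall>z. p z = p (\<lambda>_. 0) + (\<Sum>i<N. a i * z i) + (\<Sum>i<N. z i * q i z)" by (elim exE conjE)
  from mult(4) obtain a' q' where 2: "\<forall>i<N. q' i \<in> polyfun N \<and> q' i (\<lambda>_. 0) = 0"
    "\<forall>z. p' z = p' (\<lambda>_. 0) + (\<Sum>i<N. a' i * z i) + (\<Sum>i<N. z i * q' i z)" by (elim exE conjE)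
  let ?c = "p (\<lambda>_. 0)" and ?c' = "p' (\<lambda>_. 0)"
  \<comment> \<open>Read off from \<open>p p' - c c' = (p - c) p' + c (p' - c')\<close> with
    \<open>c\<close>, \<open>c'\<close> the constant terms: expanding \<open>p - c\<close>, the
    linear part \<open>a i\<close> times \<open>p' - c'\<close> is of second order and joins the
    remainder.\<close>
  let ?q = "\<lambda>i z. q i z * p' z + (a i * (p' z + (- ?c')) + ?c * q' i z)"
  show ?case
  proof (rule exI[of _ "\<lambda>i. a i * ?c' + ?c * a' i"], rule exI[of _ ?q], intro conjI allI impI)
    fix z
    have "(\<Sum>i<N. (a i * ?c' + ?c * a' i) * z i) + (\<Sum>i<N. z i * ?q i z) =
      (\<Sum>i<N. a i * z i) * p' z + (\<Sum>i<N. z i * q i z) * p' z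
      + ?c * (\<Sum>i<N. a' i * z i) + ?c * (\<Sum>i<N. z i * q' i z)"
      by (simp add: sum_distrib_left sum_distrib_right sum.distrib[symmetric] algebra_simps)
    also have "\<dots> = (p z - ?c) * p' z + ?c * (p' z - ?c')"
    proof -
      have h1: "p z - ?c = (\<Sum>i<N. a i * z i) + (\<Sum>i<N. z i * q i z)" using 1(2)[rule_format, of z] by (simp add: algebra_simps)
      have h2: "p' z - ?c' = (\<Sum>i<N. a' i * z i) + (\<Sum>i<N. z i * q' i z)" using 2(2)[rule_format, of z] by (simp add: algebra_simps)
      show ?thesis unfolding h1 h2 by (simp only: distrib_left distrib_right add.assoc)
    qed
    finally show "p z * p' z = ?c * ?c' + (\<Sum>i<N. (a i * ?c' + ?c * a' i) * z i) + (\<Sum>i<N. z i * ?q i z)"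
      by (simp add: algebra_simps)
  next
    fix i assume "i < N"
    then show "?q i \<in> polyfun N" using 1(1) 2(1) mult(1,2) by (intro polyfun.intros) auto
    show "?q i (\<lambda>_. 0) = 0" using 1(1) 2(1) \<open>i < N\<close> by simp
  qed
qed

lemma polyfun_line_differentiable:
  "p \<in> polyfun N \<Longrightarrow> \<exists>D. ((\<lambda>z. p (\<lambda>i. z * v i)) has_field_derivative D) (at 0)"
proof (induction rule: polyfun.induct)
  case (const c)
  show ?case by (rule exI[of _ 0]) simp
next
  case (coord i)
  show ?case by (rule exI[of _ "v i"]) (auto intro!: derivative_eq_intros)
next
  case (add p q)
  then obtain D E where "((\<lambda>z. p (\<lambda>i. z * v i)) has_field_derivative D) (at 0)"
    "((\<lambda>z. q (\<lambda>i. z * v i)) has_field_derivative E) (at 0)" by (elim exE)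
  from DERIV_add[OF this] show ?case by (rule exI)
next
  case (mult p q)
  then obtain D E where "((\<lambda>z. p (\<lambda>i. z * v i)) has_field_derivative D) (at 0)"
    "((\<lambda>z. q (\<lambda>i. z * v i)) has_field_derivative E) (at 0)" by (elim exE)
  from DERIV_mult[OF this] show ?case by (rule exI)
qed

text \<open>Along a line through the origin each remainder term is a product of two functions
  vanishing at 0, so its derivative there is 0 and only the linear part survives.\<close>

lemma polyfun_line_derivative:
  assumes "\<And>z. p z = c + (\<Sum>i<N. a i * z i) + (\<Sum>i<N. z i * q i z)"
    and "\<And>i. i < N \<Longrightarrow> q i \<in> polyfun N" "\<And>i. i < N \<Longrightarrow> q i (\<lambda>_. 0) = 0"
  shows "((\<lambda>z. p (\<lambda>i. z * v i)) has_field_derivative (\<Sum>i<N. a i * v i)) (at 0)"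
proof -
  have "((\<lambda>z. z * v i * q i (\<lambda>i. z * v i)) has_field_derivative 0) (at 0)" if i: "i < N" for i
  proof -
    obtain D where D: "((\<lambda>z. q i (\<lambda>i. z * v i)) has_field_derivative D) (at 0)"
      using polyfun_line_differentiable[OF assms(2)[OF i]] by blast
    have "((\<lambda>z. z * v i) has_field_derivative v i) (at 0)" by (auto intro!: derivative_eq_intros)
    from DERIV_mult[OF this D] show ?thesis using assms(3)[OF i] by simp
  qed
  then have "((\<lambda>z. \<Sum>i<N. z * v i * q i (\<lambda>i. z * v i)) has_field_derivative (\<Sum>i<N. 0)) (at 0)"
    by (intro DERIV_sum) auto
  moreover have "((\<lambda>z. c + (\<Sum>i<N. a i * (z * v i))) has_field_derivative (\<Sum>i<N. a i * v i)) (at 0)"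
    by (auto intro!: derivative_eq_intros simp: mult.commute)
  ultimately have "((\<lambda>z. c + (\<Sum>i<N. a i * (z * v i)) + (\<Sum>i<N. z * v i * q i (\<lambda>i. z * v i)))
      has_field_derivative (\<Sum>i<N. a i * v i) + (\<Sum>i<N. 0)) (at 0)"
    by (intro DERIV_add)
  then show ?thesis by (simp add: assms(1))
qed

section \<open>Local equations of points\<close>

text \<open>The functions \<open>zc i\<close> are the affine coordinates centred at \<open>Q\<close> in the chart where the \<open>k\<close>-th coordinate
  is nonzero.\<close>

locale curve_point = curve +
  fixes Q :: "(nat \<Rightarrow> complex) set" and w :: "nat \<Rightarrow> complex" and k :: nat
  assumes Q: "Q \<in> C" and w: "w \<in> Q" and k: "k \<le> n" and wk: "w k = 1"
begin

definition zc :: "nat \<Rightarrow> (nat \<Rightarrow> complex) set \<Rightarrow> complex"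
  where "zc i L = rep L i / rep L k - w i"

lemma QP: "Q \<in> proj UNIV"
  using Q C_proj by blast

lemma w_nonzero: "w \<noteq> 0"
  using wk by (auto simp: zero_fun_def)

lemma w_vanish: "i > n \<Longrightarrow> w i = 0"
  using projective_space_D(3)[OF subsetD[OF C_subset Q] w] .

lemma rep_Q: "rep Q k \<noteq> 0" "rep Q i = rep Q k * w i"
proof -
  obtain c where c: "rep Q = c *\<^sub>C w" by (rule proj_elemE[OF QP w w_nonzero rep_in[OF QP]])
  have ck: "rep Q k = c" by (simp add: c wk cscale_complex)
  show "rep Q i = rep Q k * w i" by (simp add: ck) (simp add: c cscale_complex)
  show "rep Q k \<noteq> 0" using rep_nonzero[OF QP] ck c by auto
qed

lemma zc_Q [simp]: "zc i Q = 0"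
  using rep_Q(1) rep_Q(2)[of i] by (simp add: zc_def)

lemma zc_k: "rep L k \<noteq> 0 \<Longrightarrow> zc k L = 0"
  by (simp add: zc_def wk)

lemma near_chart: "near C Q (\<lambda>L. L \<in> C \<and> rep L k \<noteq> 0)"
  by (rule nearI[OF zopen_in_diff_zero_set[OF zopen_in_self hom_poly_linear[OF clin_coord] C_proj]])
    (use Q rep_Q(1) in auto)

lemma reg_at_zc: "reg_at C Q (zc i)"
proof -
  note o = zopen_in_diff_zero_set[OF zopen_in_self hom_poly_linear[OF clin_coord[of k]] C_proj]
  have "regular_on C {L \<in> C. rep L k \<noteq> 0} (\<lambda>x. rep x i / rep x k)"
    by (rule regular_on_ratio[OF C_proj o hom_poly_linear[OF clin_coord] hom_poly_linear[OF clin_coord]]) simp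
  then have "reg_at C Q (\<lambda>x. rep x i / rep x k)" by (rule reg_atI) (use Q rep_Q(1) in simp)
  from reg_at_diff[OF this reg_at_const[OF Q]] show ?thesis unfolding zc_def .
qed

lemma reg_at_polyfun: "p \<in> polyfun N \<Longrightarrow> reg_at C Q (\<lambda>L. p (\<lambda>i. zc i L))"
  by (induction rule: polyfun.induct) (simp_all add: reg_at_const[OF Q] reg_at_zc reg_at_add reg_at_mult)

text \<open>Dehomogenization at \<open>w\<close>. The factor \<open>rep L k ^ d\<close> is nonzero
  on the chart, so zeros are preserved and it cancels in quotients of forms of equal degree.\<close>

lemma hom_poly_chart:
  assumes F: "F \<in> hom_poly d" and p: "\<forall>x. (\<forall>i>n. x i = 0) \<longrightarrow> F x = p x"
    and L: "L \<in> C" "rep L k \<noteq> 0"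
  shows "F (rep L) = rep L k ^ d * p (\<lambda>i. w i + zc i L)"
proof -
  have eq: "rep L = rep L k *\<^sub>C (\<lambda>i. w i + zc i L)"
    using L(2) by (simp add: fun_eq_iff zc_def cscale_complex)
  have "F (rep L) = F (rep L k *\<^sub>C (\<lambda>i. w i + zc i L))" by (rule arg_cong[OF eq])
  also have "\<dots> = rep L k ^ d * F (\<lambda>i. w i + zc i L)" by (rule hom_poly_homogeneous[OF F])
  also have "F (\<lambda>i. w i + zc i L) = p (\<lambda>i. w i + zc i L)"
    using projective_space_D(2)[OF subsetD[OF C_subset L(1)]] by (intro p[rule_format]) (simp add: zc_def)
  finally show ?thesis .
qed

text \<open>The coefficient vectors whose linear form in the coordinates \<open>zc i\<close> is of
  second order at \<open>Q\<close>. Once the \<open>zc i\<close> are known to generate the maximal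
  ideal, this is the kernel of the map to the cotangent space. Entries beyond \<open>n\<close> are
  fixed to 0, so that a relation is a vector of \<open>n + 1\<close> numbers.\<close>

definition relations :: "(nat \<Rightarrow> complex) set"
  where "relations = {a. (\<forall>i>n. a i = 0) \<and> (\<exists>r. (\<forall>i\<le>n. reg_at C Q (r i) \<and> r i Q = 0) \<and>
    near C Q (\<lambda>x. (\<Sum>i\<le>n. a i * zc i x) + (\<Sum>i\<le>n. zc i x * r i x) = 0))}"

lemma subspace_relations: "cvec.subspace relations"
  unfolding cvec.subspace_def
proof (intro conjI ballI allI)
  show "0 \<in> relations" unfolding relations_def
    by (intro CollectI conjI exI[of _ "\<lambda>_ _. 0"])
      (simp_all add: reg_at_const[OF Q] near_mono[OF near_self[OF Q]])
next
  fix a b assume "a \<in> relations" "b \<in> relations"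
  then obtain r s where r: "\<forall>i\<le>n. reg_at C Q (r i) \<and> r i Q = 0"
      "near C Q (\<lambda>x. (\<Sum>i\<le>n. a i * zc i x) + (\<Sum>i\<le>n. zc i x * r i x) = 0)"
    and s: "\<forall>i\<le>n. reg_at C Q (s i) \<and> s i Q = 0"
      "near C Q (\<lambda>x. (\<Sum>i\<le>n. b i * zc i x) + (\<Sum>i\<le>n. zc i x * s i x) = 0)"
    and v: "\<forall>i>n. a i = 0" "\<forall>i>n. b i = 0"
    unfolding relations_def mem_Collect_eq by (elim exE conjE) 
  show "a + b \<in> relations" unfolding relations_def
  proof (intro CollectI conjI exI)
    show "\<forall>i>n. (a + b) i = 0" using v by simp
    show "\<forall>i\<le>n. reg_at C Q (\<lambda>x. r i x + s i x) \<and> r i Q + s i Q = 0"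
      using r(1) s(1) by (simp add: reg_at_add)
    show "near C Q (\<lambda>x. (\<Sum>i\<le>n. (a + b) i * zc i x) + (\<Sum>i\<le>n. zc i x * (r i x + s i x)) = 0)"
      using r(2) s(2) by (rule near_mono2) (simp add: algebra_simps sum.distrib add_eq_0_iff)
  qed
next
  fix c a assume "a \<in> relations"
  then obtain r where r: "\<forall>i\<le>n. reg_at C Q (r i) \<and> r i Q = 0"
      "near C Q (\<lambda>x. (\<Sum>i\<le>n. a i * zc i x) + (\<Sum>i\<le>n. zc i x * r i x) = 0)"
    and v: "\<forall>i>n. a i = 0"
    unfolding relations_def mem_Collect_eq by (elim exE conjE)
  show "c *\<^sub>C a \<in> relations" unfolding relations_def
  proof (intro CollectI conjI exI)
    show "\<forall>i>n. (c *\<^sub>C a) i = 0" using v by (simp add: cscale_complex)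
    show "\<forall>i\<le>n. reg_at C Q (\<lambda>x. c * r i x) \<and> c * r i Q = 0"
      using r(1) by (simp add: reg_at_cmult)
    show "near C Q (\<lambda>x. (\<Sum>i\<le>n. (c *\<^sub>C a) i * zc i x) + (\<Sum>i\<le>n. zc i x * (c * r i x)) = 0)"
    proof (rule near_mono[OF r(2)])
      fix x assume "(\<Sum>i\<le>n. a i * zc i x) + (\<Sum>i\<le>n. zc i x * r i x) = 0"
      then have "c * ((\<Sum>i\<le>n. a i * zc i x) + (\<Sum>i\<le>n. zc i x * r i x)) = 0" by simp
      then show "(\<Sum>i\<le>n. (c *\<^sub>C a) i * zc i x) + (\<Sum>i\<le>n. zc i x * (c * r i x)) = 0"
        by (simp add: cscale_complex distrib_left sum_distrib_left mult.assoc mult.left_commute)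
    qed
  qed
qed

text \<open>An equation of \<open>C\<close> is 0 on the chart, so in its expansion at
  \<open>w\<close> the linear part equals minus the second-order remainder. Hence its differential
  is a relation.\<close>

lemma differential_relation:
  assumes F: "F \<in> hom_poly d" and van: "\<forall>M\<in>C. \<forall>u\<in>M. F u = 0"
  shows "\<exists>a\<in>relations. \<forall>v. (\<forall>i>n. v i = 0) \<longrightarrow>
    ((\<lambda>z. F (w + z *\<^sub>C v)) has_field_derivative (\<Sum>i\<le>n. a i * v i)) (at 0)"
proof -
  obtain p where p: "p \<in> polyfun (Suc n)" "\<forall>x. (\<forall>i>n. x i = 0) \<longrightarrow> F x = p x"
    using hom_poly_polyfun[OF F, of n] by (elim bexE)
  let ?p = "\<lambda>z. p (\<lambda>i. w i + z i)"
  from polyfun_taylor[OF polyfun_translate[OF p(1)], of w] obtain a q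
    where q: "\<forall>i<Suc n. q i \<in> polyfun (Suc n) \<and> q i (\<lambda>_. 0) = 0"
      and t: "\<forall>z. ?p z = p (\<lambda>i. w i + 0) + (\<Sum>i<Suc n. a i * z i) + (\<Sum>i<Suc n. z i * q i z)"
    by (elim exE conjE)
  \<comment> \<open>The expansion leaves the coefficients beyond \<open>n\<close> unspecified; they
    are cut off to obtain an element of \<open>relations\<close>.\<close>
  define b where "b = (\<lambda>i. if i \<le> n then a i else 0)"
  have t': "?p z = p w + (\<Sum>i<Suc n. b i * z i) + (\<Sum>i<Suc n. z i * q i z)" for z
    using t[rule_format, of z] by (simp add: b_def lessThan_Suc_atMost)
  have "F w = 0" using van Q w by blast
  then have pw: "p w = 0" using p(2) w_vanish by simp
  have "b \<in> relations" unfolding relations_def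
  proof (intro CollectI conjI exI)
    show "\<forall>i>n. b i = 0" by (simp add: b_def)
    show "\<forall>i\<le>n. reg_at C Q (\<lambda>L. q i (\<lambda>j. zc j L)) \<and> q i (\<lambda>j. zc j Q) = 0"
      using q reg_at_polyfun[of _ "Suc n"] by simp
    show "near C Q (\<lambda>x. (\<Sum>i\<le>n. b i * zc i x) + (\<Sum>i\<le>n. zc i x * q i (\<lambda>j. zc j x)) = 0)"
    proof (rule near_mono[OF near_chart])
      fix L assume L: "L \<in> C \<and> rep L k \<noteq> 0"
      then have "rep L k ^ d * ?p (\<lambda>i. zc i L) = F (rep L)"
        using hom_poly_chart[OF F p(2)] by simp
      also have "\<dots> = 0" using van L rep_in[OF subsetD[OF C_proj]] by blast
      finally have "?p (\<lambda>i. zc i L) = 0" using L by simp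
      then show "(\<Sum>i\<le>n. b i * zc i L) + (\<Sum>i\<le>n. zc i L * q i (\<lambda>j. zc j L)) = 0"
        using t'[of "\<lambda>i. zc i L"] pw by (simp add: lessThan_Suc_atMost)
    qed
  qed
  moreover have "((\<lambda>z. F (w + z *\<^sub>C v)) has_field_derivative (\<Sum>i\<le>n. b i * v i)) (at 0)"
    if v: "\<forall>i>n. v i = 0" for v
  proof -
    have "((\<lambda>z. ?p (\<lambda>i. z * v i)) has_field_derivative (\<Sum>i<Suc n. b i * v i)) (at 0)"
      by (rule polyfun_line_derivative[OF t']) (use q in auto)
    moreover have "F (w + z *\<^sub>C v) = ?p (\<lambda>i. z * v i)" for z
    proof -
      have "F (w + z *\<^sub>C v) = p (w + z *\<^sub>C v)"
        using v w_vanish by (intro p(2)[rule_format]) (simp add: cscale_complex)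
      also have "p (w + z *\<^sub>C v) = ?p (\<lambda>i. z * v i)"
        by (rule arg_cong[of _ _ p]) (simp add: fun_eq_iff cscale_complex)
      finally show ?thesis .
    qed
    ultimately show ?thesis by (simp add: lessThan_Suc_atMost)
  qed
  ultimately show ?thesis by (intro bexI[of _ b]) auto
qed

text \<open>Since \<open>C\<close> lies in the projective space of dimension \<open>n\<close>, each
  coordinate beyond \<open>n\<close> is itself an equation of \<open>C\<close>, and its derivative
  along \<open>v\<close> is \<open>v i\<close>.\<close>

lemma cone_tangent_vanish:
  assumes "v \<in> cone_tangent C Q" "i > n"
  shows "v i = 0"
proof -
  have F: "(\<lambda>x :: nat \<Rightarrow> complex. x i) \<in> hom_poly 1" by (rule hom_poly_linear[OF clin_coord])
  have van: "\<forall>M\<in>C. \<forall>u\<in>M. u i = 0" using projective_space_D(3) C_subset assms(2) by blast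
  have "w \<in> Q - {0}" using w w_nonzero by simp
  from assms(1)[unfolded cone_tangent_def, THEN CollectD, THEN spec, THEN bspec, OF F, THEN mp, OF van, THEN bspec, OF this]
  have "deriv (\<lambda>z. (w + z *\<^sub>C v) i) 0 = 0" .
  moreover have "((\<lambda>z. (w + z *\<^sub>C v) i) has_field_derivative v i) (at 0)"
    by (auto intro!: derivative_eq_intros simp: cscale_complex)
  ultimately show ?thesis by (simp add: DERIV_imp_deriv)
qed

text \<open>Equations of \<open>C\<close> are zero along the whole line \<open>Q\<close>, so moving
  in its own direction does not change them.\<close>

lemma w_cone_tangent: "w \<in> cone_tangent C Q"
  unfolding cone_tangent_def
proof (intro CollectI allI ballI impI)
  fix d F u assume F: "F \<in> hom_poly d" and van: "\<forall>M\<in>C. \<forall>u\<in>M. F u = 0" and u: "u \<in> Q - {0}"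
  have "u + z *\<^sub>C w \<in> Q" for z
    using u w QP by (auto simp: proj_def intro!: cvec.subspace_add cvec.subspace_scale)
  then have "F (u + z *\<^sub>C w) = 0" for z using van Q by blast
  then show "deriv (\<lambda>z. F (u + z *\<^sub>C w)) 0 = 0" by simp
qed

text \<open>Duality in finite dimension. A functional killing all relations but not \<open>a\<close>
  has a coefficient vector killed by the differentials of all equations, that is, a tangent vector;
  it would not be orthogonal to \<open>a\<close>.\<close>

lemma relation_if_orthogonal:
  assumes a: "\<forall>i>n. a i = 0" and orth: "\<And>v. v \<in> cone_tangent C Q \<Longrightarrow> (\<Sum>i\<le>n. a i * v i) = 0"
  shows "a \<in> relations"
proof (rule ccontr)
  assume "a \<notin> relations"
  obtain l :: "(nat \<Rightarrow> complex) \<Rightarrow> complex"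
    where l: "clin l" "\<And>v. v \<in> relations \<Longrightarrow> l v = 0" "l a = 1"
    using separating_functional[OF subspace_relations \<open>a \<notin> relations\<close>] by metis
  \<comment> \<open>The coefficient vector of \<open>l\<close> on sequences vanishing beyond
    \<open>n\<close>.\<close>
  define v where "v = (\<lambda>i. if i \<le> n then l (\<lambda>j. if j = i then 1 else 0) else 0)"
  have lv: "l b = (\<Sum>i\<le>n. b i * v i)" if "\<forall>i>n. b i = 0" for b
    using clin_vanishing_coords[OF l(1) that] by (simp add: v_def mult.commute)
  have "v \<in> cone_tangent C Q" unfolding cone_tangent_def
  proof (intro CollectI allI ballI impI)
    fix d F u assume F: "F \<in> hom_poly d" and van: "\<forall>M\<in>C. \<forall>u\<in>M. F u = 0" and u: "u \<in> Q - {0}"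
    obtain c where c: "u = c *\<^sub>C w" by (rule proj_elemE[OF QP w w_nonzero, of u]) (use u in auto)
    then have "c \<noteq> 0" using u by auto
    obtain b where b: "b \<in> relations"
      "\<forall>v. (\<forall>i>n. v i = 0) \<longrightarrow> ((\<lambda>z. F (w + z *\<^sub>C v)) has_field_derivative (\<Sum>i\<le>n. b i * v i)) (at 0)"
      using differential_relation[OF F van] by (elim bexE)
    have "\<forall>i>n. v i = 0" by (simp add: v_def)
    with b(2) have D: "((\<lambda>z. F (w + z *\<^sub>C v)) has_field_derivative (\<Sum>i\<le>n. b i * v i)) (at 0)" by blast
    have "\<forall>i>n. b i = 0" using b(1) by (simp add: relations_def)
    from lv[OF this] l(2)[OF b(1)] have "(\<Sum>i\<le>n. b i * v i) = 0" by simp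
    \<comment> \<open>The tangent condition is demanded at every nonzero \<open>u = c w\<close> of
      the line. By homogeneity \<open>F (u + z v)\<close> is \<open>c ^ d\<close> times
      \<open>F (w + (z / c) v)\<close>, so the derivative at \<open>w\<close> is used through the
      substitution \<open>z / c\<close>.\<close>
    with D have D0: "((\<lambda>z. F (w + z *\<^sub>C v)) has_field_derivative 0) (at (0 / c))" by simp
    have "((\<lambda>z. z / c) has_field_derivative 1 / c) (at 0)"
      by (auto intro!: derivative_eq_intros simp: \<open>c \<noteq> 0\<close>)
    from DERIV_chain2[OF D0 this] have "((\<lambda>z. c ^ d * F (w + (z / c) *\<^sub>C v)) has_field_derivative 0) (at 0)"
      using DERIV_cmult[of _ 0 0 UNIV "c ^ d"] by simp
    moreover have "F (u + z *\<^sub>C v) = c ^ d * F (w + (z / c) *\<^sub>C v)" for z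
    proof -
      have "u + z *\<^sub>C v = c *\<^sub>C (w + (z / c) *\<^sub>C v)"
        using \<open>c \<noteq> 0\<close> by (simp add: c cscale_add_right cscale_cscale)
      then show ?thesis by (simp only: hom_poly_homogeneous[OF F])
    qed
    ultimately have "((\<lambda>z. F (u + z *\<^sub>C v)) has_field_derivative 0) (at 0)" by simp
    then show "deriv (\<lambda>z. F (u + z *\<^sub>C v)) 0 = 0" by (rule DERIV_imp_deriv)
  qed
  from orth[OF this] lv[OF a] l(3) show False by simp
qed

text \<open>Nonsingularity in dimension one makes the cone tangent space two-dimensional. It
  contains \<open>w\<close>, and a second direction can be corrected by a multiple of
  \<open>w\<close> to have \<open>k\<close>-th coordinate 0.\<close>

lemma tangent_direction:
  obtains b where "b k = 0" "b \<noteq> 0" "\<forall>i>n. b i = 0"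
    "\<And>v. v \<in> cone_tangent C Q \<Longrightarrow> \<exists>\<alpha> \<beta>. v = \<alpha> *\<^sub>C w + \<beta> *\<^sub>C b"
proof -
  let ?T = "cone_tangent C Q"
  have dim: "cvec.dim ?T = 2"
    using C_nonsingular C_dim Q unfolding nonsingular_def by force
  obtain B where B: "B \<subseteq> ?T" "cvec.independent B" "?T \<subseteq> cvec.span B" "card B = 2"
    using cvec.basis_exists[of ?T] unfolding dim by blast
  have fB: "finite B" using B(4) by (simp add: card_ge_0_finite)
  have "\<exists>b\<in>?T. b \<notin> cvec.span {w}"
  proof (rule ccontr)
    assume "\<not> ?thesis"
    then have "B \<subseteq> cvec.span {w}" using B(1) by blast
    from cvec.independent_span_bound[OF _ B(2) this] B(4) show False by simp
  qed
  then obtain b where b: "b \<in> ?T" "b \<notin> cvec.span {w}" by blast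
  have ind: "cvec.independent {b, w}"
    using b(2) w_nonzero by (simp add: cvec.independent_insert)
  have span: "v \<in> cvec.span {b, w}" if v: "v \<in> ?T" for v
  proof (rule ccontr)
    assume nv: "v \<notin> cvec.span {b, w}"
    then have "cvec.independent {v, b, w}" using ind by (simp add: cvec.independent_insertI)
    moreover have "{v, b, w} \<subseteq> cvec.span B" using v b(1) w_cone_tangent B(3) by auto
    ultimately have "card {v, b, w} \<le> card B" using cvec.independent_span_bound[OF fB] by blast
    moreover have "v \<noteq> b" "v \<noteq> w" using nv cvec.span_base[of _ "{b, w}"] by blast+
    moreover have "b \<noteq> w" using b(2) cvec.span_base[of w "{w}"] by blast
    ultimately show False using B(4) by simp
  qed
  define b' where "b' = b - b k *\<^sub>C w"
  show thesis
  proof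
    show "b' k = 0" by (simp add: b'_def wk cscale_complex)
    show "b' \<noteq> 0" 
    proof
      assume "b' = 0"
      then have "b = b k *\<^sub>C w" by (simp add: b'_def)
      then show False using b(2) by (metis cvec.span_base cvec.span_scale singletonI)
    qed
    show "\<forall>i>n. b' i = 0"
      using cone_tangent_vanish[OF b(1)] w_vanish by (simp add: b'_def cscale_complex)
    fix v assume "v \<in> ?T"
    from span[OF this] obtain \<beta> where "v - \<beta> *\<^sub>C b \<in> cvec.span {w}"
      by (auto simp: cvec.span_breakdown_eq)
    then obtain \<alpha> where "v - \<beta> *\<^sub>C b = \<alpha> *\<^sub>C w" by (auto simp: cvec.span_singleton)
    then have "v = (\<alpha> + \<beta> * b k) *\<^sub>C w + \<beta> *\<^sub>C b'"
      by (simp add: b'_def cvec.scale_right_diff_distrib cscale_add_left cscale_cscale algebra_simps)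
    then show "\<exists>\<alpha> \<beta>. v = \<alpha> *\<^sub>C w + \<beta> *\<^sub>C b'" by blast
  qed
qed

text \<open>Nakayama's lemma by elimination: the generators \<open>zc i\<close> of the maximal ideal are congruent to
  multiples of \<open>zc j\<close> modulo the products of the maximal ideal with \<open>zc l\<close>, \<open>l \<in> I\<close>,
  and the elements of \<open>I\<close> are removed one at a time.\<close>

definition reduced :: "nat \<Rightarrow> nat set \<Rightarrow> bool"
  where "reduced j I \<longleftrightarrow> (\<forall>i\<le>n. \<exists>s r. reg_at C Q s \<and> (\<forall>l\<in>I. reg_at C Q (r l) \<and> r l Q = 0) \<and>
    near C Q (\<lambda>x. zc i x = zc j x * s x + (\<Sum>l\<in>I. zc l x * r l x)))"

lemma reduced_step:
  assumes I: "finite I" "m \<notin> I" "m \<le> n" and red: "reduced j (insert m I)"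
  shows "reduced j I"
  unfolding reduced_def
proof (intro allI impI)
  fix i assume i: "i \<le> n"
  from red[unfolded reduced_def, rule_format, OF I(3)] obtain s r where
    r: "reg_at C Q s" "\<forall>l\<in>insert m I. reg_at C Q (r l) \<and> r l Q = 0"
      "near C Q (\<lambda>x. zc m x = zc j x * s x + (\<Sum>l\<in>insert m I. zc l x * r l x))"
    by (elim exE conjE)
  from red[unfolded reduced_def, rule_format, OF i] obtain s' r' where
    r': "reg_at C Q s'" "\<forall>l\<in>insert m I. reg_at C Q (r' l) \<and> r' l Q = 0"
      "near C Q (\<lambda>x. zc i x = zc j x * s' x + (\<Sum>l\<in>insert m I. zc l x * r' l x))"
    by (elim exE conjE)
  \<comment> \<open>The expression for \<open>zc m\<close> contains \<open>zc m\<close> again, with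
    a coefficient \<open>r m\<close> that vanishes at \<open>Q\<close>. Hence \<open>1 - r m\<close>
    is a unit of the local ring, and solving for \<open>zc m\<close> allows it to be eliminated from
    the expression for \<open>zc i\<close>.\<close>
  let ?u = "\<lambda>x. inverse (1 - r m x)"
  have one: "reg_at C Q (\<lambda>x. 1 - r m x)" "1 - r m Q \<noteq> 0"
    using r(2) by (simp_all add: reg_at_diff reg_at_const[OF Q])
  have u: "reg_at C Q ?u" by (rule reg_at_inverse[OF one])
  show "\<exists>s r. reg_at C Q s \<and> (\<forall>l\<in>I. reg_at C Q (r l) \<and> r l Q = 0) \<and>
    near C Q (\<lambda>x. zc i x = zc j x * s x + (\<Sum>l\<in>I. zc l x * r l x))"
  proof (rule exI[of _ "\<lambda>x. s' x + r' m x * (s x * ?u x)"],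
      rule exI[of _ "\<lambda>l x. r' l x + r' m x * (r l x * ?u x)"], intro conjI ballI)
    show "reg_at C Q (\<lambda>x. s' x + r' m x * (s x * ?u x))"
      using r(1) r'(1,2) u by (intro reg_at_add reg_at_mult) auto
    show "reg_at C Q (\<lambda>x. r' l x + r' m x * (r l x * ?u x))" if "l \<in> I" for l
      using r(2) r'(2) u that by (intro reg_at_add reg_at_mult) auto
    show "r' l Q + r' m Q * (r l Q * ?u Q) = 0" if "l \<in> I" for l
      using r(2) r'(2) that by simp
    show "near C Q (\<lambda>x. zc i x = zc j x * (s' x + r' m x * (s x * ?u x)) +
      (\<Sum>l\<in>I. zc l x * (r' l x + r' m x * (r l x * ?u x))))"
    proof (rule near_mono2[OF near_conj[OF near_nonzero[OF one] r(3)] r'(3)])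
      fix x
      assume 1: "1 - r m x \<noteq> 0 \<and> zc m x = zc j x * s x + (\<Sum>l\<in>insert m I. zc l x * r l x)"
        and 2: "zc i x = zc j x * s' x + (\<Sum>l\<in>insert m I. zc l x * r' l x)"
      let ?S = "\<Sum>l\<in>I. zc l x * r l x" and ?S' = "\<Sum>l\<in>I. zc l x * r' l x"
      have "zc m x = zc j x * s x + (zc m x * r m x + ?S)" using 1 I by simp
      then have "zc m x * (1 - r m x) = zc j x * s x + ?S" by (simp add: algebra_simps)
      then have zm: "zc m x = (zc j x * s x + ?S) * ?u x" using 1 by (simp add: field_simps)
      have zi: "zc i x = zc j x * s' x + (zc m x * r' m x + ?S')" using 2 I by simp
      have "(\<Sum>l\<in>I. zc l x * (r' l x + r' m x * (r l x * ?u x))) = ?S' + r' m x * ?u x * ?S"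
        by (simp add: algebra_simps sum.distrib sum_distrib_left)
      then show "zc i x = zc j x * (s' x + r' m x * (s x * ?u x)) +
        (\<Sum>l\<in>I. zc l x * (r' l x + r' m x * (r l x * ?u x)))"
        unfolding zi zm by (simp add: algebra_simps)
    qed
  qed
qed

lemma reduced_empty: "finite I \<Longrightarrow> I \<subseteq> {..n} \<Longrightarrow> reduced j I \<Longrightarrow> reduced j {}"
proof (induction I rule: finite_induct)
  case (insert m I)
  have "reduced j I" by (rule reduced_step[OF insert(1,2) _ insert(5)]) (use insert(4) in simp)
  then show ?case using insert(3,4) by simp
qed

text \<open>A coordinate \<open>j\<close> with \<open>b j\<close> nonzero varies to first order
  along the tangent direction. Every \<open>zc i\<close> is then congruent to
  \<open>b i / b j\<close> times \<open>zc j\<close> modulo second order, which is the starting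
  point of the elimination.\<close>

lemma ex_uniformizer: "\<exists>j\<le>n. reduced j {}"
proof -
  obtain b where b: "b k = 0" "b \<noteq> 0" "\<forall>i>n. b i = 0"
    "\<And>v. v \<in> cone_tangent C Q \<Longrightarrow> \<exists>\<alpha> \<beta>. v = \<alpha> *\<^sub>C w + \<beta> *\<^sub>C b"
    by (rule tangent_direction) blast
  obtain j where j: "b j \<noteq> 0" using b(2) by (auto simp: fun_eq_iff)
  then have jn: "j \<le> n" using b(3) by (meson not_le_imp_less)
  have "reduced j {..n}" unfolding reduced_def
  proof (intro allI impI)
    fix i assume i: "i \<le> n"
    define \<gamma> where "\<gamma> = b i / b j"
    define e where "e = (\<lambda>m l :: nat. if l = m then 1 else 0 :: complex)"
    \<comment> \<open>The linear form \<open>x i - w i * x k - \<gamma> (x j - w j * x k)\<close>.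
      The terms with \<open>x k\<close> make it vanish on \<open>w\<close>, and
      \<open>\<gamma>\<close> makes it vanish on \<open>b\<close>, so it is orthogonal to the
      tangent space. In the chart \<open>zc k\<close> is 0, so only
      \<open>zc i - \<gamma> * zc j\<close> remains.\<close>
    define a where "a = (\<lambda>l. e i l - w i * e k l - \<gamma> * (e j l - w j * e k l))"
    have sum_e: "(\<Sum>l\<le>n. e m l * y l) = y m" if "m \<le> n" for m y
      using that by (simp add: e_def if_distrib[of "\<lambda>c. c * _"] cong: if_cong)
    have sum_a: "(\<Sum>l\<le>n. a l * y l) = y i - w i * y k - \<gamma> * (y j - w j * y k)" for y
    proof -
      have "(\<Sum>l\<le>n. a l * y l) = (\<Sum>l\<le>n. e i l * y l) - w i * (\<Sum>l\<le>n. e k l * y l)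
        - \<gamma> * ((\<Sum>l\<le>n. e j l * y l) - w j * (\<Sum>l\<le>n. e k l * y l))"
        unfolding a_def by (simp add: algebra_simps sum.distrib sum_subtractf sum_distrib_left)
      then show ?thesis using i k jn by (simp add: sum_e)
    qed
    have "a \<in> relations"
    proof (rule relation_if_orthogonal)
      show "\<forall>l>n. a l = 0" using i k jn by (auto simp: a_def e_def)
      fix v assume "v \<in> cone_tangent C Q"
      then obtain \<alpha> \<beta> where v: "v = \<alpha> *\<^sub>C w + \<beta> *\<^sub>C b" using b(4) by blast
      have "v l = \<alpha> * w l + \<beta> * b l" for l by (simp add: v cscale_complex)
      moreover have "\<gamma> * b j = b i" using j by (simp add: \<gamma>_def)
      ultimately show "(\<Sum>l\<le>n. a l * v l) = 0"
        unfolding sum_a using b(1) wk by (simp add: algebra_simps)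
    qed
    then obtain r where r: "\<forall>i\<le>n. reg_at C Q (r i) \<and> r i Q = 0"
      "near C Q (\<lambda>x. (\<Sum>i\<le>n. a i * zc i x) + (\<Sum>i\<le>n. zc i x * r i x) = 0)"
      unfolding relations_def by blast
    show "\<exists>s r. reg_at C Q s \<and> (\<forall>l\<in>{..n}. reg_at C Q (r l) \<and> r l Q = 0) \<and>
      near C Q (\<lambda>x. zc i x = zc j x * s x + (\<Sum>l\<le>n. zc l x * r l x))"
    proof (rule exI[of _ "\<lambda>_. \<gamma>"], rule exI[of _ "\<lambda>l x. -1 * r l x"], intro conjI ballI)
      show "reg_at C Q (\<lambda>_. \<gamma>)" by (rule reg_at_const[OF Q])
      show "reg_at C Q (\<lambda>x. -1 * r l x)" "-1 * r l Q = 0" if "l \<in> {..n}" for l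
        using r(1) that reg_at_cmult[of Q "r l" "-1"] by simp_all
      show "near C Q (\<lambda>x. zc i x = zc j x * \<gamma> + (\<Sum>l\<le>n. zc l x * (-1 * r l x)))"
      proof (rule near_mono2[OF near_chart r(2)])
        fix x assume 1: "x \<in> C \<and> rep x k \<noteq> 0" and 2: "(\<Sum>i\<le>n. a i * zc i x) + (\<Sum>i\<le>n. zc i x * r i x) = 0"
        have "zc k x = 0" using 1 by (simp add: zc_k)
        with 2 show "zc i x = zc j x * \<gamma> + (\<Sum>l\<le>n. zc l x * (-1 * r l x))"
          unfolding sum_a by (simp add: sum_negf algebra_simps)
      qed
    qed
  qed
  then have "reduced j {}" by (rule reduced_empty[rotated 2]) auto
  with jn show ?thesis by blast
qed

text \<open>Writing \<open>h\<close> as a quotient of dehomogenized forms, the denominator is a unit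
  at \<open>Q\<close> and the numerator has constant term 0; its expansion is a combination of the
  coordinates.\<close>

lemma maximal_ideal_generators:
  assumes "reg_at C Q h" "h Q = 0"
  shows "\<exists>g. (\<forall>i\<le>n. reg_at C Q (g i)) \<and> near C Q (\<lambda>x. h x = (\<Sum>i\<le>n. zc i x * g i x))"
proof -
  obtain W where W: "zopen_in C W" "Q \<in> W" "regular_on C W h" by (rule reg_atE[OF assms(1)])
  obtain W' d G H where W': "zopen_in C W'" "Q \<in> W'" "W' \<subseteq> W" "G \<in> hom_poly d" "H \<in> hom_poly d"
    and h: "\<forall>M\<in>W'. H (rep M) \<noteq> 0 \<and> h M = G (rep M) / H (rep M)"
    using regular_onE[OF C_proj W(3,2)] .
  obtain p where p: "p \<in> polyfun (Suc n)" "\<forall>x. (\<forall>i>n. x i = 0) \<longrightarrow> G x = p x"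
    using hom_poly_polyfun[OF W'(4), of n] by (elim bexE)
  obtain q where q: "q \<in> polyfun (Suc n)" "\<forall>x. (\<forall>i>n. x i = 0) \<longrightarrow> H x = q x"
    using hom_poly_polyfun[OF W'(5), of n] by (elim bexE)
  let ?p = "\<lambda>z. p (\<lambda>i. w i + z i)"
  let ?q = "\<lambda>x. q (\<lambda>i. w i + zc i x)"
  have rq: "reg_at C Q ?q" using reg_at_polyfun[OF polyfun_translate[OF q(1)], of w] .
  have "H (rep Q) = rep Q k ^ d * ?q Q" by (rule hom_poly_chart[OF W'(5) q(2) Q rep_Q(1)])
  then have qQ: "?q Q \<noteq> 0" using h W'(2) by auto
  have "G (rep Q) = rep Q k ^ d * ?p (\<lambda>i. zc i Q)" by (rule hom_poly_chart[OF W'(4) p(2) Q rep_Q(1)])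
  moreover have "G (rep Q) = 0" using h W'(2) assms(2) by auto
  ultimately have p0: "?p (\<lambda>_. 0) = 0" using rep_Q(1) by simp
  from polyfun_taylor[OF polyfun_translate[OF p(1)], of w] obtain a r
    where r: "\<forall>i<Suc n. r i \<in> polyfun (Suc n) \<and> r i (\<lambda>_. 0) = 0"
      and t: "\<forall>z. ?p z = ?p (\<lambda>_. 0) + (\<Sum>i<Suc n. a i * z i) + (\<Sum>i<Suc n. z i * r i z)"
    by (elim exE conjE)
  show ?thesis
  proof (rule exI[of _ "\<lambda>i x. (a i + r i (\<lambda>j. zc j x)) * inverse (?q x)"], intro conjI allI impI)
    show "reg_at C Q (\<lambda>x. (a i + r i (\<lambda>j. zc j x)) * inverse (?q x))" if "i \<le> n" for i
      using r that by (intro reg_at_mult reg_at_add reg_at_const Q reg_at_inverse[OF rq qQ] reg_at_polyfun[of _ "Suc n"]) auto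
    show "near C Q (\<lambda>x. h x = (\<Sum>i\<le>n. zc i x * ((a i + r i (\<lambda>j. zc j x)) * inverse (?q x))))"
    proof (rule near_mono2[OF near_chart nearI[OF W'(1,2)]])
      show "x \<in> W' \<Longrightarrow> x \<in> W'" for x .
      fix x assume x: "x \<in> C \<and> rep x k \<noteq> 0" "x \<in> W'"
      have "h x = G (rep x) / H (rep x)" using h x(2) by blast
      also have "G (rep x) = rep x k ^ d * ?p (\<lambda>i. zc i x)" using hom_poly_chart[OF W'(4) p(2)] x by blast
      also have "H (rep x) = rep x k ^ d * ?q x" using hom_poly_chart[OF W'(5) q(2)] x by blast
      also have "rep x k ^ d * ?p (\<lambda>i. zc i x) / (rep x k ^ d * ?q x) = ?p (\<lambda>i. zc i x) * inverse (?q x)"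
        using x by (simp add: divide_inverse)
      also have "?p (\<lambda>i. zc i x) = (\<Sum>i\<le>n. zc i x * (a i + r i (\<lambda>j. zc j x)))"
        using t[rule_format, of "\<lambda>i. zc i x"] p0
        by (simp add: lessThan_Suc_atMost algebra_simps sum.distrib)
      finally show "h x = (\<Sum>i\<le>n. zc i x * ((a i + r i (\<lambda>j. zc j x)) * inverse (?q x)))"
        by (simp add: sum_distrib_right mult.assoc)
    qed
  qed
qed

text \<open>All \<open>zc i\<close> are multiples of one \<open>zc j\<close> near \<open>Q\<close>.
  So \<open>zc j\<close> generates the maximal ideal, and where it vanishes all affine coordinates
  vanish, which leaves only the point \<open>Q\<close>.\<close>

lemma local_equation_exists: "\<exists>U t. local_equation C Q U t"
proof -
  obtain j where j: "j \<le> n" "reduced j {}" using ex_uniformizer by blast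
  have "\<forall>i\<in>{..n}. \<exists>s. reg_at C Q s \<and> near C Q (\<lambda>x. zc i x = zc j x * s x)"
    using j(2) unfolding reduced_def by simp
  from bchoice[OF this] obtain s where s: "\<forall>i\<in>{..n}. reg_at C Q (s i) \<and> near C Q (\<lambda>x. zc i x = zc j x * s i x)" ..
  have all: "near C Q (\<lambda>x. \<forall>i\<in>{..n}. zc i x = zc j x * s i x)"
    by (rule near_all_finite) (use s Q in auto)
  have "\<exists>U. local_equation C Q U (zc j)"
  proof (rule local_equationI)
    show "reg_at C Q (zc j)" by (rule reg_at_zc)
    show "near C Q (\<lambda>x. zc j x = 0 \<longleftrightarrow> x = Q)"
    proof (rule near_mono2[OF near_chart all])
      fix x assume x: "x \<in> C \<and> rep x k \<noteq> 0" and z: "\<forall>i\<in>{..n}. zc i x = zc j x * s i x"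
      have "x = Q" if "zc j x = 0"
      proof -
        have coord: "rep x i = rep x k * w i" for i
        proof (cases "i \<le> n")
          case True
          then have "zc i x = 0" using z that by auto
          then show ?thesis using x by (simp add: zc_def field_simps)
        next
          case False
          then show ?thesis using x projective_space_D(2)[OF subsetD[OF C_subset], of x i] w_vanish by simp
        qed
        have eq: "rep x = rep x k *\<^sub>C w"
          by (rule ext) (simp only: cscale_fun_apply cscale_complex coord[symmetric])
        have "rep x k *\<^sub>C w \<in> Q" using QP w by (simp add: proj_def cvec.subspace_scale)
        then have "rep x \<in> Q" by (subst eq)
        moreover have xP: "x \<in> proj UNIV" using x C_proj by blast
        ultimately show ?thesis by (intro proj_eqI[OF xP QP rep_in[OF xP] _ rep_nonzero[OF xP]])
      qed
      then show "zc j x = 0 \<longleftrightarrow> x = Q" by auto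
    qed
    fix h assume h: "reg_at C Q h" "h Q = 0"
    from maximal_ideal_generators[OF this] obtain g where g: "\<forall>i\<le>n. reg_at C Q (g i)"
      "near C Q (\<lambda>x. h x = (\<Sum>i\<le>n. zc i x * g i x))" by (elim exE conjE)
    show "\<exists>g. reg_at C Q g \<and> near C Q (\<lambda>x. h x = zc j x * g x)"
    proof (rule exI[of _ "\<lambda>x. \<Sum>i\<le>n. s i x * g i x"], intro conjI)
      show "reg_at C Q (\<lambda>x. \<Sum>i\<le>n. s i x * g i x)"
        using s g(1) by (intro reg_at_sum Q reg_at_mult) auto
      show "near C Q (\<lambda>x. h x = zc j x * (\<Sum>i\<le>n. s i x * g i x))"
      proof (rule near_mono2[OF g(2) all])
        fix x assume 1: "h x = (\<Sum>i\<le>n. zc i x * g i x)" and 2: "\<forall>i\<in>{..n}. zc i x = zc j x * s i x"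
        have "(\<Sum>i\<le>n. zc i x * g i x) = (\<Sum>i\<le>n. zc j x * (s i x * g i x))"
        proof (rule sum.cong[OF refl])
          fix i assume "i \<in> {..n}"
          then have "zc i x = zc j x * s i x" using 2 by blast
          then show "zc i x * g i x = zc j x * (s i x * g i x)" by simp
        qed
        then show "h x = zc j x * (\<Sum>i\<le>n. s i x * g i x)" using 1 by (simp add: sum_distrib_left)
      qed
    qed
  qed
  then show ?thesis by blast
qed

end

lemma (in curve) ex_local_equation:
  assumes "Q \<in> C"
  shows "\<exists>U t. local_equation C Q U t"
proof -
  have QS: "Q \<in> projective_space n" using assms C_subset by blast
  have QP: "Q \<in> proj UNIV" using assms C_proj by blast
  obtain k where k: "rep Q k \<noteq> 0" using rep_nonzero[OF QP] by (auto simp: fun_eq_iff)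
  have kn: "k \<le> n" using projective_space_D(2)[OF QS, of k] k by (meson not_le_imp_less)
  let ?w = "(1 / rep Q k) *\<^sub>C rep Q"
  have "?w \<in> Q" using QP rep_in[OF QP] by (auto simp: proj_def intro: cvec.subspace_scale)
  then interpret curve_point C n Q ?w k
    using assms kn k by unfold_locales (simp_all add: cscale_complex)
  show ?thesis by (rule local_equation_exists)
qed

section \<open>Cocycles on an elliptic curve\<close>

lemma point_coverD: "point_cover C U \<Longrightarrow> x \<in> C \<Longrightarrow> zopen_in C (U x)" "point_cover C U \<Longrightarrow> x \<in> C \<Longrightarrow> x \<in> U x"
  by (auto simp: point_cover_def)

lemma refinesD: "refines C V U \<Longrightarrow> x \<in> C \<Longrightarrow> p \<in> V x \<Longrightarrow> p \<in> U x"
  by (auto simp: refines_def)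

lemma refines_trans: "refines C W V \<Longrightarrow> refines C V U \<Longrightarrow> refines C W U"
  unfolding refines_def by blast

lemma cocycleD:
  assumes "cocycle C U F" "x \<in> C" "y \<in> C"
  shows "regular_on C (U x \<inter> U y) (F x y)"
    "z \<in> C \<Longrightarrow> p \<in> U x \<inter> U y \<inter> U z \<Longrightarrow> F x z p = F x y p + F y z p"
  using assms unfolding cocycle_def by blast+

lemma cocycle_diag: "cocycle C U F \<Longrightarrow> x \<in> C \<Longrightarrow> p \<in> U x \<Longrightarrow> F x x p = 0"
  using cocycleD(2)[of C U F x x x p] by simp

lemma coboundaryE:
  assumes "coboundary C V f"
  obtains k where "\<And>x. x \<in> C \<Longrightarrow> regular_on C (V x) (k x)"
    "\<And>x y p. x \<in> C \<Longrightarrow> y \<in> C \<Longrightarrow> p \<in> V x \<Longrightarrow> p \<in> V y \<Longrightarrow> f x y p = k y p - k x p"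
proof -
  from assms obtain g where g: "\<forall>x\<in>C. regular_on C (V x) (g x)"
    "\<forall>x\<in>C. \<forall>y\<in>C. \<forall>p \<in> V x \<inter> V y. f x y p = g y p - g x p"
    unfolding coboundary_def by (elim exE conjE)
  show thesis by (rule that[of g]) (use g in auto)
qed

locale elliptic = curve +
  assumes genus: "H1_structure_sheaf_dim C 1"
begin

text \<open>The dimension statement for a one-element basis without sums: a class that stays
  nontrivial on every refinement, and of which every other class is a scalar multiple.\<close>

lemma genus_cocycle:
  obtains U F where "point_cover C U" "cocycle C U F"
    "\<And>V. point_cover C V \<Longrightarrow> refines C V U \<Longrightarrow> \<not> coboundary C V F"
    "\<And>W G. point_cover C W \<Longrightarrow> cocycle C W G \<Longrightarrow> \<exists>c V. point_cover C V \<and> refines C V U \<and> refines C V W \<and>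
      coboundary C V (\<lambda>x y p. G x y p - c * F x y p)"
proof -
  from genus[unfolded H1_structure_sheaf_dim_def] obtain U
    and F :: "nat \<Rightarrow> (nat \<Rightarrow> complex) set \<Rightarrow> (nat \<Rightarrow> complex) set \<Rightarrow> (nat \<Rightarrow> complex) set \<Rightarrow> complex" where
    1: "point_cover C U" "\<forall>i<1. cocycle C U (F i)" and
    2: "\<forall>c V. point_cover C V \<and> refines C V U \<and> coboundary C V (\<Sum>i<1. c i *\<^sub>C F i) \<longrightarrow> (\<forall>i<1. c i = 0)" and
    3: "\<forall>W G. point_cover C W \<and> cocycle C W G \<longrightarrow>
      (\<exists>c V. point_cover C V \<and> refines C V U \<and> refines C V W \<and> coboundary C V (G - (\<Sum>i<1. c i *\<^sub>C F i)))"
    by (elim exE conjE)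
  have sum1: "(\<Sum>i<1. c i *\<^sub>C F i) = (\<lambda>x y p. c 0 * F 0 x y p)" for c :: "nat \<Rightarrow> complex"
    by (simp add: fun_eq_iff cscale_complex)
  show thesis
  proof (rule that[of U "F 0"])
    show "point_cover C U" "cocycle C U (F 0)" using 1 by simp_all
    show "\<not> coboundary C V (F 0)" if V: "point_cover C V" "refines C V U" for V
    proof
      assume cb: "coboundary C V (F 0)"
      have "(\<Sum>i<1. (\<lambda>_. 1) i *\<^sub>C F i) = F 0" unfolding sum1 by simp
      with cb have "coboundary C V (\<Sum>i<1. (\<lambda>_. 1) i *\<^sub>C F i)" by (simp only:)
      with V have "\<forall>i<(1::nat). (\<lambda>_::nat. 1::complex) i = 0"
        by (intro 2[THEN spec, THEN spec, THEN mp] conjI)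
      from this[THEN spec, of 0] show False by simp
    qed
    fix W G assume W: "point_cover C W" "cocycle C W G"
    from 3[rule_format, OF conjI[OF W]] obtain c V where V: "point_cover C V" "refines C V U" "refines C V W"
      "coboundary C V (G - (\<Sum>i<1. c i *\<^sub>C F i))" by (elim exE conjE)
    have eq: "G - (\<Sum>i<1. c i *\<^sub>C F i) = (\<lambda>x y p. G x y p - c 0 * F 0 x y p)"
      unfolding sum1 by (simp add: fun_eq_iff)
    from V show "\<exists>c V. point_cover C V \<and> refines C V U \<and> refines C V W \<and>
      coboundary C V (\<lambda>x y p. G x y p - c * F 0 x y p)"
      unfolding eq by (intro exI conjI)
  qed
qed

text \<open>The multiplier may be singular outside \<open>A\<close>. Only overlaps with different
  indices have to avoid that locus: on the diagonal the cocycle is 0, and so is the product whatever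
  the value of the multiplier.\<close>

lemma cocycle_mult:
  assumes F: "cocycle C U F" and V: "point_cover C V" "refines C V U" and m: "regular_on C A m"
    and A: "\<And>x y. x \<in> C \<Longrightarrow> y \<in> C \<Longrightarrow> x \<noteq> y \<Longrightarrow> V x \<inter> V y \<subseteq> A"
  shows "cocycle C V (\<lambda>x y p. m p * F x y p)"
  unfolding cocycle_def
proof (intro conjI ballI)
  fix x y assume xy: "x \<in> C" "y \<in> C"
  have o: "zopen_in C (V x \<inter> V y)" by (intro zopen_in_Int point_coverD V xy)
  show "regular_on C (V x \<inter> V y) (\<lambda>p. m p * F x y p)"
  proof (cases "x = y")
    case True
    show ?thesis
      by (rule regular_on_cong[OF regular_on_const[OF o, of 0]])
        (use True cocycle_diag[OF F xy(1)] refinesD[OF V(2) xy(1)] in auto)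
  next
    case False
    have "regular_on C (V x \<inter> V y) m" by (rule regular_on_subset[OF m o A[OF xy False]])
    moreover have "regular_on C (V x \<inter> V y) (F x y)"
      by (rule regular_on_subset[OF cocycleD(1)[OF F xy] o]) (use refinesD[OF V(2)] xy in auto)
    ultimately show ?thesis by (rule regular_on_mult)
  qed
next
  fix x y z p assume xyz: "x \<in> C" "y \<in> C" "z \<in> C" "p \<in> V x \<inter> V y \<inter> V z"
  then have "p \<in> U x \<inter> U y \<inter> U z" using refinesD[OF V(2)] by blast
  from cocycleD(2)[OF F xyz(1,2,3) this]
  show "m p * F x z p = m p * F x y p + m p * F y z p" by (simp add: distrib_left)
qed

text \<open>A function \<open>f\<close> with at most a simple pole at \<open>Q\<close> is constant, since \<open>H\<^sup>1(C, O\<^sub>C)\<close> has dimension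
  one: multiplication of the generator \<open>F\<close> by \<open>f\<close> is multiplication by a scalar \<open>\<lambda>\<close> up to a
  coboundary \<open>dh\<close>. If \<open>f\<close> is not \<open>\<lambda>\<close>, then \<open>F / (f - \<lambda>)\<close>, on a cover whose
  overlaps avoid the zeros of \<open>f - \<lambda>\<close>, is \<open>\<mu> F + dk\<close>, and
  \<open>F = \<mu> dh + (f - \<lambda>) dk\<close> is a coboundary. Normalizing \<open>k\<close> to vanish at \<open>Q\<close> cancels the pole of \<open>f\<close>.\<close>

theorem simple_pole_constant:
  assumes t: "local_equation C Q U0 t" and f: "regular_on C (C - {Q}) f"
    and g: "reg_at C Q g" "near C Q (\<lambda>x. x \<noteq> Q \<longrightarrow> t x * f x = g x)"
  shows "\<exists>c. \<forall>x\<in>C - {Q}. f x = c"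
proof (rule ccontr)
  assume nonconst: "\<not> ?thesis"
  note Q = local_equationD(3)[OF t]
  obtain U F where U: "point_cover C U" and F: "cocycle C U F"
    and nontriv: "\<And>V. point_cover C V \<Longrightarrow> refines C V U \<Longrightarrow> \<not> coboundary C V F"
    and gen: "\<And>W G. point_cover C W \<Longrightarrow> cocycle C W G \<Longrightarrow> \<exists>c V. point_cover C V \<and> refines C V U \<and> refines C V W \<and>
      coboundary C V (\<lambda>x y p. G x y p - c * F x y p)"
    by (rule genus_cocycle) blast
  \<comment> \<open>The point \<open>Q\<close> is removed from every member except its own, so the
    pole of \<open>f\<close> lies in no overlap of different members.\<close>
  define V1 where "V1 = (\<lambda>x. U x - ({Q} - {x}))"
  have V1: "point_cover C V1"
    unfolding point_cover_def V1_def using point_coverD[OF U] open_diff_finite by auto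
  have ref1: "refines C V1 U" unfolding refines_def V1_def by blast
  have "V1 x \<inter> V1 y \<subseteq> C - {Q}" if "x \<in> C" "y \<in> C" "x \<noteq> y" for x y
    using that zopen_in_subset[OF point_coverD(1)[OF U that(1)]] unfolding V1_def by blast
  from gen[OF V1 cocycle_mult[OF F V1 ref1 f this]] obtain l V2 where V2: "point_cover C V2" "refines C V2 V1"
    and cb2: "coboundary C V2 (\<lambda>x y p. f p * F x y p - l * F x y p)" by blast
  obtain h where h: "\<And>x. x \<in> C \<Longrightarrow> regular_on C (V2 x) (h x)"
    "\<And>x y p. x \<in> C \<Longrightarrow> y \<in> C \<Longrightarrow> p \<in> V2 x \<Longrightarrow> p \<in> V2 y \<Longrightarrow> f p * F x y p - l * F x y p = h y p - h x p"
    by (rule coboundaryE[OF cb2]) blast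
  define A where "A = {x \<in> C - {Q}. f x - l \<noteq> 0}"
  have oQ: "zopen_in C (C - {Q})" by (rule regular_on_zopen[OF C_proj f])
  have fl: "regular_on C (C - {Q}) (\<lambda>x. f x - l)"
    by (rule regular_on_diff[OF f regular_on_const[OF oQ]])
  have oA: "zopen_in C A" unfolding A_def by (rule zopen_in_nonzero[OF C_proj fl])
  have "A \<noteq> {}" using nonconst unfolding A_def by auto
  then have finA: "finite (C - A)" by (rule finite_complement[OF oA])
  have "regular_on C A (\<lambda>x. f x - l)" by (rule regular_on_subset[OF fl oA]) (auto simp: A_def)
  then have inv: "regular_on C A (\<lambda>x. inverse (f x - l))"
    by (rule regular_on_inverse) (simp add: A_def)
  \<comment> \<open>The same device for the finite set \<open>C - A\<close>, which consists of
    \<open>Q\<close> and the zeros of \<open>f - l\<close>: each such point stays only in the member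
    indexed by it.\<close>
  define V3 where "V3 = (\<lambda>x. U x - ((C - A) - {x}))"
  have V3: "point_cover C V3"
    unfolding point_cover_def V3_def using point_coverD[OF U] open_diff_finite finA by auto
  have ref3: "refines C V3 U" unfolding refines_def V3_def by blast
  have V3A: "V3 x \<inter> V3 y \<subseteq> A" if "x \<in> C" "y \<in> C" "x \<noteq> y" for x y
    using that zopen_in_subset[OF point_coverD(1)[OF U that(1)]] unfolding V3_def by blast
  from gen[OF V3 cocycle_mult[OF F V3 ref3 inv V3A]] obtain \<mu> V4 where V4: "point_cover C V4" "refines C V4 V3"
    and cb4: "coboundary C V4 (\<lambda>x y p. inverse (f p - l) * F x y p - \<mu> * F x y p)" by blast
  obtain k where k: "\<And>x. x \<in> C \<Longrightarrow> regular_on C (V4 x) (k x)"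
    "\<And>x y p. x \<in> C \<Longrightarrow> y \<in> C \<Longrightarrow> p \<in> V4 x \<Longrightarrow> p \<in> V4 y \<Longrightarrow>
      inverse (f p - l) * F x y p - \<mu> * F x y p = k y p - k x p"
    by (rule coboundaryE[OF cb4]) blast
  define V5 where "V5 = (\<lambda>x. V2 x \<inter> V4 x)"
  have V5: "point_cover C V5"
    unfolding point_cover_def V5_def using point_coverD[OF V2(1)] point_coverD[OF V4(1)] zopen_in_Int by blast
  have ref5: "refines C V5 U"
    using refines_trans[OF V4(2) ref3] unfolding refines_def V5_def by blast
  \<comment> \<open>Subtracting one constant from all \<open>k x\<close> does not change their
    differences; this one makes \<open>k Q - c\<close> vanish at \<open>Q\<close>, hence divisible
    by \<open>t\<close>.\<close>
  define c where "c = k Q Q"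
  have kQ: "reg_at C Q (k Q)" by (rule reg_atI[OF k(1)[OF Q] point_coverD(2)[OF V4(1) Q]])
  have "reg_at C Q (\<lambda>x. k Q x - c)" "k Q Q - c = 0"
    using reg_at_diff[OF kQ reg_at_const[OF Q]] by (simp_all add: c_def)
  from local_equationD(7)[OF t this] obtain s where s: "reg_at C Q s" "near C Q (\<lambda>x. k Q x - c = t x * s x)"
    by blast
  \<comment> \<open>Only the member indexed by \<open>Q\<close> contains \<open>Q\<close>. There
    \<open>t f = g\<close> and \<open>k Q - c = t s\<close> turn \<open>f * (k Q - c)\<close> into
    the regular germ \<open>g * s\<close>, while \<open>l * (k Q - c)\<close> is 0 at
    \<open>Q\<close>; the exceptional value is this continuation.\<close>
  define m where "m = (\<lambda>x p. if x = Q \<and> p = Q then \<mu> * h Q Q + g Q * s Q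
    else \<mu> * h x p + (f p - l) * (k x p - c))"
  have "coboundary C V5 F" unfolding coboundary_def
  proof (intro exI[of _ m] conjI ballI)
    fix x assume x: "x \<in> C"
    show "regular_on C (V5 x) (m x)"
    proof (rule regular_onI[OF point_coverD(1)[OF V5 x]])
      fix p assume p: "p \<in> V5 x"
      have pC: "p \<in> C" using p zopen_in_subset[OF point_coverD(1)[OF V5 x]] by blast
      have hp: "reg_at C p (h x)" by (rule reg_atI[OF h(1)[OF x]]) (use p in \<open>simp add: V5_def\<close>)
      have kp: "reg_at C p (k x)" by (rule reg_atI[OF k(1)[OF x]]) (use p in \<open>simp add: V5_def\<close>)
      show "reg_at C p (m x)"
      proof (cases "p = Q")
        case False
        have "reg_at C p f" by (rule reg_atI[OF f]) (use pC False in simp)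
        then have "reg_at C p (\<lambda>p. \<mu> * h x p + (f p - l) * (k x p - c))"
          by (intro reg_at_add reg_at_mult reg_at_diff reg_at_const pC hp kp)
        then show ?thesis
          by (rule reg_at_cong) (rule near_mono[OF near_neq[OF pC False]], simp add: m_def)
      next
        case True
        have "x = Q"
        proof (rule ccontr)
          assume "x \<noteq> Q"
          have "p \<in> V1 x" using p refinesD[OF V2(2) x] by (simp add: V5_def)
          then show False using True \<open>x \<noteq> Q\<close> by (simp add: V1_def)
        qed
        have "reg_at C Q (\<lambda>p. \<mu> * h Q p + (g p * s p - l * (k Q p - c)))"
          using hp True \<open>x = Q\<close>
          by (intro reg_at_add reg_at_mult reg_at_diff reg_at_const[OF Q] kQ s(1) g(1)) simp_all
        then have "reg_at C Q (m Q)"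
        proof (rule reg_at_cong)
          show "near C Q (\<lambda>p. \<mu> * h Q p + (g p * s p - l * (k Q p - c)) = m Q p)"
          proof (rule near_mono2[OF g(2) s(2)])
            fix p assume 1: "p \<noteq> Q \<longrightarrow> t p * f p = g p" and 2: "k Q p - c = t p * s p"
            show "\<mu> * h Q p + (g p * s p - l * (k Q p - c)) = m Q p"
            proof (cases "p = Q")
              case True
              then show ?thesis by (simp add: m_def c_def)
            next
              case False
              then have "g p = t p * f p" using 1 by simp
              then have "g p * s p = f p * (k Q p - c)" by (simp add: 2)
              then show ?thesis using False by (simp add: m_def algebra_simps)
            qed
          qed
        qed
        then show ?thesis using True \<open>x = Q\<close> by simp
      qed
    qed
  next
    fix x y p assume x: "x \<in> C" and y: "y \<in> C" and p: "p \<in> V5 x \<inter> V5 y"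
    show "F x y p = m y p - m x p"
    proof (cases "x = y")
      case True
      then show ?thesis using cocycle_diag[OF F x] refinesD[OF ref5 x] p by simp
    next
      case False
      have "p \<in> V3 x \<inter> V3 y" using p refinesD[OF V4(2)] x y unfolding V5_def by blast
      then have "p \<in> A" using V3A[OF x y False] by blast
      then have pQ: "p \<noteq> Q" and fp: "f p - l \<noteq> 0" by (auto simp: A_def)
      have "m y p - m x p = \<mu> * (h y p - h x p) + (f p - l) * (k y p - k x p)"
        using pQ by (simp add: m_def algebra_simps)
      also have "h y p - h x p = f p * F x y p - l * F x y p"
        using h(2)[OF x y] p unfolding V5_def by simp
      also have "k y p - k x p = inverse (f p - l) * F x y p - \<mu> * F x y p"
        using k(2)[OF x y] p unfolding V5_def by simp
      also have "\<mu> * (f p * F x y p - l * F x y p) + (f p - l) * (inverse (f p - l) * F x y p - \<mu> * F x y p) =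
        ((f p - l) * inverse (f p - l)) * F x y p"
        by (simp only: algebra_simps)
      also have "\<dots> = F x y p" using fp by simp
      finally show ?thesis by simp
    qed
  qed
  then show False using nontriv[OF V5 ref5] by blast
qed

text \<open>For indices other than \<open>Q\<close> the functions \<open>k x\<close> agree on
  overlaps, so their diagonal values \<open>k p p\<close> form a regular function off
  \<open>Q\<close>. Comparison with the index \<open>Q\<close> shows that its negative differs from
  \<open>r\<close> near \<open>Q\<close> by the regular germ \<open>k Q\<close>.\<close>

lemma glue_principal_part:
  assumes Q: "Q \<in> C" and V: "point_cover C V" and k: "\<And>x. x \<in> C \<Longrightarrow> regular_on C (V x) (k x)"
    and eq: "\<And>x y p. x \<in> C \<Longrightarrow> y \<in> C \<Longrightarrow> p \<in> V x \<Longrightarrow> p \<in> V y \<Longrightarrow>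
      (if y = Q then r p else 0) - (if x = Q then r p else 0) = k y p - k x p"
  shows "\<exists>e. regular_on C (C - {Q}) e \<and> near C Q (\<lambda>x. x \<noteq> Q \<longrightarrow> e x = r x - k Q x)"
proof (intro exI[of _ "\<lambda>p. - 1 * k p p"] conjI)
  show "regular_on C (C - {Q}) (\<lambda>p. - 1 * k p p)"
  proof (rule regular_onI)
    show "zopen_in C (C - {Q})" by (rule open_diff_finite[OF zopen_in_self]) simp
    fix p assume p: "p \<in> C - {Q}"
    then have pC: "p \<in> C" and pQ: "p \<noteq> Q" by auto
    have "reg_at C p (\<lambda>q. - 1 * k p q)"
      by (rule reg_at_cmult[OF reg_atI[OF k[OF pC] point_coverD(2)[OF V pC]]])
    then show "reg_at C p (\<lambda>p. - 1 * k p p)"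
    proof (rule reg_at_cong)
      show "near C p (\<lambda>q. - 1 * k p q = - 1 * k q q)"
      proof (rule near_mono2[OF near_neq[OF pC pQ] nearI[OF point_coverD[OF V pC]]])
        show "x \<in> V p \<Longrightarrow> x \<in> V p" for x .
        fix q assume q: "q \<noteq> Q" "q \<in> V p"
        then have qC: "q \<in> C" using zopen_in_subset[OF point_coverD(1)[OF V pC]] by blast
        from eq[OF pC qC q(2) point_coverD(2)[OF V qC]] show "- 1 * k p q = - 1 * k q q"
          using q(1) pQ by simp
      qed
    qed
  qed
  show "near C Q (\<lambda>x. x \<noteq> Q \<longrightarrow> - 1 * k x x = r x - k Q x)"
  proof (rule nearI[OF point_coverD[OF V Q]], rule impI)
    fix q assume q: "q \<in> V Q" "q \<noteq> Q"
    then have qC: "q \<in> C" using zopen_in_subset[OF point_coverD(1)[OF V Q]] by blast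
    from eq[OF qC Q point_coverD(2)[OF V qC] q(1)] show "- 1 * k q q = r q - k Q q"
      using q(2) by (simp add: algebra_simps)
  qed
qed

text \<open>The difference of the local data \<open>t ^ (-j)\<close> at the index \<open>Q\<close>
  and 0 at all other indices. These data are singular at \<open>Q\<close>, but overlaps of the two
  kinds of members omit \<open>Q\<close>, so the differences are regular.\<close>

lemma pole_cocycle:
  assumes t: "local_equation C Q U0 t"
  shows "cocycle C (\<lambda>x. if x = Q then U0 else C - {Q})
    (\<lambda>x y p. (if y = Q then inverse (t p) ^ j else 0) - (if x = Q then inverse (t p) ^ j else 0))"
  unfolding cocycle_def
proof (intro conjI ballI)
  let ?W = "\<lambda>x. if x = Q then U0 else C - {Q}"
  let ?r = "\<lambda>p. inverse (t p) ^ j"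
  fix x y assume xy: "x \<in> C" "y \<in> C"
  have oW: "zopen_in C (?W x)" for x
    using local_equationD(1)[OF t] open_diff_finite[OF zopen_in_self, of "{Q}"] by simp
  have o: "zopen_in C (U0 - {Q})" by (rule open_diff_finite[OF local_equationD(1)[OF t]]) simp
  have tU: "regular_on C U0 t" "\<forall>x\<in>U0. t x = 0 \<longleftrightarrow> x = Q" using t by (auto simp: local_equation_def)
  have "regular_on C (U0 - {Q}) t" by (rule regular_on_subset[OF tU(1) o]) auto
  then have r: "regular_on C (U0 - {Q}) ?r"
    by (intro regular_on_power[OF C_proj] regular_on_inverse) (use tU(2) in auto)
  show "regular_on C (?W x \<inter> ?W y) (\<lambda>p. (if y = Q then ?r p else 0) - (if x = Q then ?r p else 0))"
  proof (cases "(x = Q) = (y = Q)")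
    case True
    show ?thesis
      by (rule regular_on_cong[OF regular_on_const[OF zopen_in_Int[OF oW oW], where c = 0]]) (use True in auto)
  next
    case False
    have sub: "?W x \<inter> ?W y \<subseteq> U0 - {Q}" using False by auto
    have r': "regular_on C (?W x \<inter> ?W y) ?r"
      by (rule regular_on_subset[OF r zopen_in_Int[OF oW oW] sub])
    show ?thesis
    proof (cases "x = Q")
      case True
      then have "y \<noteq> Q" using False by simp
      show ?thesis
        by (rule regular_on_cong[OF regular_on_cmult[OF r', of "- 1"]]) (use True \<open>y \<noteq> Q\<close> in simp)
    next
      case xQ: False
      then have "y = Q" using False by simp
      show ?thesis by (rule regular_on_cong[OF r']) (use xQ \<open>y = Q\<close> in simp)
    qed
  qed
qed simp

text \<open>Only the order and the leading coefficient of the pole are recorded; the term in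
  \<open>t ^ (-1)\<close> and the regular part are absorbed into \<open>g\<close>.\<close>

theorem pole_function:
  assumes t: "local_equation C Q U0 t" and j: "j \<ge> 2"
  shows "\<exists>e g. regular_on C (C - {Q}) e \<and> reg_at C Q g \<and> g Q = 1 \<and>
    near C Q (\<lambda>x. x \<noteq> Q \<longrightarrow> e x = inverse (t x) ^ j * g x)"
proof -
  note Q = local_equationD(3)[OF t]
  obtain U F where gen: "\<And>W G. point_cover C W \<Longrightarrow> cocycle C W G \<Longrightarrow>
      \<exists>c V. point_cover C V \<and> refines C V U \<and> refines C V W \<and>
      coboundary C V (\<lambda>x y p. G x y p - c * F x y p)"
    by (rule genus_cocycle) blast
  let ?W = "\<lambda>x. if x = Q then U0 else C - {Q}"
  let ?\<gamma> = "\<lambda>j x p. if x = Q then inverse (t p) ^ j else 0"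
  have W: "point_cover C ?W"
    unfolding point_cover_def
    using local_equationD(1,2)[OF t] open_diff_finite[OF zopen_in_self, of "{Q}"] by simp
  have main: "\<exists>c V k. point_cover C V \<and> (\<forall>x\<in>C. regular_on C (V x) (k x)) \<and>
    (\<forall>x\<in>C. \<forall>y\<in>C. \<forall>p\<in>V x \<inter> V y. ?\<gamma> i y p - ?\<gamma> i x p - c * F x y p = k y p - k x p)" for i
    using gen[OF W pole_cocycle[OF t, of i]] unfolding coboundary_def by blast
  obtain c1 V1 k1 where V1: "point_cover C V1" "\<forall>x\<in>C. regular_on C (V1 x) (k1 x)"
    "\<forall>x\<in>C. \<forall>y\<in>C. \<forall>p\<in>V1 x \<inter> V1 y. ?\<gamma> 1 y p - ?\<gamma> 1 x p - c1 * F x y p = k1 y p - k1 x p"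
    using main[of 1] by (elim exE conjE)
  obtain c V k where V: "point_cover C V" "\<forall>x\<in>C. regular_on C (V x) (k x)"
    "\<forall>x\<in>C. \<forall>y\<in>C. \<forall>p\<in>V x \<inter> V y. ?\<gamma> j y p - ?\<gamma> j x p - c * F x y p = k y p - k x p"
    using main[of j] by (elim exE conjE)
  have k1Q: "reg_at C Q (k1 Q)" by (rule reg_atI[of "V1 Q"]) (use V1(2) Q point_coverD(2)[OF V1(1) Q] in auto)
  have kQ: "reg_at C Q (k Q)" by (rule reg_atI[of "V Q"]) (use V(2) Q point_coverD(2)[OF V(1) Q] in auto)
  note rt = local_equationD(4)[OF t] and tQ = local_equationD(5)[OF t] and tn = local_equationD(6)[OF t]
  \<comment> \<open>Otherwise gluing gives a function \<open>e\<close> for which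
    \<open>t * e\<close> takes the value 1 at \<open>Q\<close>. Being constant by
    \<open>simple_pole_constant\<close>, it would give the value 0.\<close>
  have "c1 \<noteq> 0"
  proof
    assume "c1 = 0"
    have "\<exists>e. regular_on C (C - {Q}) e \<and> near C Q (\<lambda>x. x \<noteq> Q \<longrightarrow> e x = inverse (t x) ^ 1 - k1 Q x)"
      by (rule glue_principal_part[OF Q V1(1)]) (use V1(2,3) \<open>c1 = 0\<close> in auto)
    then obtain e where e: "regular_on C (C - {Q}) e" "near C Q (\<lambda>x. x \<noteq> Q \<longrightarrow> e x = inverse (t x) ^ 1 - k1 Q x)"
      by blast
    have te: "near C Q (\<lambda>x. x \<noteq> Q \<longrightarrow> t x * e x = 1 - t x * k1 Q x)"
      by (rule near_mono2[OF e(2) tn]) (auto simp: right_diff_distrib)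
    have rg: "reg_at C Q (\<lambda>x. 1 - t x * k1 Q x)"
      by (intro reg_at_diff reg_at_const[OF Q] reg_at_mult rt k1Q)
    obtain a where a: "\<forall>x\<in>C - {Q}. e x = a" using simple_pole_constant[OF t e(1) rg te] by blast
    have "1 - t Q * k1 Q Q - a * t Q = 0"
    proof (rule punctured_identity[OF reg_at_diff[OF rg reg_at_cmult[OF rt]]])
      show "near C Q (\<lambda>x. x \<noteq> Q \<longrightarrow> 1 - t x * k1 Q x - a * t x = 0)"
      proof (rule near_mono2[OF te near_self[OF Q]], rule impI)
        fix x assume "x \<noteq> Q \<longrightarrow> t x * e x = 1 - t x * k1 Q x" "x \<in> C" "x \<noteq> Q"
        moreover from this have "e x = a" using a by simp
        ultimately show "1 - t x * k1 Q x - a * t x = 0" by (simp add: mult.commute)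
      qed
    qed
    then show False by (simp add: tQ)
  qed
  let ?V = "\<lambda>x. V1 x \<inter> V x"
  \<comment> \<open>The multiple of the simple principal part whose class cancels that of
    \<open>t ^ (-j)\<close>: \<open>c - ?b * c1\<close> is 0, so the generator \<open>F\<close>
    drops out.\<close>
  let ?b = "c / c1"
  let ?r = "\<lambda>x. inverse (t x) ^ j - ?b * inverse (t x)"
  let ?k = "\<lambda>x p. k x p - ?b * k1 x p"
  have "\<exists>e. regular_on C (C - {Q}) e \<and> near C Q (\<lambda>x. x \<noteq> Q \<longrightarrow> e x = ?r x - ?k Q x)"
  proof (rule glue_principal_part[OF Q])
    show pc: "point_cover C ?V"
      unfolding point_cover_def using point_coverD[OF V1(1)] point_coverD[OF V(1)] zopen_in_Int by blast
    fix x assume x: "x \<in> C"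
    note o = point_coverD(1)[OF pc x]
    have "regular_on C (?V x) (k x)" by (rule regular_on_subset[OF _ o, of "V x"]) (use V(2) x in auto)
    moreover have "regular_on C (?V x) (k1 x)"
      by (rule regular_on_subset[OF _ o, of "V1 x"]) (use V1(2) x in auto)
    ultimately show "regular_on C (?V x) (?k x)"
      by (intro regular_on_diff regular_on_cmult)
    fix y p assume y: "y \<in> C" and p: "p \<in> ?V x" "p \<in> ?V y"
    have 1: "?\<gamma> 1 y p - ?\<gamma> 1 x p - c1 * F x y p = k1 y p - k1 x p" using V1(3) x y p by blast
    have 2: "?\<gamma> j y p - ?\<gamma> j x p - c * F x y p = k y p - k x p" using V(3) x y p by blast
    have "?k y p - ?k x p = (k y p - k x p) - ?b * (k1 y p - k1 x p)" by (simp only: algebra_simps)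
    also have "\<dots> = (?\<gamma> j y p - ?\<gamma> j x p) - ?b * (?\<gamma> 1 y p - ?\<gamma> 1 x p) - (c - ?b * c1) * F x y p"
      unfolding 1[symmetric] 2[symmetric] by (simp only: algebra_simps)
    also have "c - ?b * c1 = 0" using \<open>c1 \<noteq> 0\<close> by simp
    finally have eq: "?k y p - ?k x p = (?\<gamma> j y p - ?\<gamma> j x p) - ?b * (?\<gamma> 1 y p - ?\<gamma> 1 x p) - 0 * F x y p" .
    show "(if y = Q then ?r p else 0) - (if x = Q then ?r p else 0) = ?k y p - ?k x p"
      unfolding eq by (cases "x = Q"; cases "y = Q"; simp)
  qed
  then obtain e where e: "regular_on C (C - {Q}) e" "near C Q (\<lambda>x. x \<noteq> Q \<longrightarrow> e x = ?r x - ?k Q x)" by blast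
  \<comment> \<open>The product of \<open>e\<close> with \<open>t ^ j\<close>. Its value at
    \<open>Q\<close> is 1 because \<open>j - 1\<close> is still positive, so the correction by
    \<open>t ^ (-1)\<close> does not touch the leading coefficient.\<close>
  let ?g = "\<lambda>x. 1 - ?b * t x ^ (j - 1) - t x ^ j * ?k Q x"
  have "reg_at C Q ?g"
    by (intro reg_at_diff reg_at_const[OF Q] reg_at_cmult reg_at_mult reg_at_power rt kQ k1Q)
  moreover have "?g Q = 1" using j tQ by (simp add: power_0_left)
  moreover have "near C Q (\<lambda>x. x \<noteq> Q \<longrightarrow> e x = inverse (t x) ^ j * ?g x)"
  proof (rule near_mono2[OF e(2) tn], rule impI)
    fix x assume 1: "x \<noteq> Q \<longrightarrow> e x = ?r x - ?k Q x" and 2: "x \<noteq> Q \<longrightarrow> t x \<noteq> 0" and x: "x \<noteq> Q"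
    then have t0: "t x \<noteq> 0" and ex: "e x = ?r x - ?k Q x" by auto
    obtain i where i: "j = Suc i" using j by (cases j) auto
    have a: "inverse (t x) ^ j * t x ^ j = 1" using t0 by (simp add: power_mult_distrib[symmetric])
    have b: "inverse (t x) ^ j * t x ^ (j - 1) = inverse (t x)"
      using t0 by (simp add: i power_mult_distrib[symmetric] mult.assoc)
    have "inverse (t x) ^ j * ?g x = inverse (t x) ^ j - ?b * (inverse (t x) ^ j * t x ^ (j - 1))
      - (inverse (t x) ^ j * t x ^ j) * ?k Q x"
      by (simp only: right_diff_distrib mult_1_right mult.assoc mult.left_commute)
    then show "e x = inverse (t x) ^ j * ?g x" unfolding a b ex by (simp add: algebra_simps)
  qed
  ultimately show ?thesis using e(1) by (intro exI[of _ e] exI[of _ ?g] conjI)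
qed

end

section \<open>Sections with poles at one point\<close>

lemma power_int_pred:
  fixes x :: complex
  assumes "x \<noteq> 0"
  shows "x powi (- (m - 1)) = x powi (- m) * x"
proof -
  have "x powi (- m + 1) = x powi (- m) * x" by (rule power_int_add_1[OF disjI1[OF assms]])
  then show ?thesis by (simp add: add.commute)
qed

context curve
begin

lemma local_equation_shrink:
  assumes "local_equation C p U t" "zopen_in C V" "p \<in> V" "V \<subseteq> U"
  shows "local_equation C p V t"
  unfolding local_equation_def
proof (intro conjI allI impI)
  have tU: "regular_on C U t" "\<forall>x\<in>U. t x = 0 \<longleftrightarrow> x = p" using assms(1) by (auto simp: local_equation_def)
  show "regular_on C V t" by (rule regular_on_subset[OF tU(1) assms(2,4)])
  show "\<forall>x\<in>V. (t x = 0) = (x = p)" using tU(2) assms(4) by blast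
  fix W h assume h: "zopen_in C W \<and> p \<in> W \<and> regular_on C W h \<and> h p = 0"
  with assms(1) obtain W' g where W': "zopen_in C W'" "p \<in> W'" "W' \<subseteq> U \<inter> W" "regular_on C W' g"
    "\<forall>x\<in>W'. h x = t x * g x" unfolding local_equation_def by meson
  note o = zopen_in_Int[OF W'(1) assms(2)]
  show "\<exists>W' g. zopen_in C W' \<and> p \<in> W' \<and> W' \<subseteq> V \<inter> W \<and> regular_on C W' g \<and> (\<forall>x\<in>W'. h x = t x * g x)"
    by (intro exI[of _ "W' \<inter> V"] exI[of _ g] conjI o regular_on_subset[OF W'(4) o])
      (use W' assms(3) in auto)
qed (rule assms(2,3))+

lemma reg_at_powi: "reg_at C p f \<Longrightarrow> f p \<noteq> 0 \<Longrightarrow> reg_at C p (\<lambda>x. f x powi i)"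
  unfolding power_int_def by (cases "i \<ge> 0") (simp_all add: reg_at_power reg_at_inverse)

text \<open>Sections are stored with the value 0 at \<open>P\<close> and \<open>Q\<close>, even
  where they are regular. Here \<open>e\<close> is the honest function, extended over
  \<open>P\<close> if \<open>P\<close> differs from \<open>Q\<close>, and \<open>g\<close> is its
  germ at \<open>Q\<close> after clearing the pole with one fixed local equation \<open>t\<close>;
  \<open>g Q\<close> is the leading coefficient.\<close>

definition pole_rep where
  "pole_rep P Q t m f e g \<longleftrightarrow> regular_on C (C - {Q}) e \<and> (\<forall>x. f x = (if x \<in> C - {P, Q} then e x else 0)) \<and>
    reg_at C Q g \<and> near C Q (\<lambda>x. x \<noteq> Q \<longrightarrow> e x = t x powi (- m) * g x)"

lemma pole_repD:
  assumes "pole_rep P Q t m f e g"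
  shows "regular_on C (C - {Q}) e" "f x = (if x \<in> C - {P, Q} then e x else 0)"
    "reg_at C Q g" "near C Q (\<lambda>x. x \<noteq> Q \<longrightarrow> e x = t x powi (- m) * g x)"
  using assms by (auto simp: pole_rep_def)

lemma pole_rep_imp_section:
  assumes t: "local_equation C Q U0 t" and P: "P \<in> C" and r: "pole_rep P Q t m f e g"
  shows "f \<in> sections_of C {P, Q} (point_divisor m Q)"
  unfolding sections_of_def
proof (intro CollectI conjI ballI)
  note r = pole_repD[OF r]
  have oZ: "zopen_in C (C - {P, Q})" by (rule open_diff_finite[OF zopen_in_self]) simp
  have "regular_on C (C - {P, Q}) e" by (rule regular_on_subset[OF r(1) oZ]) auto
  then show "regular_on C (C - {P, Q}) f" by (rule regular_on_cong) (simp add: r(2))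
  show "\<forall>x. x \<notin> C - {P, Q} \<longrightarrow> f x = 0" using r(2) by auto
  fix p assume p: "p \<in> {P, Q}"
  show "\<exists>U t g. local_equation C p U t \<and> regular_on C U g \<and>
    (\<forall>x\<in>U - {P, Q}. f x = t x powi (- point_divisor m Q p) * g x)"
  proof (cases "p = Q")
    case True
    obtain W where W: "zopen_in C W" "Q \<in> W" "regular_on C W g" by (rule reg_atE[OF r(3)])
    obtain V where V: "zopen_in C V" "Q \<in> V" "\<And>x. x \<in> V \<Longrightarrow> x \<noteq> Q \<longrightarrow> e x = t x powi (- m) * g x"
      by (rule nearE[OF r(4)]) blast
    let ?U = "W \<inter> V \<inter> U0"
    have o: "zopen_in C ?U" using zopen_in_Int[OF zopen_in_Int[OF W(1) V(1)] local_equationD(1)[OF t]] .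
    have le: "local_equation C Q ?U t"
      by (rule local_equation_shrink[OF t o]) (use W V local_equationD(2)[OF t] in auto)
    have rg: "regular_on C ?U g" by (rule regular_on_subset[OF W(3) o]) auto
    have eq: "\<forall>x\<in>?U - {P, Q}. f x = t x powi (- m) * g x"
    proof
      fix x assume x: "x \<in> ?U - {P, Q}"
      then have "x \<in> C - {P, Q}" using zopen_in_subset[OF o] by blast
      then have "f x = e x" by (simp add: r(2))
      also have "\<dots> = t x powi (- m) * g x" using V(3) x by blast
      finally show "f x = t x powi (- m) * g x" .
    qed
    have "point_divisor m Q p = m" using True by (simp add: point_divisor_def)
    with le rg eq show ?thesis unfolding True by (intro exI[of _ ?U] exI[of _ t] exI[of _ g]) simp
  next
    case False
    then have pP: "p = P" using p by auto
    \<comment> \<open>A section must also be described at \<open>P\<close> through some local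
      equation, although the exponent there is 0.\<close>
    obtain U1 t1 where t1: "local_equation C P U1 t1" using ex_local_equation[OF P] by blast
    let ?U = "U1 - {Q}"
    have o: "zopen_in C ?U" by (rule open_diff_finite[OF local_equationD(1)[OF t1]]) simp
    have UC: "?U \<subseteq> C" by (rule zopen_in_subset[OF o])
    have le: "local_equation C P ?U t1"
      by (rule local_equation_shrink[OF t1 o]) (use False pP local_equationD(2)[OF t1] in auto)
    have rg: "regular_on C ?U e" by (rule regular_on_subset[OF r(1) o]) (use UC in auto)
    have "\<forall>x\<in>?U - {P, Q}. f x = e x" using UC by (auto simp: r(2))
    moreover have "point_divisor m Q p = 0" using False by (simp add: point_divisor_def)
    ultimately show ?thesis using le rg unfolding pP by (intro exI[of _ ?U] exI[of _ t1] exI[of _ e]) simp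
  qed
qed

text \<open>Two adjustments: the local description at \<open>P\<close> supplies the missing value
  there, and the local equation used by the section at \<open>Q\<close> is traded for the fixed
  \<open>t\<close>, from which it differs by a unit.\<close>

lemma section_imp_pole_rep:
  assumes t: "local_equation C Q U0 t" and P: "P \<in> C" and f: "f \<in> sections_of C {P, Q} (point_divisor m Q)"
  shows "\<exists>e g. pole_rep P Q t m f e g"
proof -
  note Q = local_equationD(3)[OF t]
  have fr: "regular_on C (C - {P, Q}) f" and f0: "\<And>x. x \<notin> C - {P, Q} \<Longrightarrow> f x = 0"
    and loc: "\<And>p. p \<in> {P, Q} \<Longrightarrow> \<exists>U t g. local_equation C p U t \<and> regular_on C U g \<and>
      (\<forall>x\<in>U - {P, Q}. f x = t x powi (- point_divisor m Q p) * g x)"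
    using f unfolding sections_of_def by blast+
  obtain U1 t1 g1 where 1: "local_equation C P U1 t1" "regular_on C U1 g1"
    "\<forall>x\<in>U1 - {P, Q}. f x = t1 x powi (- point_divisor m Q P) * g1 x" using loc[of P] by auto
  obtain U2 t2 g2 where 2: "local_equation C Q U2 t2" "regular_on C U2 g2"
    "\<forall>x\<in>U2 - {P, Q}. f x = t2 x powi (- point_divisor m Q Q) * g2 x" using loc[of Q] by auto
  \<comment> \<open>At \<open>P\<close> the exponent is 0, so \<open>g1\<close> itself continues
    \<open>f\<close>. If \<open>P = Q\<close> nothing has to be filled in.\<close>
  define e where "e = (\<lambda>x. if x = P \<and> P \<noteq> Q then g1 P else f x)"
  have "regular_on C (C - {Q}) e"
  proof (rule regular_onI)
    show "zopen_in C (C - {Q})" by (rule open_diff_finite[OF zopen_in_self]) simp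
    fix p assume p: "p \<in> C - {Q}"
    show "reg_at C p e"
    proof (cases "p = P")
      case True
      have "reg_at C P g1" by (rule reg_atI[OF 1(2) local_equationD(2)[OF 1(1)]])
      moreover have "near C P (\<lambda>x. g1 x = e x)"
      proof (rule near_mono2[OF near_neq[OF P, of Q] nearI[OF local_equationD(1,2)[OF 1(1)]]])
        show "P \<noteq> Q" using p True by auto
        show "x \<in> U1 \<Longrightarrow> x \<in> U1" for x .
        fix x assume x: "x \<noteq> Q" "x \<in> U1"
        show "g1 x = e x"
        proof (cases "x = P")
          case True
          then show ?thesis using \<open>P \<noteq> Q\<close> by (simp add: e_def)
        next
          case False
          then have "f x = t1 x powi (- point_divisor m Q P) * g1 x" using 1(3) x by simp
          then show ?thesis using \<open>P \<noteq> Q\<close> False by (simp add: e_def point_divisor_def)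
        qed
      qed
      ultimately show ?thesis unfolding True by (rule reg_at_cong)
    next
      case False
      have "reg_at C p f" by (rule reg_atI[OF fr]) (use p False in auto)
      then show ?thesis
        by (rule reg_at_cong) (rule near_mono[OF near_neq[OF _ False]], use p in \<open>auto simp: e_def\<close>)
    qed
  qed
  moreover have "\<forall>x. f x = (if x \<in> C - {P, Q} then e x else 0)" using f0 by (auto simp: e_def)
  moreover obtain s where s: "reg_at C Q s" "near C Q (\<lambda>x. t2 x = t x * s x)"
    using local_equationD(7)[OF t local_equationD(4,5)[OF 2(1)]] by blast
  obtain s' where s': "reg_at C Q s'" "near C Q (\<lambda>x. t x = t2 x * s' x)"
    using local_equationD(7)[OF 2(1) local_equationD(4,5)[OF t]] by blast
  \<comment> \<open>The two local equations divide each other, so the quotients are mutually inverse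
    off \<open>Q\<close>, and by the identity principle also at \<open>Q\<close>; hence
    \<open>s\<close> is a unit.\<close>
  have "s Q * s' Q - 1 = 0"
  proof (rule punctured_identity[OF reg_at_diff[OF reg_at_mult[OF s(1) s'(1)] reg_at_const[OF Q]]])
    show "near C Q (\<lambda>x. x \<noteq> Q \<longrightarrow> s x * s' x - 1 = 0)"
    proof (rule near_mono2[OF near_conj[OF s(2) s'(2)] local_equationD(6)[OF t]], rule impI)
      fix x assume a: "t2 x = t x * s x \<and> t x = t2 x * s' x" and b: "x \<noteq> Q \<longrightarrow> t x \<noteq> 0" "x \<noteq> Q"
      then have "t x * (s x * s' x) = t x * 1" by (metis mult.assoc mult_1_right)
      then show "s x * s' x - 1 = 0" using b by simp
    qed
  qed
  then have sQ: "s Q \<noteq> 0" by auto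
  have g2: "reg_at C Q g2" by (rule reg_atI[OF 2(2) local_equationD(2)[OF 2(1)]])
  define g where "g = (\<lambda>x. s x powi (- m) * g2 x)"
  have g: "reg_at C Q g" unfolding g_def by (rule reg_at_mult[OF reg_at_powi[OF s(1) sQ] g2])
  have nP: "near C Q (\<lambda>x. x \<noteq> Q \<longrightarrow> x \<noteq> P)"
  proof (cases "P = Q")
    case True
    then show ?thesis by (intro near_mono[OF near_self[OF Q]]) simp
  next
    case False
    then show ?thesis by (intro near_mono[OF near_neq[OF Q, of P]]) auto
  qed
  have "near C Q (\<lambda>x. x \<in> U2)" by (rule nearI[OF local_equationD(1,2)[OF 2(1)]])
  then have "near C Q (\<lambda>x. x \<noteq> Q \<longrightarrow> e x = t x powi (- m) * g x)"
  proof (rule near_mono2[OF near_conj[OF nP s(2)]], intro impI)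
    fix x assume a: "(x \<noteq> Q \<longrightarrow> x \<noteq> P) \<and> t2 x = t x * s x" and x: "x \<in> U2" "x \<noteq> Q"
    then have "e x = f x" by (simp add: e_def)
    also have "\<dots> = t2 x powi (- m) * g2 x" using 2(3) a x by (simp add: point_divisor_def)
    also have "\<dots> = t x powi (- m) * g x" using a by (simp add: g_def power_int_mult_distrib mult.assoc)
    finally show "e x = t x powi (- m) * g x" .
  qed
  with calculation g show ?thesis unfolding pole_rep_def by blast
qed

lemma pole_rep_combine:
  assumes Q: "Q \<in> C" and "pole_rep P Q t m f e g" "pole_rep P Q t m f' e' g'"
  shows "pole_rep P Q t m (f + c *\<^sub>C f') (\<lambda>x. e x + c * e' x) (\<lambda>x. g x + c * g' x)"
  unfolding pole_rep_def
proof (intro conjI allI)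
  note r = pole_repD[OF assms(2)] and r' = pole_repD[OF assms(3)]
  show "regular_on C (C - {Q}) (\<lambda>x. e x + c * e' x)"
    by (intro regular_on_add regular_on_cmult r(1) r'(1))
  show "(f + c *\<^sub>C f') x = (if x \<in> C - {P, Q} then e x + c * e' x else 0)" for x
    using r(2)[of x] r'(2)[of x] by (simp add: cscale_complex)
  show "reg_at C Q (\<lambda>x. g x + c * g' x)" by (intro reg_at_add reg_at_cmult r(3) r'(3))
  show "near C Q (\<lambda>x. x \<noteq> Q \<longrightarrow> e x + c * e' x = t x powi (- m) * (g x + c * g' x))"
    by (rule near_mono2[OF r(4) r'(4)]) (auto simp: algebra_simps)
qed

lemma pole_rep_zero: "Q \<in> C \<Longrightarrow> pole_rep P Q t m 0 (\<lambda>_. 0) (\<lambda>_. 0)"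
  unfolding pole_rep_def
  by (intro conjI regular_on_const open_diff_finite[OF zopen_in_self] reg_at_const near_mono[OF near_self]) auto

text \<open>A germ \<open>g\<close> vanishing at \<open>Q\<close> is divisible by \<open>t\<close>,
  which lowers the pole order by one.\<close>

lemma pole_rep_lower:
  assumes t: "local_equation C Q U0 t" and r: "pole_rep P Q t m f e g" "g Q = 0"
  shows "\<exists>g'. pole_rep P Q t (m - 1) f e g'"
proof -
  note r' = pole_repD[OF r(1)]
  obtain g' where g': "reg_at C Q g'" "near C Q (\<lambda>x. g x = t x * g' x)"
    using local_equationD(7)[OF t r'(3) r(2)] by blast
  have "near C Q (\<lambda>x. x \<noteq> Q \<longrightarrow> e x = t x powi (- (m - 1)) * g' x)"
  proof (rule near_mono2[OF near_conj[OF r'(4) g'(2)] local_equationD(6)[OF t]], rule impI)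
    fix x assume a: "(x \<noteq> Q \<longrightarrow> e x = t x powi (- m) * g x) \<and> g x = t x * g' x" "x \<noteq> Q \<longrightarrow> t x \<noteq> 0" "x \<noteq> Q"
    then have "t x \<noteq> 0" by simp
    with a show "e x = t x powi (- (m - 1)) * g' x"
      by (simp only: power_int_pred mult.assoc simp_thms)
  qed
  then have "pole_rep P Q t (m - 1) f e g'" using r'(1,2) g'(1) unfolding pole_rep_def by blast
  then show ?thesis by (rule exI[of _ g'])
qed

lemma pole_rep_raise:
  assumes t: "local_equation C Q U0 t" and r: "pole_rep P Q t (m - 1) f e g"
  shows "pole_rep P Q t m f e (\<lambda>x. t x * g x)"
  unfolding pole_rep_def
proof (intro conjI allI)
  note r' = pole_repD[OF r]
  show "near C Q (\<lambda>x. x \<noteq> Q \<longrightarrow> e x = t x powi (- m) * (t x * g x))"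
  proof (rule near_mono2[OF r'(4) local_equationD(6)[OF t]], rule impI)
    fix x assume a: "x \<noteq> Q \<longrightarrow> e x = t x powi (- (m - 1)) * g x" "x \<noteq> Q \<longrightarrow> t x \<noteq> 0" "x \<noteq> Q"
    then have "t x \<noteq> 0" by simp
    with a show "e x = t x powi (- m) * (t x * g x)"
      by (simp only: power_int_pred mult.assoc simp_thms)
  qed
qed (use pole_repD[OF r] local_equationD(4)[OF t] in \<open>auto intro: reg_at_mult\<close>)

text \<open>The leading coefficient depends on the section alone. Together with lowering and
  raising, it describes the quotient of two successive steps of the filtration by pole
  order.\<close>

lemma pole_rep_leading_unique:
  assumes t: "local_equation C Q U0 t" and r: "pole_rep P Q t m f e g" "pole_rep P Q t m f e' g'"
  shows "g Q = g' Q"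
proof -
  note Q = local_equationD(3)[OF t] and r1 = pole_repD[OF r(1)] and r2 = pole_repD[OF r(2)]
  have nP: "near C Q (\<lambda>x. x \<noteq> Q \<longrightarrow> x \<in> C - {P, Q})"
  proof (cases "P = Q")
    case True
    then show ?thesis by (intro near_mono[OF near_self[OF Q]]) simp
  next
    case False
    show ?thesis by (rule near_mono2[OF near_self[OF Q] near_neq[OF Q False[symmetric]]]) simp
  qed
  have "g Q - g' Q = 0"
  proof (rule punctured_identity[OF reg_at_diff[OF r1(3) r2(3)]])
    show "near C Q (\<lambda>x. x \<noteq> Q \<longrightarrow> g x - g' x = 0)"
    proof (rule near_mono2[OF near_conj[OF nP local_equationD(6)[OF t]] near_conj[OF r1(4) r2(4)]], rule impI)
      fix x assume a: "(x \<noteq> Q \<longrightarrow> x \<in> C - {P, Q}) \<and> (x \<noteq> Q \<longrightarrow> t x \<noteq> 0)"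
        "(x \<noteq> Q \<longrightarrow> e x = t x powi (- m) * g x) \<and> (x \<noteq> Q \<longrightarrow> e' x = t x powi (- m) * g' x)" "x \<noteq> Q"
      have "e x = e' x" using r1(2)[of x] r2(2)[of x] a by simp
      then have "t x powi (- m) * g x = t x powi (- m) * g' x" using a by simp
      then show "g x - g' x = 0" using a by (simp add: power_int_eq_0_iff)
    qed
  qed
  then show ?thesis by simp
qed

lemma sections_subspace:
  assumes P: "P \<in> C" and Q: "Q \<in> C"
  shows "cvec.subspace (sections_of C {P, Q} (point_divisor m Q))"
proof -
  let ?L = "sections_of C {P, Q} (point_divisor m Q)"
  obtain U0 t where t: "local_equation C Q U0 t" using ex_local_equation[OF Q] by blast
  have comb: "f + c *\<^sub>C f' \<in> ?L" if ff: "f \<in> ?L" "f' \<in> ?L" for f f' c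
  proof -
    from section_imp_pole_rep[OF t P ff(1)] section_imp_pole_rep[OF t P ff(2)]
    obtain e g e' g' where "pole_rep P Q t m f e g" "pole_rep P Q t m f' e' g'" by blast
    from pole_rep_imp_section[OF t P pole_rep_combine[OF Q this]] show ?thesis .
  qed
  have zero: "0 \<in> ?L" by (rule pole_rep_imp_section[OF t P pole_rep_zero[OF Q]])
  show ?thesis unfolding cvec.subspace_def
    using zero comb[of _ _ 1] comb[OF zero] by simp
qed

definition const_section :: "(nat \<Rightarrow> complex) set \<Rightarrow> (nat \<Rightarrow> complex) set \<Rightarrow> complex \<Rightarrow> (nat \<Rightarrow> complex) set \<Rightarrow> complex"
  where "const_section P Q c = (\<lambda>x. if x \<in> C - {P, Q} then c else 0)"

lemma const_section_in:
  assumes P: "P \<in> C" and Q: "Q \<in> C" and m: "m \<ge> 0"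
  shows "const_section P Q c \<in> sections_of C {P, Q} (point_divisor m Q)"
proof -
  obtain U0 t where t: "local_equation C Q U0 t" using ex_local_equation[OF Q] by blast
  have "pole_rep P Q t m (const_section P Q c) (\<lambda>_. c) (\<lambda>x. c * t x ^ nat m)"
    unfolding pole_rep_def
  proof (intro conjI allI)
    show "near C Q (\<lambda>x. x \<noteq> Q \<longrightarrow> c = t x powi (- m) * (c * t x ^ nat m))"
    proof (rule near_mono[OF local_equationD(6)[OF t]], rule impI)
      fix x assume "x \<noteq> Q \<longrightarrow> t x \<noteq> 0" "x \<noteq> Q"
      then show "c = t x powi (- m) * (c * t x ^ nat m)"
        using m by (simp add: power_int_minus) (simp add: power_int_def)
    qed
    show "reg_at C Q (\<lambda>x. c * t x ^ nat m)"
      by (intro reg_at_cmult reg_at_power local_equationD(4)[OF t])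
    show "regular_on C (C - {Q}) (\<lambda>_. c)"
      by (intro regular_on_const open_diff_finite[OF zopen_in_self]) simp
  qed (simp add: const_section_def)
  then show ?thesis by (rule pole_rep_imp_section[OF t P])
qed

lemma ex_generic_point: "\<exists>x. x \<in> C - {P, Q}"
proof -
  have "infinite (C - {P, Q})" using C_infinite by simp
  then show ?thesis by (metis finite.emptyI ex_in_conv)
qed

lemma const_section_span: "range (const_section P Q) = cvec.span {const_section P Q 1}"
proof -
  have "const_section P Q c = c *\<^sub>C const_section P Q 1" for c
    by (simp add: const_section_def fun_eq_iff cscale_complex)
  then show ?thesis unfolding cvec.span_singleton by (intro image_cong refl)
qed

lemma const_section_nonzero: "const_section P Q 1 \<noteq> 0"
proof -
  obtain x where "x \<in> C - {P, Q}" using ex_generic_point by blast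
  then have "const_section P Q 1 x = 1" by (simp add: const_section_def)
  then show ?thesis by (metis zero_fun_def zero_neq_one)
qed

end

context elliptic
begin

text \<open>Multiplying by \<open>t\<close> leaves \<open>t ^ (1 - m) * g\<close>, which is regular
  because \<open>m\<close> is at most 1, so \<open>simple_pole_constant\<close> applies. For
  negative \<open>m\<close> the constant equals \<open>t ^ (-m) * g\<close> near \<open>Q\<close>
  and hence vanishes.\<close>

lemma section_const:
  assumes P: "P \<in> C" and Q: "Q \<in> C" and m: "m \<le> 1" and f: "f \<in> sections_of C {P, Q} (point_divisor m Q)"
  shows "\<exists>c. f = const_section P Q c \<and> (m < 0 \<longrightarrow> c = 0)"
proof -
  obtain U0 t where t: "local_equation C Q U0 t" using ex_local_equation[OF Q] by blast
  obtain e g where r: "pole_rep P Q t m f e g" using section_imp_pole_rep[OF t P f] by blast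
  note r' = pole_repD[OF r]
  have reg: "reg_at C Q (\<lambda>x. t x ^ k * g x)" for k
    by (intro reg_at_mult reg_at_power local_equationD(4)[OF t] r'(3))
  have "near C Q (\<lambda>x. x \<noteq> Q \<longrightarrow> t x * e x = t x ^ nat (1 - m) * g x)"
  proof (rule near_mono2[OF r'(4) local_equationD(6)[OF t]], rule impI)
    fix x assume a: "x \<noteq> Q \<longrightarrow> e x = t x powi (- m) * g x" "x \<noteq> Q \<longrightarrow> t x \<noteq> 0" "x \<noteq> Q"
    then have "t x \<noteq> 0" by simp
    from power_int_pred[OF this, of m] have "t x * t x powi (- m) = t x powi (- (m - 1))" by (simp only: mult.commute)
    also have "\<dots> = t x ^ nat (1 - m)" using m by (simp add: power_int_def)
    finally show "t x * e x = t x ^ nat (1 - m) * g x" using a by (simp add: mult.assoc[symmetric])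
  qed
  from simple_pole_constant[OF t r'(1) reg this] obtain c where c: "\<forall>x\<in>C - {Q}. e x = c" by blast
  have "f = const_section P Q c" unfolding const_section_def using r'(2) c by auto
  moreover have "c = 0" if m0: "m < 0"
  proof -
    have "c - t Q ^ nat (- m) * g Q = 0"
    proof (rule punctured_identity[OF reg_at_diff[OF reg_at_const[OF Q] reg]])
      show "near C Q (\<lambda>x. x \<noteq> Q \<longrightarrow> c - t x ^ nat (- m) * g x = 0)"
      proof (rule near_mono2[OF r'(4) near_self[OF Q]], rule impI)
        fix x assume "x \<noteq> Q \<longrightarrow> e x = t x powi (- m) * g x" "x \<in> C" "x \<noteq> Q"
        moreover from this have "e x = c" using c by blast
        ultimately show "c - t x ^ nat (- m) * g x = 0" using m0 by (simp add: power_int_def)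
      qed
    qed
    then show ?thesis using m0 local_equationD(5)[OF t] by (simp add: power_0_left)
  qed
  ultimately show ?thesis by blast
qed

text \<open>Order 1 allows only constants. Passing from order \<open>m\<close> to
  \<open>m + 1\<close> adds exactly one dimension: the leading coefficient detects it, and the
  function with pole of order \<open>m + 1\<close>, at least 2, realizes it.\<close>

theorem sections_basis:
  assumes P: "P \<in> C" and Q: "Q \<in> C" and "m \<ge> 1"
  shows "\<exists>B. finite B \<and> card B = m \<and> cvec.independent B \<and>
    cvec.span B = sections_of C {P, Q} (point_divisor (int m) Q)"
  using assms(3)
proof (induction m rule: dec_induct)
  case base
  have "sections_of C {P, Q} (point_divisor (int 1) Q) = range (const_section P Q)"
    using section_const[OF P Q, of 1] const_section_in[OF P Q, of 1] by auto
  then have sp: "cvec.span {const_section P Q 1} = sections_of C {P, Q} (point_divisor (int 1) Q)"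
    by (simp only: const_section_span)
  show ?case
  proof (intro exI conjI)
    show "finite {const_section P Q 1}" "card {const_section P Q 1} = 1" by simp_all
    show "cvec.independent {const_section P Q 1}"
      using const_section_nonzero by (simp only: cvec.dependent_single not_False_eq_True)
  qed (rule sp)
next
  case (step m)
  then obtain B where B: "finite B" "card B = m" "cvec.independent B"
    "cvec.span B = sections_of C {P, Q} (point_divisor (int m) Q)" by blast
  let ?L = "\<lambda>m. sections_of C {P, Q} (point_divisor m Q)"
  let ?m = "int (Suc m)"
  obtain U0 t where t: "local_equation C Q U0 t" using ex_local_equation[OF Q] by blast
  obtain e1 g1 where e1: "regular_on C (C - {Q}) e1" "reg_at C Q g1" "g1 Q = 1"
    "near C Q (\<lambda>x. x \<noteq> Q \<longrightarrow> e1 x = inverse (t x) ^ Suc m * g1 x)"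
    using pole_function[OF t, of "Suc m"] step(1) by auto
  define f1 where "f1 = (\<lambda>x. if x \<in> C - {P, Q} then e1 x else 0)"
  have "t x powi (- ?m) = inverse (t x) ^ Suc m" for x
    by (simp only: power_int_minus power_int_of_nat power_inverse)
  then have r1: "pole_rep P Q t ?m f1 e1 g1"
    unfolding pole_rep_def using e1 by (simp only: f1_def simp_thms)
  have f1: "f1 \<in> ?L ?m" by (rule pole_rep_imp_section[OF t P r1])
  have m1: "?m - 1 = int m" by simp
  \<comment> \<open>A section of lower order, viewed in order \<open>m + 1\<close>, has
    \<open>t * g\<close> as its germ and thus leading coefficient 0, while that of \<open>f1\<close>
    is 1.\<close>
  have f1_notin: "f1 \<notin> ?L (int m)"
  proof
    assume "f1 \<in> ?L (int m)"
    then obtain e g where "pole_rep P Q t (?m - 1) f1 e g"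
      unfolding m1 using section_imp_pole_rep[OF t P] by blast
    from pole_rep_leading_unique[OF t r1 pole_rep_raise[OF t this]]
    show False using e1(3) local_equationD(5)[OF t] by simp
  qed
  have mono: "?L (int m) \<subseteq> ?L ?m"
  proof
    fix f assume "f \<in> ?L (int m)"
    then obtain e g where "pole_rep P Q t (?m - 1) f e g"
      unfolding m1 using section_imp_pole_rep[OF t P] by blast
    from pole_rep_imp_section[OF t P pole_rep_raise[OF t this]] show "f \<in> ?L ?m" .
  qed
  have sp: "cvec.span (insert f1 B) = ?L ?m"
  proof
    have "insert f1 B \<subseteq> ?L ?m" using f1 mono B(4) cvec.span_superset[of B] by blast
    then show "cvec.span (insert f1 B) \<subseteq> ?L ?m" by (rule cvec.span_minimal[OF _ sections_subspace[OF P Q]])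
    show "?L ?m \<subseteq> cvec.span (insert f1 B)"
    proof
      fix f assume "f \<in> ?L ?m"
      then obtain e g where r: "pole_rep P Q t ?m f e g" using section_imp_pole_rep[OF t P] by blast
      \<comment> \<open>Since \<open>g1 Q\<close> is 1, subtracting \<open>g Q\<close> times
        \<open>f1\<close> removes the leading coefficient and leaves a section of order
        \<open>m\<close>.\<close>
      have "g Q + - g Q * g1 Q = 0" using e1(3) by simp
      from pole_rep_lower[OF t pole_rep_combine[OF Q r r1] this]
      obtain e' g' where "pole_rep P Q t (?m - 1) (f + (- g Q) *\<^sub>C f1) e' g'" by blast
      then have "f + (- g Q) *\<^sub>C f1 \<in> cvec.span B"
        unfolding m1 B(4) by (rule pole_rep_imp_section[OF t P])
      then show "f \<in> cvec.span (insert f1 B)"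
        unfolding cvec.span_insert
        by (intro CollectI exI[of _ "g Q"]) (simp only: cvec.scale_minus_left add_uminus_conv_diff)
    qed
  qed
  have nsp: "f1 \<notin> cvec.span B" using f1_notin B(4) by blast
  then have nB: "f1 \<notin> B" using cvec.span_base by blast
  show ?case
  proof (intro exI conjI)
    show "finite (insert f1 B)" "card (insert f1 B) = Suc m" using B(1,2) nB by simp_all
    show "cvec.independent (insert f1 B)" by (rule cvec.independent_insertI[OF nsp B(3)])
  qed (rule sp)
qed

end

section \<open>Linear isomorphisms of projective spaces\<close>

lemma proj_image:
  assumes A: "clin A" and inj: "\<forall>v\<in>V. A v = 0 \<longrightarrow> v = 0" and V: "A ` V \<subseteq> V'" "cvec.subspace V'"
    and L: "L \<in> proj V"
  shows "A ` L \<in> proj V'"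
proof -
  have LV: "L \<subseteq> V" using L by (simp add: proj_def)
  have nz: "A (rep L) \<noteq> 0" using inj LV rep_in[OF L] rep_nonzero[OF L] by blast
  have "A (rep L) \<in> V'" using V(1) LV rep_in[OF L] by blast
  from span_in_proj[OF V(2) this nz] have "cvec.span {A (rep L)} \<in> proj V'" .
  moreover have "A ` L = cvec.span {A (rep L)}"
  proof -
    have "A ` cvec.span {rep L} = cvec.span (A ` {rep L})" by (rule cvp.linear_span_image[OF A, symmetric])
    moreover have "cvec.span {rep L} = L" by (rule proj_eq_span[OF L rep_in[OF L] rep_nonzero[OF L], symmetric])
    ultimately show ?thesis by (simp only: image_insert image_empty)
  qed
  ultimately show "A ` L \<in> proj V'" by (simp only:)
qed

text \<open>Homogeneous polynomials, and with them closed sets and quotients, pull back along a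
  linear map of the whole type. Injectivity on \<open>V\<close> sends nonzero vectors of a line to
  nonzero vectors, so image lines exist and denominators stay nonzero.\<close>

lemma morphism_image:
  fixes A :: "'v::cvector \<Rightarrow> 'w::cvector"
  assumes A: "clin A" and inj: "\<forall>v\<in>V. A v = 0 \<longrightarrow> v = 0" and V: "A ` V \<subseteq> V'" "cvec.subspace V'"
  shows "morphism (proj V) (proj V') (\<lambda>L. A ` L)"
proof -
  note im = proj_image[OF A inj V]
  have vanish: "F (rep (A ` L)) = 0 \<longleftrightarrow> F (A (rep L)) = 0" if F: "F \<in> hom_poly d" and L: "L \<in> proj V" for F d L
  proof -
    have "F (rep (A ` L)) = 0 \<longleftrightarrow> (\<forall>v\<in>A ` L. F v = 0)"
      by (rule hom_poly_vanish_iff[OF F proj_mono_UNIV[OF im[OF L]], symmetric])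
    also have "\<dots> \<longleftrightarrow> (\<forall>u\<in>L. F (A u) = 0)" by blast
    also have "\<dots> \<longleftrightarrow> F (A (rep L)) = 0"
      by (rule hom_poly_vanish_iff[OF hom_poly_compose[OF F A] proj_mono_UNIV[OF L]])
    finally show ?thesis .
  qed
  have opn: "zopen_in (proj V) {x \<in> proj V. A ` x \<in> U}" if U: "zopen_in (proj V') U" for U
  proof -
    obtain Z where Z: "zclosed Z" "U = proj V' - Z" using U by (auto simp: zopen_in_def)
    from Z(1)[unfolded zclosed_iff] obtain S where S: "S \<subseteq> (\<Union>d. hom_poly d)"
      and Zeq: "Z = {L \<in> proj UNIV. \<forall>F\<in>S. F (rep L) = 0}" by (elim exE conjE)
    let ?Z = "{L \<in> proj UNIV. \<forall>F\<in>S. F (A (rep L)) = 0}"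
    have "zclosed ?Z" unfolding zclosed_iff
    proof (intro exI conjI)
      show "(\<lambda>F v. F (A v)) ` S \<subseteq> (\<Union>d. hom_poly d)"
      proof
        fix K assume "K \<in> (\<lambda>F v. F (A v)) ` S"
        then obtain F where F: "F \<in> S" "K = (\<lambda>v. F (A v))" by (elim imageE)
        obtain d where d: "F \<in> hom_poly d" using S F(1) by blast
        show "K \<in> (\<Union>d. hom_poly d)" unfolding F(2) by (rule UN_I[of d, OF UNIV_I]) (rule hom_poly_compose[OF d A])
      qed
      show "?Z = {L \<in> proj UNIV. \<forall>K\<in>(\<lambda>F v. F (A v)) ` S. K (rep L) = 0}" by (simp only: ball_simps)
    qed
    moreover have "{x \<in> proj V. A ` x \<in> U} = proj V - ?Z"
    proof (intro set_eqI)
      fix L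
      have "A ` L \<in> U \<longleftrightarrow> \<not> (\<forall>F\<in>S. F (A (rep L)) = 0)" if L: "L \<in> proj V"
      proof -
        have "A ` L \<in> Z \<longleftrightarrow> (\<forall>F\<in>S. F (rep (A ` L)) = 0)"
          unfolding Zeq using proj_mono_UNIV[OF im[OF L]] by simp
        also have "\<dots> \<longleftrightarrow> (\<forall>F\<in>S. F (A (rep L)) = 0)"
        proof (rule ball_cong[OF refl])
          fix F assume "F \<in> S"
          then obtain d where "F \<in> hom_poly d" using S by blast
          then show "F (rep (A ` L)) = 0 \<longleftrightarrow> F (A (rep L)) = 0" by (rule vanish[OF _ L])
        qed
        finally show ?thesis unfolding Z(2) using im[OF L] by blast
      qed
      then show "L \<in> {x \<in> proj V. A ` x \<in> U} \<longleftrightarrow> L \<in> proj V - ?Z" using proj_mono_UNIV by auto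
    qed
    ultimately show ?thesis by (rule zopen_inI)
  qed
  have reg: "regular_on (proj V) {x \<in> proj V. A ` x \<in> U} (f \<circ> (\<lambda>L. A ` L))"
    if f: "regular_on (proj V') U f" for U f
    unfolding regular_on_iff
  proof
    fix L assume L: "L \<in> {x \<in> proj V. A ` x \<in> U}"
    then obtain W where W: "zopen_in (proj V') W" "A ` L \<in> W" "W \<subseteq> U" "ratio_on W f"
      using f unfolding regular_on_iff by blast
    obtain d G H where GH: "G \<in> hom_poly d" "H \<in> hom_poly d"
      "\<forall>M\<in>W. \<forall>v\<in>M - {0}. H v \<noteq> 0 \<and> f M = G v / H v" using ratio_onE[OF W(4)] .
    have "ratio_on {x \<in> proj V. A ` x \<in> W} (f \<circ> (\<lambda>L. A ` L))"
    proof (rule ratio_onI[OF hom_poly_compose[OF GH(1) A] hom_poly_compose[OF GH(2) A]])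
      fix M v assume M: "M \<in> {x \<in> proj V. A ` x \<in> W}" and v: "v \<in> M - {0}"
      have "v \<in> V" using M v by (auto simp: proj_def)
      then have "A v \<in> A ` M - {0}" using inj v by blast
      then show "H (A v) \<noteq> 0 \<and> (f \<circ> (\<lambda>L. A ` L)) M = G (A v) / H (A v)"
        using GH(3) M unfolding o_apply by blast
    qed
    then show "\<exists>W. zopen_in (proj V) W \<and> L \<in> W \<and> W \<subseteq> {x \<in> proj V. A ` x \<in> U} \<and>
      ratio_on W (f \<circ> (\<lambda>L. A ` L))"
      using L W(2,3) by (intro exI[of _ "{x \<in> proj V. A ` x \<in> W}"] conjI opn[OF W(1)]) auto
  qed
  show ?thesis unfolding morphism_def
    using im opn reg by (intro conjI allI impI) auto
qed

text \<open>Coordinates with respect to \<open>B\<close> extend to some linear map \<open>A\<close>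
  of the whole type. It is inverse to \<open>A'\<close> only between the span of \<open>B\<close>
  and the coordinate space, which is all that the induced maps on lines see.\<close>

lemma isomorphic_projective_space:
  fixes B :: "'v::cvector set"
  assumes B: "finite B" "cvec.independent B" "card B = Suc n"
  shows "isomorphic_varieties (proj (cvec.span B)) (projective_space n)"
proof -
  let ?V = "cvec.span B" and ?W = "{x :: nat \<Rightarrow> complex. \<forall>i>n. x i = 0}"
  let ?e = "\<lambda>i j :: nat. if j = i then 1 else 0 :: complex"
  obtain h where h: "bij_betw h {..n} B"
    using ex_bij_betw_nat_finite[OF B(1)] unfolding B(3) atLeast0LessThan lessThan_Suc_atMost by blast
  obtain A :: "'v \<Rightarrow> nat \<Rightarrow> complex" where A: "clin A" "\<forall>b\<in>B. A b = ?e (inv_into {..n} h b)"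
    using cvp.linear_independent_extend[OF B(2), of "\<lambda>b. ?e (inv_into {..n} h b)"] by blast
  define A' where "A' = (\<lambda>x :: nat \<Rightarrow> complex. \<Sum>i\<le>n. x i *\<^sub>C h i)"
  have A': "clin A'"
    unfolding A'_def
    by (intro clinI) (simp_all add: cscale_add_left sum.distrib cvec.scale_sum_right cscale_cscale cscale_complex)
  have Ah: "A (h i) = ?e i" if "i \<le> n" for i
  proof -
    have "h i \<in> B" using h that by (auto simp: bij_betw_def)
    moreover have "inv_into {..n} h (h i) = i" using bij_betw_inv_into_left[OF h] that by simp
    ultimately show ?thesis using A(2) by simp
  qed
  have A'e: "A' (?e i) = h i" if "i \<le> n" for i
    unfolding A'_def using that by (simp add: if_distrib[of "\<lambda>c. c *\<^sub>C _"] cong: if_cong)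
  have sV: "cvec.subspace ?V" by (rule cvec.subspace_span)
  have sW: "cvec.subspace ?W" unfolding cvec.subspace_def by (simp add: cscale_complex)
  have id1: "A' (A v) = v" if "v \<in> ?V" for v
  proof -
    have "A' (A b) = b" if b: "b \<in> B" for b
    proof -
      obtain i where "i \<le> n" "b = h i" using b h by (auto simp: bij_betw_def)
      then show ?thesis using Ah A'e by simp
    qed
    moreover have "clin (\<lambda>v :: 'v. v)" by (intro clinI) simp_all
    ultimately show ?thesis
      using cvp.linear_eq_on_span[OF clin_compose[OF A' A(1)] _ _ that, of "\<lambda>v. v"] by blast
  qed
  have id2: "A (A' x) = x" if x: "x \<in> ?W" for x
  proof -
    have "A (A' x) = (\<Sum>i\<le>n. x i *\<^sub>C A (h i))"
      unfolding A'_def by (subst clinD(5)[OF A(1)]) (simp only: clinD(2)[OF A(1)])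
    also have "\<dots> = (\<Sum>i\<le>n. x i *\<^sub>C ?e i)" by (rule sum.cong[OF refl]) (simp add: Ah)
    also have "\<dots> = x" by (rule vanishing_coords_sum[symmetric]) (use x in simp)
    finally show ?thesis .
  qed
  have AV: "A ` ?V \<subseteq> ?W"
  proof -
    have "A ` ?V = cvec.span (A ` B)" by (rule cvp.linear_span_image[OF A(1), symmetric])
    also have "\<dots> \<subseteq> ?W"
    proof (rule cvec.span_minimal[OF _ sW])
      show "A ` B \<subseteq> ?W"
      proof
        fix y assume "y \<in> A ` B"
        then obtain i where "i \<le> n" "y = A (h i)" using h by (auto simp: bij_betw_def)
        then show "y \<in> ?W" by (simp add: Ah)
      qed
    qed
    finally show ?thesis .
  qed
  have A'W: "A' ` ?W \<subseteq> ?V"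
  proof
    fix y assume "y \<in> A' ` ?W"
    then obtain x where y: "y = A' x" by blast
    have "h i \<in> B" if "i \<in> {..n}" for i using h that by (auto simp: bij_betw_def)
    then show "y \<in> ?V" unfolding y A'_def by (intro cvec.span_sum cvec.span_scale cvec.span_base)
  qed
  have "morphism (proj ?V) (proj ?W) (\<lambda>L. A ` L)"
  proof (rule morphism_image[OF A(1) _ AV sW], intro ballI impI)
    fix v assume "v \<in> ?V" "A v = 0"
    then show "v = 0" using id1[of v] clinD(3)[OF A'] by metis
  qed
  moreover have "morphism (proj ?W) (proj ?V) (\<lambda>L. A' ` L)"
  proof (rule morphism_image[OF A' _ A'W sV], intro ballI impI)
    fix v assume "v \<in> ?W" "A' v = 0"
    then show "v = 0" using id2[of v] clinD(3)[OF A(1)] by metis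
  qed
  moreover have "\<forall>x\<in>proj ?V. A' ` (A ` x) = x"
  proof
    fix L assume "L \<in> proj ?V"
    then have "L \<subseteq> ?V" by (simp add: proj_def)
    then have "(\<lambda>v. A' (A v)) ` L = (\<lambda>v. v) ` L" by (intro image_cong refl id1) blast
    then show "A' ` (A ` L) = L" by (simp add: image_image)
  qed
  moreover have "\<forall>y\<in>proj ?W. A ` (A' ` y) = y"
  proof
    fix L assume "L \<in> proj ?W"
    then have "L \<subseteq> ?W" by (simp add: proj_def)
    then have "(\<lambda>v. A (A' v)) ` L = (\<lambda>v. v) ` L" by (intro image_cong refl id2) blast
    then show "A ` (A' ` L) = L" by (simp add: image_image)
  qed
  ultimately show ?thesis
    unfolding isomorphic_varieties_def projective_space_def
    by (intro conjI zclosed_proj sV sW exI[of _ "\<lambda>L. A ` L"] exI[of _ "\<lambda>L. A' ` L"])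
qed


section \<open>The exterior square\<close>

locale alternating_form =
  fixes \<mu> :: "'v::cvector \<Rightarrow> 'v \<Rightarrow> 'w::cvector"
  assumes add_left: "\<mu> (u + v) w = \<mu> u w + \<mu> v w" and add_right: "\<mu> w (u + v) = \<mu> w u + \<mu> w v"
    and scale_left: "\<mu> (c *\<^sub>C u) w = c *\<^sub>C \<mu> u w" and scale_right: "\<mu> w (c *\<^sub>C u) = c *\<^sub>C \<mu> w u"
    and alternating: "\<mu> u u = 0"
begin

text \<open>The formula inside \<open>ext2_lift\<close>. Over an infinite support the sum would be 0
  by convention, so linearity holds only for finitely supported functions, and the following lemmas
  carry finiteness along.\<close>

definition ev :: "('v \<times> 'v \<Rightarrow> complex) \<Rightarrow> 'w"
  where "ev x = (\<Sum>(s, t) | x (s, t) \<noteq> 0. x (s, t) *\<^sub>C \<mu> s t)"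

lemma ev_superset:
  assumes "finite A" "{p. x p \<noteq> 0} \<subseteq> A"
  shows "ev x = (\<Sum>p\<in>A. x p *\<^sub>C \<mu> (fst p) (snd p))"
proof -
  have "ev x = (\<Sum>p\<in>{p. x p \<noteq> 0}. x p *\<^sub>C \<mu> (fst p) (snd p))"
    unfolding ev_def by (intro sum.cong) auto
  also have "\<dots> = (\<Sum>p\<in>A. x p *\<^sub>C \<mu> (fst p) (snd p))"
    by (rule sum.mono_neutral_left[OF assms]) auto
  finally show ?thesis .
qed

lemma ev_combine:
  assumes "finite {p. x p \<noteq> 0}" "finite {p. y p \<noteq> 0}"
  shows "finite {p. (x + c *\<^sub>C y) p \<noteq> 0}" "ev (x + c *\<^sub>C y) = ev x + c *\<^sub>C ev y"
proof -
  let ?A = "{p. x p \<noteq> 0} \<union> {p. y p \<noteq> 0}"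
  have fA: "finite ?A" using assms by simp
  have sub: "{p. (x + c *\<^sub>C y) p \<noteq> 0} \<subseteq> ?A" by (auto simp: cscale_complex)
  show "finite {p. (x + c *\<^sub>C y) p \<noteq> 0}" by (rule finite_subset[OF sub fA])
  have "ev (x + c *\<^sub>C y) = (\<Sum>p\<in>?A. (x + c *\<^sub>C y) p *\<^sub>C \<mu> (fst p) (snd p))" by (rule ev_superset[OF fA sub])
  also have "\<dots> = (\<Sum>p\<in>?A. x p *\<^sub>C \<mu> (fst p) (snd p)) + c *\<^sub>C (\<Sum>p\<in>?A. y p *\<^sub>C \<mu> (fst p) (snd p))"
    by (simp add: cscale_add_left sum.distrib cvec.scale_sum_right cscale_cscale cscale_complex)
  also have "(\<Sum>p\<in>?A. x p *\<^sub>C \<mu> (fst p) (snd p)) = ev x" by (rule ev_superset[OF fA, symmetric]) auto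
  also have "(\<Sum>p\<in>?A. y p *\<^sub>C \<mu> (fst p) (snd p)) = ev y" by (rule ev_superset[OF fA, symmetric]) auto
  finally show "ev (x + c *\<^sub>C y) = ev x + c *\<^sub>C ev y" .
qed

lemma ev_diff:
  assumes "finite {p. x p \<noteq> 0}" "finite {p. y p \<noteq> 0}"
  shows "finite {p. (x - y) p \<noteq> 0}" "ev (x - y) = ev x - ev y"
proof -
  have eq: "x + (-1) *\<^sub>C y = x - y" by (simp add: fun_eq_iff cscale_complex)
  show "finite {p. (x - y) p \<noteq> 0}" using ev_combine(1)[OF assms, of "-1"] unfolding eq .
  show "ev (x - y) = ev x - ev y"
    using ev_combine(2)[OF assms, of "-1"] unfolding eq by (simp add: cvec.scale_minus_left)
qed

lemma ev_scale:
  assumes "finite {p. x p \<noteq> 0}"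
  shows "finite {p. (c *\<^sub>C x) p \<noteq> 0}" "ev (c *\<^sub>C x) = c *\<^sub>C ev x"
proof -
  have 0: "finite {p :: 'v \<times> 'v. (0 :: 'v \<times> 'v \<Rightarrow> complex) p \<noteq> 0}" "ev 0 = 0" by (simp_all add: ev_def)
  show "finite {p. (c *\<^sub>C x) p \<noteq> 0}" "ev (c *\<^sub>C x) = c *\<^sub>C ev x"
    using ev_combine[OF 0(1) assms, of c] unfolding add_0_left 0(2) by simp_all
qed

lemma ev_single: "finite {p. single_pair s t p \<noteq> 0}" "ev (single_pair s t) = \<mu> s t"
proof -
  have sub: "{p. single_pair s t p \<noteq> 0} \<subseteq> {(s, t)}" by (auto simp: single_pair_def)
  show "finite {p. single_pair s t p \<noteq> 0}" by (rule finite_subset[OF sub]) simp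
  show "ev (single_pair s t) = \<mu> s t"
    by (subst ev_superset[OF _ sub]) (simp_all add: single_pair_def cscale_one)
qed

text \<open>The finitely supported functions on which \<open>ev\<close> is 0 form a subspace, and
  each generating relation lies in it by one of the axioms of an alternating form.\<close>

lemma ev_ext2_rel:
  assumes "r \<in> ext2_rel V"
  shows "finite {p. r p \<noteq> 0} \<and> ev r = 0"
proof -
  let ?S = "{r. finite {p. r p \<noteq> 0} \<and> ev r = 0}"
  have "cvec.subspace ?S" unfolding cvec.subspace_def
  proof (intro conjI ballI allI)
    show "0 \<in> ?S" by (simp add: ev_def)
    show "x + y \<in> ?S" if "x \<in> ?S" "y \<in> ?S" for x y using that ev_combine[of x y 1] by (simp add: cscale_one)
    show "c *\<^sub>C x \<in> ?S" if "x \<in> ?S" for c x using that ev_scale[of x c] by simp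
  qed
  then have "ext2_rel V \<subseteq> ?S" unfolding ext2_rel_def
  proof (rule cvec.span_minimal[rotated], intro Un_least subsetI)
    fix x assume "x \<in> {single_pair (u + v) w - single_pair u w - single_pair v w | u v w. u \<in> V \<and> v \<in> V \<and> w \<in> V}"
    then obtain u v w where x: "x = single_pair (u + v) w - single_pair u w - single_pair v w" by blast
    show "x \<in> ?S" unfolding x mem_Collect_eq
      by (intro conjI ev_diff(1) ev_single(1))
        (simp only: ev_diff(2)[OF ev_diff(1)[OF ev_single(1) ev_single(1)] ev_single(1)]
          ev_diff(2)[OF ev_single(1) ev_single(1)] ev_single(2) add_left add_diff_cancel_left' diff_self)
  next
    fix x assume "x \<in> {single_pair w (u + v) - single_pair w u - single_pair w v | u v w. u \<in> V \<and> v \<in> V \<and> w \<in> V}"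
    then obtain u v w where x: "x = single_pair w (u + v) - single_pair w u - single_pair w v" by blast
    show "x \<in> ?S" unfolding x mem_Collect_eq
      by (intro conjI ev_diff(1) ev_single(1))
        (simp only: ev_diff(2)[OF ev_diff(1)[OF ev_single(1) ev_single(1)] ev_single(1)]
          ev_diff(2)[OF ev_single(1) ev_single(1)] ev_single(2) add_right add_diff_cancel_left' diff_self)
  next
    fix x assume "x \<in> {single_pair (c *\<^sub>C u) w - c *\<^sub>C single_pair u w | c u w. u \<in> V \<and> w \<in> V}"
    then obtain c u w where x: "x = single_pair (c *\<^sub>C u) w - c *\<^sub>C single_pair u w" by blast
    show "x \<in> ?S" unfolding x mem_Collect_eq
      by (intro conjI ev_diff(1) ev_scale(1) ev_single(1))
        (simp only: ev_diff(2)[OF ev_single(1) ev_scale(1)[OF ev_single(1)]] ev_scale(2)[OF ev_single(1)]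
          ev_single(2) scale_left diff_self)
  next
    fix x assume "x \<in> {single_pair w (c *\<^sub>C u) - c *\<^sub>C single_pair w u | c u w. u \<in> V \<and> w \<in> V}"
    then obtain c u w where x: "x = single_pair w (c *\<^sub>C u) - c *\<^sub>C single_pair w u" by blast
    show "x \<in> ?S" unfolding x mem_Collect_eq
      by (intro conjI ev_diff(1) ev_scale(1) ev_single(1))
        (simp only: ev_diff(2)[OF ev_single(1) ev_scale(1)[OF ev_single(1)]] ev_scale(2)[OF ev_single(1)]
          ev_single(2) scale_right diff_self)
  next
    fix x assume "x \<in> {single_pair u u | u. u \<in> V}"
    then obtain u where x: "x = single_pair u u" by blast
    show "x \<in> ?S" unfolding x mem_Collect_eq
      by (intro conjI ev_single(1)) (simp add: ev_single alternating)
  qed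
  then show ?thesis using assms by blast
qed

text \<open>All members of the coset have the same value under \<open>ev\<close>, so the image is a
  singleton and \<open>the_elem\<close> is meaningful.\<close>

lemma ext2_lift_wedge: "ext2_lift \<mu> (wedge V s t) = \<mu> s t"
proof -
  have "ev (single_pair s t + r) = \<mu> s t" if "r \<in> ext2_rel V" for r
    using ev_combine(2)[OF ev_single(1), of r s t 1] ev_ext2_rel[OF that] by (simp add: ev_single cscale_one)
  moreover have "0 \<in> ext2_rel V" unfolding ext2_rel_def by (rule cvec.span_zero)
  ultimately have "ev ` wedge V s t = {\<mu> s t}"
    unfolding wedge_def ext2_class_def
    by (auto simp: ev_single intro!: image_eqI[of _ _ "single_pair s t + 0"])
  then show ?thesis unfolding ext2_lift_def ev_def[symmetric] by simp
qed

lemma wedge_nonzero: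
  assumes "\<mu> s t \<noteq> 0"
  shows "wedge V s t \<noteq> ext2_rel V"
proof
  assume eq: "wedge V s t = ext2_rel V"
  have "0 \<in> ext2_rel V" unfolding ext2_rel_def by (rule cvec.span_zero)
  then have "single_pair s t + 0 \<in> wedge V s t" unfolding wedge_def ext2_class_def by blast
  then have "ev (single_pair s t) = 0" unfolding eq using ev_ext2_rel by simp
  then show False using assms by (simp add: ev_single)
qed

end

text \<open>Functionals dual to \<open>s\<close> and \<open>t\<close> give the alternating form
  \<open>l' u * l v - l u * l' v\<close>, which takes the value 1 on the pair; a vanishing wedge
  would force 0.\<close>

lemma wedge_independent:
  assumes "s \<noteq> 0" "t \<notin> cvec.span {s}"
  shows "wedge V s t \<noteq> ext2_rel V"
proof -
  obtain l :: "'a \<Rightarrow> complex" where l: "clin l" "\<And>v. v \<in> cvec.span {s} \<Longrightarrow> l v = 0" "l t = 1"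
    using separating_functional[OF cvec.subspace_span assms(2)] by metis
  have "s \<notin> cvec.span {t}"
  proof
    assume "s \<in> cvec.span {t}"
    then obtain c where c: "s = c *\<^sub>C t" by (auto simp: cvec.span_singleton)
    with assms(1) have "c \<noteq> 0" by auto
    then have "t = (1 / c) *\<^sub>C s" by (simp add: c cscale_cscale cscale_one)
    then show False using assms(2) cvec.span_scale[OF cvec.span_base[of s "{s}"], of "1 / c"] by simp
  qed
  then obtain l' :: "'a \<Rightarrow> complex" where l': "clin l'" "\<And>v. v \<in> cvec.span {t} \<Longrightarrow> l' v = 0" "l' s = 1"
    using separating_functional[OF cvec.subspace_span] by metis
  interpret alternating_form "\<lambda>u v. l' u * l v - l u * l' v"
    by unfold_locales (simp_all add: clinD(1,2)[OF l(1)] clinD(1,2)[OF l'(1)] cscale_complex algebra_simps)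
  have "l s = 0" "l' t = 0" using l(2) l'(2) cvec.span_base by blast+
  then show ?thesis using l(3) l'(3) by (intro wedge_nonzero) simp
qed

lemma wedge_dependent:
  assumes "s \<in> V"
  shows "wedge V s (c *\<^sub>C s) = ext2_rel V"
proof -
  have sub: "cvec.subspace (ext2_rel V)" unfolding ext2_rel_def by (rule cvec.subspace_span)
  have 1: "single_pair s (c *\<^sub>C s) - c *\<^sub>C single_pair s s \<in> ext2_rel V"
    unfolding ext2_rel_def by (rule cvec.span_base) (use assms in blast)
  have 2: "single_pair s s \<in> ext2_rel V" unfolding ext2_rel_def by (rule cvec.span_base) (use assms in blast)
  have "single_pair s (c *\<^sub>C s) - c *\<^sub>C single_pair s s + c *\<^sub>C single_pair s s \<in> ext2_rel V"
    by (rule cvec.subspace_add[OF sub 1 cvec.subspace_scale[OF sub 2]])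
  then have r: "single_pair s (c *\<^sub>C s) \<in> ext2_rel V" by (simp only: diff_add_cancel)
  show ?thesis unfolding wedge_def ext2_class_def
  proof (intro equalityI subsetI)
    fix x assume "x \<in> {single_pair s (c *\<^sub>C s) + r |r. r \<in> ext2_rel V}"
    then obtain r' where "x = single_pair s (c *\<^sub>C s) + r'" "r' \<in> ext2_rel V" by blast
    then show "x \<in> ext2_rel V" using cvec.subspace_add[OF sub r] by blast
  next
    fix x assume "x \<in> ext2_rel V"
    then have "x - single_pair s (c *\<^sub>C s) \<in> ext2_rel V" using cvec.subspace_diff[OF sub _ r] by blast
    moreover have "x = single_pair s (c *\<^sub>C s) + (x - single_pair s (c *\<^sub>C s))" by simp
    ultimately show "x \<in> {single_pair s (c *\<^sub>C s) + r |r. r \<in> ext2_rel V}" by blast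
  qed
qed

lemma wedge_in_ext2:
  assumes "s \<in> V" "t \<in> V"
  shows "wedge V s t \<in> ext2 V"
  unfolding wedge_def ext2_def by (intro imageI cvec.span_base) (use assms in blast)

section \<open>Resonance in terms of pairs of sections\<close>

lemma second_det_map_wedge: "second_det_map (wedge V s t) = (\<lambda>x. fst s x * snd t x - snd s x * fst t x)"
proof -
  interpret alternating_form "\<lambda>s t x. fst s x * snd t x - snd s x * fst t x :: complex"
    by unfold_locales (simp_all add: fun_eq_iff cscale_prod_def cscale_complex algebra_simps)
  show ?thesis unfolding second_det_map_def by (rule ext2_lift_wedge)
qed

text \<open>A spanning vector of a line is nonzero, and for nonzero \<open>s\<close> the wedge with
  \<open>t\<close> is zero exactly when \<open>t\<close> is a multiple of \<open>s\<close>. The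
  quotient construction of the exterior square disappears from here on.\<close>

lemma mem_resonance_iff:
  "L \<in> resonance C Z D1 D2 \<longleftrightarrow> L \<in> proj (sum_sections C Z D1 D2) \<and>
    (\<exists>s\<in>sum_sections C Z D1 D2. \<exists>t\<in>sum_sections C Z D1 D2. L = cvec.span {s} \<and> t \<notin> cvec.span {s} \<and>
      (\<forall>x. fst s x * snd t x = snd s x * fst t x))"
proof -
  let ?H = "sum_sections C Z D1 D2"
  have "wedge ?H s t \<noteq> ext2_rel ?H \<and> wedge ?H s t \<in> {\<xi> \<in> ext2 ?H. second_det_map \<xi> = 0} \<longleftrightarrow>
    t \<notin> cvec.span {s} \<and> (\<forall>x. fst s x * snd t x = snd s x * fst t x)"
    if L: "L \<in> proj ?H" "s \<in> ?H" "t \<in> ?H" "L = cvec.span {s}" for s t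
  proof -
    have "s \<noteq> 0"
    proof
      assume "s = 0"
      then have "L \<subseteq> {0}" unfolding L(4) by (simp add: cvec.span_singleton image_subset_iff)
      then show False using rep_in[OF L(1)] rep_nonzero[OF L(1)] by blast
    qed
    have "wedge ?H s t \<noteq> ext2_rel ?H \<longleftrightarrow> t \<notin> cvec.span {s}"
    proof
      show "t \<notin> cvec.span {s}" if "wedge ?H s t \<noteq> ext2_rel ?H"
        using that wedge_dependent[OF L(2)] unfolding cvec.span_singleton by blast
      show "wedge ?H s t \<noteq> ext2_rel ?H" if "t \<notin> cvec.span {s}"
        by (rule wedge_independent[OF \<open>s \<noteq> 0\<close> that])
    qed
    moreover have "second_det_map (wedge ?H s t) = 0 \<longleftrightarrow> (\<forall>x. fst s x * snd t x = snd s x * fst t x)"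
      unfolding second_det_map_wedge by (simp add: fun_eq_iff)
    ultimately show ?thesis using wedge_in_ext2[OF L(2,3)] by blast
  qed
  then show ?thesis unfolding resonance_def Let_def by blast
qed

section \<open>The resonance variety\<close>

context elliptic
begin

lemma section_const_swap:
  assumes P: "P \<in> C" and Q: "Q \<in> C" and a: "a \<le> 1" and f: "f \<in> sections_of C {P, Q} (point_divisor a P)"
  shows "\<exists>c. f = const_section P Q c"
proof -
  have eq: "{P, Q} = {Q, P}" by (rule insert_commute)
  obtain c where "f = const_section Q P c" using section_const[OF Q P a] f unfolding eq by blast
  then have "f = const_section P Q c" unfolding const_section_def eq .
  then show ?thesis by blast
qed

lemma sections_swap_subspace:
  "P \<in> C \<Longrightarrow> Q \<in> C \<Longrightarrow> cvec.subspace (sections_of C {P, Q} (point_divisor a P))"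
  using sections_subspace[of Q P a] by (simp only: insert_commute)

text \<open>The first components are constants, so the determinant equation can be divided by them:
  a nonzero one would make the two sections proportional. Hence both first components
  vanish.\<close>

lemma resonance_section:
  assumes P: "P \<in> C" and Q: "Q \<in> C" and a: "a \<le> 1"
    and L: "L \<in> resonance C {P, Q} (point_divisor a P) (point_divisor b Q)"
  shows "\<exists>s t. L = cvec.span {(0, s)} \<and> s \<noteq> 0 \<and> s \<in> sections_of C {P, Q} (point_divisor b Q) \<and>
    t \<in> sections_of C {P, Q} (point_divisor b Q) \<and> t \<notin> cvec.span {s}"
proof -
  let ?L1 = "sections_of C {P, Q} (point_divisor a P)" and ?L2 = "sections_of C {P, Q} (point_divisor b Q)"
  from L[unfolded mem_resonance_iff sum_sections_def] obtain s1 s2 t1 t2 where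
    LP: "L \<in> proj (?L1 \<times> ?L2)" and mem: "s1 \<in> ?L1" "s2 \<in> ?L2" "t1 \<in> ?L1" "t2 \<in> ?L2"
    and span: "L = cvec.span {(s1, s2)}" "(t1, t2) \<notin> cvec.span {(s1, s2)}"
    and det: "\<And>x. s1 x * t2 x = s2 x * t1 x"
    by force
  obtain \<alpha> \<beta> where c: "s1 = const_section P Q \<alpha>" "t1 = const_section P Q \<beta>"
    using section_const_swap[OF P Q a] mem(1,3) by blast
  have zero: "f x = 0" if "f \<in> ?L2" "x \<notin> C - {P, Q}" for f x
    using that unfolding sections_of_def by blast
  have indep: "(t1, t2) \<noteq> k *\<^sub>C (s1, s2)" for k
    using span(2) cvec.span_scale[OF cvec.span_base[of "(s1, s2)" "{(s1, s2)}"], of k] by auto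
  have "\<alpha> = 0"
  proof (rule ccontr)
    assume \<alpha>: "\<alpha> \<noteq> 0"
    \<comment> \<open>With \<open>s1\<close> a nonzero constant, the determinant equation gives the
      same factor for the second components as for the first. At \<open>P\<close> and
      \<open>Q\<close>, where the constants are stored as 0, the second components are 0 by
      convention.\<close>
    have "t1 x = (\<beta> / \<alpha>) * s1 x" for x using \<alpha> by (simp add: c const_section_def)
    moreover have "t2 x = (\<beta> / \<alpha>) * s2 x" for x
    proof (cases "x \<in> C - {P, Q}")
      case True
      then have "\<alpha> * t2 x = s2 x * \<beta>" using det[of x] by (simp add: c const_section_def)
      then show ?thesis using \<alpha> by (simp add: field_simps)
    next
      case False
      show ?thesis unfolding zero[OF mem(2) False] zero[OF mem(4) False] by simp
    qed
    ultimately have "(t1, t2) = (\<beta> / \<alpha>) *\<^sub>C (s1, s2)"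
      by (simp add: cscale_prod_def fun_eq_iff cscale_complex)
    then show False using indep by blast
  qed
  then have s1: "s1 = 0" by (simp add: c const_section_def fun_eq_iff)
  have "s2 \<noteq> 0"
  proof
    assume "s2 = 0"
    then have "L = {0}" unfolding span(1) s1 by (simp add: zero_prod_def[symmetric] cvec.span_singleton)
    then show False using rep_in[OF LP] rep_nonzero[OF LP] by blast
  qed
  then obtain x where x: "s2 x \<noteq> 0" by (auto simp: fun_eq_iff)
  \<comment> \<open>A point where \<open>s2\<close> is nonzero is off \<open>P\<close> and
    \<open>Q\<close>, so \<open>t1\<close> takes its true constant value there and the determinant
    equation forces that constant to be 0.\<close>
  then have "x \<in> C - {P, Q}" using zero mem(2) by blast
  then have "\<beta> = 0" using det[of x] x by (simp add: s1 c(2) const_section_def)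
  then have t1: "t1 = 0" by (simp add: c const_section_def fun_eq_iff)
  have "t2 \<notin> cvec.span {s2}"
  proof
    assume "t2 \<in> cvec.span {s2}"
    then obtain k where "t2 = k *\<^sub>C s2" unfolding cvec.span_singleton by blast
    then have "(t1, t2) = k *\<^sub>C (s1, s2)" by (simp add: s1 t1 cscale_prod_def cvec.scale_zero_right)
    then show False using indep by blast
  qed
  then show ?thesis using span(1) mem \<open>s2 \<noteq> 0\<close> unfolding s1 by blast
qed

text \<open>Both second components would be constants, and two constants are never
  independent.\<close>

lemma resonance_empty:
  assumes P: "P \<in> C" and Q: "Q \<in> C" and a: "a \<le> 1" and b: "b \<le> 1"
  shows "resonance C {P, Q} (point_divisor a P) (point_divisor b Q) = {}"
proof (rule equals0I)
  fix L assume "L \<in> resonance C {P, Q} (point_divisor a P) (point_divisor b Q)"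
  from resonance_section[OF P Q a this] obtain s t where st: "s \<noteq> 0" "t \<notin> cvec.span {s}"
    "s \<in> sections_of C {P, Q} (point_divisor b Q)" "t \<in> sections_of C {P, Q} (point_divisor b Q)" by blast
  obtain \<alpha> \<beta> where c: "s = const_section P Q \<alpha>" "t = const_section P Q \<beta>"
    using section_const[OF P Q b] st(3,4) by blast
  have "\<alpha> \<noteq> 0" using st(1) by (auto simp: c const_section_def fun_eq_iff)
  then have "t = (\<beta> / \<alpha>) *\<^sub>C s" by (simp add: c const_section_def fun_eq_iff cscale_complex)
  then show False using st(2) cvec.span_scale[OF cvec.span_base[of s "{s}"], of "\<beta> / \<alpha>"] by simp
qed

text \<open>Every determinant of two sections of the second summand is 0, so a line in that summand
  is resonant as soon as some section is independent from it; dimension at least two provides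
  one.\<close>

lemma resonance_eq_proj:
  assumes P: "P \<in> C" and Q: "Q \<in> C" and a: "a \<le> 1" and b: "b \<ge> 2"
    and B: "cvec.independent B" "card B = nat b" "cvec.span B = sections_of C {P, Q} (point_divisor b Q)"
  shows "resonance C {P, Q} (point_divisor a P) (point_divisor b Q) =
    proj ({0} \<times> sections_of C {P, Q} (point_divisor b Q))"
proof -
  let ?L1 = "sections_of C {P, Q} (point_divisor a P)" and ?L2 = "sections_of C {P, Q} (point_divisor b Q)"
  have sub2: "cvec.subspace ?L2" by (rule sections_subspace[OF P Q])
  have zero1: "0 \<in> ?L1" by (rule cvec.subspace_0[OF sections_swap_subspace[OF P Q]])
  have sub: "cvec.subspace ({0} \<times> ?L2)"
    using sub2 unfolding cvec.subspace_def
    by (auto simp: zero_prod_def cscale_prod_def cvec.scale_zero_right)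
  show ?thesis
  proof (intro equalityI subsetI)
    fix L assume "L \<in> resonance C {P, Q} (point_divisor a P) (point_divisor b Q)"
    from resonance_section[OF P Q a this] obtain s where s: "L = cvec.span {(0, s)}" "s \<noteq> 0" "s \<in> ?L2" by blast
    show "L \<in> proj ({0} \<times> ?L2)" unfolding s(1)
      by (rule span_in_proj[OF sub]) (use s(2,3) in \<open>auto simp: zero_prod_def\<close>)
  next
    let ?z = "0 :: (nat \<Rightarrow> complex) set \<Rightarrow> complex"
    fix L assume L: "L \<in> proj ({?z} \<times> ?L2)"
    then have L0: "L \<subseteq> {0} \<times> ?L2" by (simp add: proj_def)
    then obtain s where s: "rep L = (0, s)" "s \<in> ?L2" using rep_in[OF L] by blast
    have span: "L = cvec.span {(0, s)}" using proj_eq_span[OF L rep_in[OF L] rep_nonzero[OF L]] unfolding s(1) .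
    \<comment> \<open>This is where the dimension count enters: an independent set of
      \<open>b\<close> elements does not fit into a line when \<open>b\<close> is at least
      2.\<close>
    have "\<not> ?L2 \<subseteq> cvec.span {s}"
    proof
      assume "?L2 \<subseteq> cvec.span {s}"
      then have "B \<subseteq> cvec.span {s}" using cvec.span_superset[of B] unfolding B(3) by (rule subset_trans[rotated])
      from cvec.independent_span_bound[OF _ B(1) this] have "nat b \<le> 1" using B(2) by simp
      then show False using b by linarith
    qed
    then obtain t where t: "t \<in> ?L2" "t \<notin> cvec.span {s}" by blast
    have "(?z, t) \<notin> cvec.span {(?z, s)}"
    proof
      assume "(?z, t) \<in> cvec.span {(?z, s)}"
      then obtain k where "(?z, t) = k *\<^sub>C (?z, s)" unfolding cvec.span_singleton by blast
      then have "t = k *\<^sub>C s" by (simp add: cscale_prod_def)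
      then show False using t(2) cvec.span_scale[OF cvec.span_base[of s "{s}"], of k] by simp
    qed
    moreover have "L \<in> proj (?L1 \<times> ?L2)" using L zero1 unfolding proj_def by blast
    ultimately show "L \<in> resonance C {P, Q} (point_divisor a P) (point_divisor b Q)"
      unfolding mem_resonance_iff sum_sections_def using zero1 s(2) t(1) span
      by (intro conjI bexI[of _ "(0, s)"] bexI[of _ "(0, t)"]) simp_all
  qed
qed

lemma resonance_isomorphic:
  assumes P: "P \<in> C" and Q: "Q \<in> C" and a: "a \<le> 1" and b: "b \<ge> 2"
  shows "isomorphic_varieties (resonance C {P, Q} (point_divisor a P) (point_divisor b Q))
    (projective_space (nat (b - 1)))"
proof -
  have nb: "1 \<le> nat b" "int (nat b) = b" using b by auto
  from sections_basis[OF P Q nb(1)] obtain B where B: "finite B" "card B = nat b" "cvec.independent B"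
    "cvec.span B = sections_of C {P, Q} (point_divisor b Q)" unfolding nb(2) by blast
  let ?i = "\<lambda>f :: (nat \<Rightarrow> complex) set \<Rightarrow> complex. (0 :: (nat \<Rightarrow> complex) set \<Rightarrow> complex, f)"
  have i: "clin ?i" by (intro clinI) (simp_all add: cscale_prod_def cvec.scale_zero_right)
  have "cvec.span (?i ` B) = ?i ` cvec.span B" by (rule cvp.linear_span_image[OF i])
  also have "\<dots> = {0} \<times> sections_of C {P, Q} (point_divisor b Q)" unfolding B(4) by auto
  finally have sp: "cvec.span (?i ` B) = {0} \<times> sections_of C {P, Q} (point_divisor b Q)" .
  have "cvec.independent (?i ` B)"
    by (rule cvp.linear_independent_injective_image[OF i B(3)]) (simp add: inj_on_def)
  \<comment> \<open>The projective space of dimension \<open>b - 1\<close> has \<open>b\<close>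
    homogeneous coordinates, one for each basis section.\<close>
  moreover have "card (?i ` B) = Suc (nat (b - 1))"
    using B(2) b by (subst card_image) (auto simp: inj_on_def)
  ultimately have "isomorphic_varieties (proj (cvec.span (?i ` B))) (projective_space (nat (b - 1)))"
    using B(1) by (intro isomorphic_projective_space finite_imageI)
  then show ?thesis unfolding sp resonance_eq_proj[OF P Q a b B(3,2,4)] .
qed

end

theorem proposition3p6:
  fixes C :: "(nat \<Rightarrow> complex) set set" and P Q :: "(nat \<Rightarrow> complex) set" and a b :: int
  assumes "elliptic_curve C" and "P \<in> C" and "Q \<in> C" and "a \<le> b" and "a \<le> 1"
  shows "(b < 2 \<longrightarrow> resonance C {P, Q} (point_divisor a P) (point_divisor b Q) = {}) \<and>
         (b \<ge> 2 \<longrightarrow> isomorphic_varieties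
            (resonance C {P, Q} (point_divisor a P) (point_divisor b Q))
            (projective_space (nat (b - 1))))"
proof -
  obtain n where "C \<subseteq> projective_space n"
    using assms(1) unfolding elliptic_curve_def smooth_projective_curve_def by blast
  with assms(1) interpret elliptic C n
    by unfold_locales (simp_all add: elliptic_curve_def smooth_projective_curve_def)
  show ?thesis
    using resonance_empty[OF assms(2,3,5)] resonance_isomorphic[OF assms(2,3,5)] by simp
qed

end
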